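(* Let $(f_t)$ be a Loewner chain and $(\varphi_{s,t})$ its evolution family, i.e. $\varphi_{s,t}=f_t^{-1}\circ f_s$ for $t\ge s\ge0$. Suppose there exists $t_0\ge0$ such that the map $f_{t_0}$ has a simple pole (in the angular sense) at a point $\sigma\in\mathbb{T}=\partial\mathbb{D}$. Then the following two conditions are equivalent: (i) for every $s\ge0$ the following assertions hold: (i.1) the map $f_s$ has a simple pole at the point $\sigma$; (i.2) $\displaystyle\limsup_{t\to s^+}\big|\arg\big(\mathrm{Res}(f_s;\sigma)/\mathrm{Res}(f_t;\sigma)\big)\big|<\pi$; (ii) the evolution family $(\varphi_{s,t})$ has a boundary regular fixed point at $\sigma$. Moreover, if conditions (i) and (ii) above hold, then (iii) the function $t\mapsto\mathrm{Res}(f_t;\sigma)$ is locally absolutely continuous on $[0,+\infty)$, with $\arg\big(\mathrm{Res}(f_t;\sigma)\big)$ being constant.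
   Context: $\mathbb{D}$ is the open unit disc of $\mathbb{C}$; $\angle\lim$ denotes the angular (non-tangential) limit; $\mathbb{C}^*=\mathbb{C}\setminus\{0\}$; $\arg$ in (i.2) is the principal value with values in $(-\pi,\pi]$. Simple pole in the angular sense: $f:\mathbb{D}\to\mathbb{C}$ has a simple pole at $\sigma\in\mathbb{T}$ if $\angle\lim_{z\to\sigma}(z-\sigma)f(z)$ exists and belongs to $\mathbb{C}^*$; this limit is denoted $\mathrm{Res}(f;\sigma)$ (the residue of $f$ at $\sigma$). Loewner chain of order $d\in[1,+\infty]$: a family $(f_t)_{t\ge0}$ of univalent holomorphic maps $f_t:\mathbb{D}\to\mathbb{C}$ with $f_s(\mathbb{D})\subset f_t(\mathbb{D})$ for $s<t$, such that for any compact $K\subset\mathbb{D}$ and $T>0$ there is a non-negative $k_{K,T}\in L^d([0,T],\mathbb{R})$ with $|f_s(z)-f_t(z)|\le\int_s^t k_{K,T}(\xi)\,d\xi$ for $z\in K$, $0\le s\le t\le T$. A "Loewner chain" with no order mentioned is one of some order $d\in[1,+\infty]$. Evolution family of order $d\in[1,+\infty]$: a family $(\varphi_{s,t})_{0\le s\le t<+\infty}$ of holomorphic self-maps of $\mathbb{D}$ with $\varphi_{s,s}=\mathrm{id}_{\mathbb{D}}$, $\varphi_{s,t}=\varphi_{u,t}\circ\varphi_{s,u}$ for $0\le s\le u\le t$, and such that for any $z\in\mathbb{D}$ and $T>0$ there is a non-negative $k_{z,T}\in L^d([0,T],\mathbb{R})$ with $|\varphi_{s,u}(z)-\varphi_{s,t}(z)|\le\int_u^t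 k_{z,T}(\xi)\,d\xi$ for $0\le s\le u\le t\le T$. For a Loewner chain $(f_t)$ of order $d$, the maps $f_t^{-1}\circ f_s$ form an evolution family of order $d$, called the evolution family of $(f_t)$. Boundary regular fixed point: $\sigma$ is a boundary regular fixed point of a holomorphic $\varphi:\mathbb{D}\to\mathbb{D}$ if $\angle\lim_{z\to\sigma}\varphi(z)=\sigma$ and $\angle\lim_{z\to\sigma}\frac{\varphi(z)-\sigma}{z-\sigma}$ exists finitely. It is a boundary regular fixed point of $(\varphi_{s,t})$ if it is one for $\varphi_{s,t}$ for all $t\ge s\ge0$. *)

theory Defs
  imports "HOL-Analysis.Analysis"
begin

abbreviation unit_disc :: "complex set" ("\<bbbD>") where
  "\<bbbD> \<equiv> ball 0 1"

definition stolz_region :: "complex \<Rightarrow> real \<Rightarrow> complex set" where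
  "stolz_region \<sigma> M = {z \<in> \<bbbD>. dist z \<sigma> < M * (1 - norm z)}"

(* Convergence along this filter is angular (non-tangential) convergence at \<sigma>, i.e.
   convergence within each Stolz region with vertex \<sigma>; the supremum of filters requires
   convergence along each of them, see tendsto_angular_at_iff. *)
definition angular_at :: "complex \<Rightarrow> complex filter" where
  "angular_at \<sigma> = (SUP M\<in>{1<..}. at \<sigma> within stolz_region \<sigma> M)"

lemma tendsto_angular_at_iff:
  "(f \<longlongrightarrow> l) (angular_at \<sigma>) \<longleftrightarrow>
     (\<forall>M>1. (f \<longlongrightarrow> l) (at \<sigma> within stolz_region \<sigma> M))"
  by (auto simp: angular_at_def tendsto_def eventually_Sup)

lemma angular_at_neq_bot:
  assumes "norm \<sigma> = 1"
  shows "angular_at \<sigma> \<noteq> bot"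
proof -
  have "\<sigma> islimpt stolz_region \<sigma> 2"
    unfolding islimpt_approachable
  proof (intro allI impI)
    fix e :: real assume "e > 0"
    define r where "r = min (1/2) (e/2)"
    have r: "0 < r" "r < 1" "r < e" using \<open>e > 0\<close> by (auto simp: r_def min_def)
    define z where "z = of_real (1 - r) * \<sigma>"
    have nz: "norm z = 1 - r" using r assms by (simp add: z_def norm_mult del: of_real_diff)
    have "z - \<sigma> = - (of_real r * \<sigma>)" by (simp add: z_def algebra_simps)
    hence d: "dist z \<sigma> = r" using r assms by (simp add: dist_norm norm_mult)
    show "\<exists>x'\<in>stolz_region \<sigma> 2. x' \<noteq> \<sigma> \<and> dist x' \<sigma> < e"
      using r nz d by (intro bexI[of _ z]) (auto simp: stolz_region_def)
  qed
  hence "at \<sigma> within stolz_region \<sigma> 2 \<noteq> bot" by (simp add: trivial_limit_within)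
  moreover have "at \<sigma> within stolz_region \<sigma> 2 \<le> angular_at \<sigma>"
    unfolding angular_at_def by (rule SUP_upper) simp
  ultimately show ?thesis by (metis bot.extremum_uniqueI)
qed

definition angular_residue :: "(complex \<Rightarrow> complex) \<Rightarrow> complex \<Rightarrow> complex" where
  "angular_residue f \<sigma> = Lim (angular_at \<sigma>) (\<lambda>z. (z - \<sigma>) * f z)"

definition has_angular_simple_pole :: "(complex \<Rightarrow> complex) \<Rightarrow> complex \<Rightarrow> bool" where
  "has_angular_simple_pole f \<sigma> \<longleftrightarrow>
     (\<exists>c. c \<noteq> 0 \<and> ((\<lambda>z. (z - \<sigma>) * f z) \<longlongrightarrow> c) (angular_at \<sigma>))"

lemma angular_residue_eqI:
  assumes "norm \<sigma> = 1" "((\<lambda>z. (z - \<sigma>) * f z) \<longlongrightarrow> c) (angular_at \<sigma>)"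
  shows "angular_residue f \<sigma> = c"
  unfolding angular_residue_def using assms by (intro tendsto_Lim angular_at_neq_bot)

(* Membership of k in L^d([0,T]). *)
definition in_Ld :: "ennreal \<Rightarrow> real \<Rightarrow> (real \<Rightarrow> real) \<Rightarrow> bool" where
  "in_Ld d T k \<longleftrightarrow> k \<in> borel_measurable (lebesgue_on {0..T}) \<and>
     (if d = \<infinity> then \<exists>C. AE x in lebesgue_on {0..T}. \<bar>k x\<bar> \<le> C
      else integrable (lebesgue_on {0..T}) (\<lambda>x. \<bar>k x\<bar> powr enn2real d))"

(* Maps on the disc are total functions on \<complex>, and families indexed by [0,\<infinity>) are total
   functions on \<real>; values outside \<bbbD> or at negative times are irrelevant. *)
definition loewner_chain_of_order :: "ennreal \<Rightarrow> (real \<Rightarrow> complex \<Rightarrow> complex) \<Rightarrow> bool" where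
  "loewner_chain_of_order d f \<longleftrightarrow>
     (\<forall>t\<ge>0. f t holomorphic_on \<bbbD> \<and> inj_on (f t) \<bbbD>) \<and>
     (\<forall>s t. 0 \<le> s \<and> s < t \<longrightarrow> f s ` \<bbbD> \<subseteq> f t ` \<bbbD>) \<and>
     (\<forall>K T. compact K \<and> K \<subseteq> \<bbbD> \<and> 0 < T \<longrightarrow>
        (\<exists>k. in_Ld d T k \<and> (\<forall>\<xi>\<in>{0..T}. 0 \<le> k \<xi>) \<and>
           (\<forall>z\<in>K. \<forall>s t. 0 \<le> s \<and> s \<le> t \<and> t \<le> T \<longrightarrow>
              norm (f s z - f t z) \<le> integral\<^sup>L (lebesgue_on {s..t}) k)))"

definition loewner_chain :: "(real \<Rightarrow> complex \<Rightarrow> complex) \<Rightarrow> bool" where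
  "loewner_chain f \<longleftrightarrow> (\<exists>d\<ge>1. loewner_chain_of_order d f)"

definition evolution_family_of ::
    "(real \<Rightarrow> complex \<Rightarrow> complex) \<Rightarrow> real \<Rightarrow> real \<Rightarrow> complex \<Rightarrow> complex" where
  "evolution_family_of f s t = inv_into \<bbbD> (f t) \<circ> f s"

definition boundary_regular_fixed_point :: "(complex \<Rightarrow> complex) \<Rightarrow> complex \<Rightarrow> bool" where
  "boundary_regular_fixed_point \<phi> \<sigma> \<longleftrightarrow>
     (\<phi> \<longlongrightarrow> \<sigma>) (angular_at \<sigma>) \<and>
     (\<exists>l. ((\<lambda>z. (\<phi> z - \<sigma>) / (z - \<sigma>)) \<longlongrightarrow> l) (angular_at \<sigma>))"

definition family_boundary_regular_fixed_point ::
    "(real \<Rightarrow> real \<Rightarrow> complex \<Rightarrow> complex) \<Rightarrow> complex \<Rightarrow> bool" where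
  "family_boundary_regular_fixed_point \<phi> \<sigma> \<longleftrightarrow>
     (\<forall>s t. 0 \<le> s \<and> s \<le> t \<longrightarrow> boundary_regular_fixed_point (\<phi> s t) \<sigma>)"

(* The epsilon-delta definition over finite systems of non-overlapping intervals. *)
definition abs_continuous_on_interval ::
    "real \<Rightarrow> real \<Rightarrow> (real \<Rightarrow> 'a::real_normed_vector) \<Rightarrow> bool" where
  "abs_continuous_on_interval a b g \<longleftrightarrow>
     (\<forall>\<epsilon>>0. \<exists>\<delta>>0. \<forall>(n::nat) u v.
        (\<forall>i<n. a \<le> u i \<and> u i \<le> v i \<and> v i \<le> b) \<and>
        disjoint_family_on (\<lambda>i. {u i<..<v i}) {..<n} \<and>
        (\<Sum>i<n. v i - u i) < \<delta> \<longrightarrow>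
        (\<Sum>i<n. norm (g (v i) - g (u i))) < \<epsilon>)"

definition locally_abs_continuous_on_nonneg :: "(real \<Rightarrow> 'a::real_normed_vector) \<Rightarrow> bool" where
  "locally_abs_continuous_on_nonneg g \<longleftrightarrow>
     (\<forall>a b. 0 \<le> a \<and> a \<le> b \<longrightarrow> abs_continuous_on_interval a b g)"

end

theory Submission
  imports Defs "HOL-Complex_Analysis.Complex_Analysis"
begin

text \<open>
  The Cayley transform sends \<open>\<sigma>\<close> to \<open>\<infinity>\<close> and the disc to the right half-plane. Simple poles become maps
  \<open>g t\<close> with \<open>g t w / w \<longlongrightarrow> a t \<noteq> 0\<close> in sectors, and \<open>\<sigma>\<close> is a boundary regular fixed point of a self-map
  \<open>h\<close> iff \<open>h w / w \<longlongrightarrow> c\<close> with \<open>c > 0\<close> (Julia--Wolff--Caratheodory).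

  If \<open>a s / a t\<close> is not negative, the image sectors of \<open>g s\<close> and \<open>g t\<close> overlap, which forces the
  transition map to satisfy \<open>c = a s / a t > 0\<close>. Hence (i) propagates \<open>c > 0\<close> to the right of
  every time. The delicate point is a limit \<open>u \<rightarrow> t\<close> from the left with \<open>a u / a t < 0\<close>. It is excluded by
  a length-area argument: the transition map takes the positive axis to a curve ending at \<open>\<infinity>\<close>, along
  which \<open>g u\<close> stays near the ray of direction \<open>a u\<close>; since \<open>g u\<close> is close to \<open>g t\<close>, this curve has to
  reach \<open>\<infinity>\<close> through a thin neighbourhood of the boundary, where \<open>g u\<close> then has too large an image.

  For (iii), \<open>Re h / c\<close> is monotone in time by Julia's inequality, and its relative increment
  along \<open>x \<rightarrow> \<infinity>\<close> tends to zero; so \<open>1 / c\<close> is approximated in variation by absolutely continuous functions.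
\<close>

section \<open>Absolutely continuous functions\<close>

text \<open>The obstacle at left limits is a lack of uniformity: as u tends to t, \<open>g u\<close>
  converges to \<open>g t\<close> on compact sets only, which says nothing about slopes at infinity.
  The link between times is \<open>g u (h u z) = g s z\<close>: the curve \<open>h u x\<close>
  depends on u, its image under \<open>g u\<close> does not. In logarithmic coordinates arcs about 0
  become vertical segments, and the parts of such a segment outside a fixed compact range of angles
  have total length at most 2/1000. By Cauchy-Schwarz, long images of such short pieces would need
  more area than a bounded univalent image has.

  The number c (\<open>dilation\<close>) is the reciprocal of the angular derivative at \<sigma>; it
  exists for every transition map and is 0 exactly when \<sigma> is not a boundary regular fixed
  point. So (ii) means that all dilations are positive. Under (i), positivity can fail only if
  \<open>a s / a t\<close> is real and negative, which (i.2) excludes just to the right of each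
  time. Once it holds throughout, every residue is one fixed number divided by
  \<open>dilation 0 t\<close>, and (iii) concerns this positive function alone.\<close>

lemma abs_continuous_on_intervalD:
  assumes "abs_continuous_on_interval a b F" "0 < e"
  obtains d where "0 < d" "\<And>(n::nat) u v. (\<And>i. i < n \<Longrightarrow> a \<le> u i \<and> u i \<le> v i \<and> v i \<le> b) \<Longrightarrow>
      disjoint_family_on (\<lambda>i. {u i<..<v i}) {..<n} \<Longrightarrow> (\<Sum>i<n. v i - u i) < d \<Longrightarrow>
      (\<Sum>i<n. norm (F (v i) - F (u i))) < e"
proof -
  obtain d where d: "0 < d" "\<forall>(n::nat) u v. (\<forall>i<n. a \<le> u i \<and> u i \<le> v i \<and> v i \<le> b) \<and>
      disjoint_family_on (\<lambda>i. {u i<..<v i}) {..<n} \<and> (\<Sum>i<n. v i - u i) < d \<longrightarrow>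
      (\<Sum>i<n. norm (F (v i) - F (u i))) < e"
    using assms unfolding abs_continuous_on_interval_def by blast
  show ?thesis by (rule that[OF d(1)]) (use d(2) in blast)
qed

lemma abs_continuous_on_intervalI:
  assumes "\<And>e. 0 < e \<Longrightarrow> \<exists>d>0. \<forall>(n::nat) u v. (\<forall>i<n. a \<le> u i \<and> u i \<le> v i \<and> v i \<le> b) \<longrightarrow>
      disjoint_family_on (\<lambda>i. {u i<..<v i}) {..<n} \<longrightarrow> (\<Sum>i<n. v i - u i) < d \<longrightarrow>
      (\<Sum>i<n. norm (F (v i) - F (u i))) < e"
  shows "abs_continuous_on_interval a b F"
  unfolding abs_continuous_on_interval_def using assms by (simp add: imp_conjL)

lemma abs_continuous_on_interval_imp_uniform:
  assumes "abs_continuous_on_interval a b F" "0 < e"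
  obtains d where "0 < d" "\<And>u v. a \<le> u \<Longrightarrow> u \<le> v \<Longrightarrow> v \<le> b \<Longrightarrow> v - u < d \<Longrightarrow> norm (F v - F u) < e"
proof -
  obtain d where d: "0 < d" "\<And>(n::nat) u v. (\<And>i. i < n \<Longrightarrow> a \<le> u i \<and> u i \<le> v i \<and> v i \<le> b) \<Longrightarrow>
      disjoint_family_on (\<lambda>i. {u i<..<v i}) {..<n} \<Longrightarrow> (\<Sum>i<n. v i - u i) < d \<Longrightarrow>
      (\<Sum>i<n. norm (F (v i) - F (u i))) < e"
    by (rule abs_continuous_on_intervalD[OF assms]) blast
  show ?thesis
  proof (rule that[OF d(1)])
    fix u v assume "a \<le> u" "u \<le> v" "v \<le> b" "v - u < d"
    thus "norm (F v - F u) < e"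
      using d(2)[of 1 "\<lambda>_. u" "\<lambda>_. v"] by (simp add: disjoint_family_on_def)
  qed
qed

lemma abs_continuous_on_interval_dominated:
  fixes G :: "real \<Rightarrow> 'a::real_normed_vector" and F :: "real \<Rightarrow> 'b::real_normed_vector"
  assumes G: "abs_continuous_on_interval a b G"
    and dom: "\<And>u v. a \<le> u \<Longrightarrow> u \<le> v \<Longrightarrow> v \<le> b \<Longrightarrow> norm (F v - F u) \<le> C * norm (G v - G u)"
  shows "abs_continuous_on_interval a b F"
proof (rule abs_continuous_on_intervalI)
  fix e :: real assume e: "0 < e"
  define C' where "C' = max C 1"
  have C': "0 < C'" "C \<le> C'" by (auto simp: C'_def)
  have eC: "0 < e / C'" using e C' by simp
  obtain d where d: "0 < d" "\<And>(n::nat) u v. (\<And>i. i < n \<Longrightarrow> a \<le> u i \<and> u i \<le> v i \<and> v i \<le> b) \<Longrightarrow>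
      disjoint_family_on (\<lambda>i. {u i<..<v i}) {..<n} \<Longrightarrow> (\<Sum>i<n. v i - u i) < d \<Longrightarrow>
      (\<Sum>i<n. norm (G (v i) - G (u i))) < e / C'"
    by (rule abs_continuous_on_intervalD[OF G eC]) blast
  show "\<exists>d>0. \<forall>(n::nat) u v. (\<forall>i<n. a \<le> u i \<and> u i \<le> v i \<and> v i \<le> b) \<longrightarrow>
      disjoint_family_on (\<lambda>i. {u i<..<v i}) {..<n} \<longrightarrow> (\<Sum>i<n. v i - u i) < d \<longrightarrow>
      (\<Sum>i<n. norm (F (v i) - F (u i))) < e"
  proof (intro exI[of _ d] conjI allI impI d(1))
    fix n :: nat and u v :: "nat \<Rightarrow> real"
    assume uv: "\<forall>i<n. a \<le> u i \<and> u i \<le> v i \<and> v i \<le> b"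
      and "disjoint_family_on (\<lambda>i. {u i<..<v i}) {..<n}" "(\<Sum>i<n. v i - u i) < d"
    hence G: "(\<Sum>i<n. norm (G (v i) - G (u i))) < e / C'" by (intro d(2)) auto
    have "(\<Sum>i<n. norm (F (v i) - F (u i))) \<le> (\<Sum>i<n. C' * norm (G (v i) - G (u i)))"
    proof (rule sum_mono)
      fix i assume "i \<in> {..<n}"
      hence "norm (F (v i) - F (u i)) \<le> C * norm (G (v i) - G (u i))" using uv by (intro dom) auto
      also have "\<dots> \<le> C' * norm (G (v i) - G (u i))" using C' by (intro mult_right_mono) auto
      finally show "norm (F (v i) - F (u i)) \<le> C' * norm (G (v i) - G (u i))" .
    qed
    also have "\<dots> = C' * (\<Sum>i<n. norm (G (v i) - G (u i)))" by (simp add: sum_distrib_left)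
    also have "\<dots> < e" using G C' by (simp add: field_simps)
    finally show "(\<Sum>i<n. norm (F (v i) - F (u i))) < e" .
  qed
qed

lemma abs_continuous_on_interval_subset:
  assumes "abs_continuous_on_interval a b F" "a \<le> a'" "b' \<le> b"
  shows "abs_continuous_on_interval a' b' F"
proof (rule abs_continuous_on_intervalI)
  fix e :: real assume e: "0 < e"
  obtain d where d: "0 < d" "\<And>(n::nat) u v. (\<And>i. i < n \<Longrightarrow> a \<le> u i \<and> u i \<le> v i \<and> v i \<le> b) \<Longrightarrow>
      disjoint_family_on (\<lambda>i. {u i<..<v i}) {..<n} \<Longrightarrow> (\<Sum>i<n. v i - u i) < d \<Longrightarrow>
      (\<Sum>i<n. norm (F (v i) - F (u i))) < e"
    by (rule abs_continuous_on_intervalD[OF assms(1) e]) blast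
  show "\<exists>d>0. \<forall>(n::nat) u v. (\<forall>i<n. a' \<le> u i \<and> u i \<le> v i \<and> v i \<le> b') \<longrightarrow>
      disjoint_family_on (\<lambda>i. {u i<..<v i}) {..<n} \<longrightarrow> (\<Sum>i<n. v i - u i) < d \<longrightarrow>
      (\<Sum>i<n. norm (F (v i) - F (u i))) < e"
  proof (intro exI[of _ d] conjI allI impI d(1))
    fix n :: nat and u v :: "nat \<Rightarrow> real"
    assume "\<forall>i<n. a' \<le> u i \<and> u i \<le> v i \<and> v i \<le> b'"
      "disjoint_family_on (\<lambda>i. {u i<..<v i}) {..<n}" "(\<Sum>i<n. v i - u i) < d"
    thus "(\<Sum>i<n. norm (F (v i) - F (u i))) < e"
      using assms(2,3) by (intro d(2)) (auto intro: order_trans)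
  qed
qed

text \<open>The interval with the largest left endpoint lies to the right of all others, so it can
  be split off and the rest treated up to \<open>u i\<close>. This ordering presupposes nonempty
  open intervals: a degenerate one counts as disjoint wherever it sits, even inside another. Those
  contribute zero and are dropped at the end.\<close>

lemma sum_increments_mono_le:
  fixes F u v :: "_ \<Rightarrow> real"
  assumes "finite S" and mono: "mono_on {a..b} F" and ab: "a \<le> b"
    and "\<And>i. i \<in> S \<Longrightarrow> a \<le> u i \<and> u i \<le> v i \<and> v i \<le> b"
    and "disjoint_family_on (\<lambda>i. {u i<..<v i}) S"
  shows "(\<Sum>i\<in>S. F (v i) - F (u i)) \<le> F b - F a"
proof -
  have strict: "(\<Sum>i\<in>S. F (v i) - F (u i)) \<le> F c - F a"
    if "finite S" "a \<le> c" "c \<le> b" "\<And>i. i \<in> S \<Longrightarrow> a \<le> u i \<and> u i < v i \<and> v i \<le> c"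
      "disjoint_family_on (\<lambda>i. {u i<..<v i}) S" for S c
    using that
  proof (induction "card S" arbitrary: S c)
    case 0
    thus ?case using mono_onD[OF mono, of a c] by simp
  next
    case (Suc n)
    hence ne: "S \<noteq> {}" by auto
    have "Max (u ` S) \<in> u ` S" using Suc.prems(1) ne by (intro Max_in) auto
    then obtain i where i: "i \<in> S" "u i = Max (u ` S)" by (elim imageE) simp
    have ui: "u j \<le> u i" if "j \<in> S" for j using that Suc.prems(1) i by simp
    have vj: "v j \<le> u i" if "j \<in> S - {i}" for j
    proof (rule ccontr)
      assume "\<not> v j \<le> u i"
      define m where "m = (u i + min (v i) (v j)) / 2"
      have "u i < v i" using Suc.prems(4)[OF i(1)] by simp
      hence "m \<in> {u i<..<v i} \<inter> {u j<..<v j}"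
        using \<open>\<not> v j \<le> u i\<close> ui[of j] that by (auto simp: m_def min_def)
      moreover have "{u i<..<v i} \<inter> {u j<..<v j} = {}"
        using Suc.prems(5) i(1) that by (auto simp: disjoint_family_on_def)
      ultimately show False by blast
    qed
    have 1: "(\<Sum>j\<in>S - {i}. F (v j) - F (u j)) \<le> F (u i) - F a"
    proof (rule Suc.hyps(1))
      show "n = card (S - {i})" using Suc.hyps(2) Suc.prems(1) i(1) by (simp add: card_Diff_singleton)
      show "disjoint_family_on (\<lambda>i. {u i<..<v i}) (S - {i})"
        using Suc.prems(5) by (auto simp: disjoint_family_on_def)
    qed (use Suc.prems i(1) vj in \<open>fastforce+\<close>)
    have "F (v i) \<le> F c" using Suc.prems(2,3) Suc.prems(4)[OF i(1)] by (intro mono_onD[OF mono]) auto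
    with 1 show ?case using Suc.prems(1) i(1) by (simp add: sum.remove)
  qed
  have "v i = u i" if "i \<in> S" "\<not> u i < v i" for i using assms(4)[OF that(1)] that(2) by simp
  hence "(\<Sum>i\<in>S. F (v i) - F (u i)) = (\<Sum>i\<in>{i\<in>S. u i < v i}. F (v i) - F (u i))"
    using assms(1) by (intro sum.mono_neutral_right) (auto, metis)
  also have "\<dots> \<le> F b - F a"
    using assms by (intro strict) (auto simp: disjoint_family_on_def)
  finally show ?thesis .
qed

text \<open>Truncation: the part \<open>min (k x) n\<close> integrates to at most n times the total
  length of the intervals, and the excess \<open>k'\<close> has a small integral over all of
  \<open>{0..T}\<close> by dominated convergence.\<close>

lemma abs_continuous_on_interval_indefinite_integral:
  fixes k :: "real \<Rightarrow> real"
  assumes int: "integrable (lebesgue_on {0..T}) k" and pos: "\<And>x. x \<in> {0..T} \<Longrightarrow> 0 \<le> k x" and T: "0 \<le> T"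
  shows "abs_continuous_on_interval 0 T (\<lambda>t. integral {0..t} k)"
proof (rule abs_continuous_on_intervalI)
  fix e :: real assume e: "0 < e"
  have k_on: "k integrable_on {0..T}" using integrable_on_lebesgue_on[OF int] by simp
  have lim: "(\<lambda>n. integral\<^sup>L (lebesgue_on {0..T}) (\<lambda>x. k x - min (k x) (real n))) \<longlonglongrightarrow> integral\<^sup>L (lebesgue_on {0..T}) (\<lambda>x. 0)"
  proof (rule integral_dominated_convergence[where w=k])
    show "AE x in lebesgue_on {0..T}. (\<lambda>n. k x - min (k x) (real n)) \<longlonglongrightarrow> 0"
    proof (rule AE_I2)
      fix x
      obtain n0 where "k x \<le> real n0" using real_arch_simple by blast
      hence "\<forall>\<^sub>F n in sequentially. k x - min (k x) (real n) = 0"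
        by (intro eventually_sequentiallyI[of n0]) (auto simp: min_def)
      thus "(\<lambda>n. k x - min (k x) (real n)) \<longlonglongrightarrow> 0" by (rule tendsto_eventually)
    qed
    show "AE x in lebesgue_on {0..T}. norm (k x - min (k x) (real n)) \<le> k x" for n
      using pos by (intro AE_I2) (auto simp: min_def)
  qed (use int in \<open>auto intro!: borel_measurable_diff borel_measurable_min\<close>)
  obtain n where n: "integral\<^sup>L (lebesgue_on {0..T}) (\<lambda>x. k x - min (k x) (real n)) < e / 2"
    using order_tendstoD(2)[OF lim, of "e / 2"] e by (auto simp: eventually_sequentially)
  define k' where "k' = (\<lambda>x. k x - min (k x) (real n))"
  have int': "integrable (lebesgue_on {0..T}) k'"
  proof (rule Bochner_Integration.integrable_bound[OF int])
    show "k' \<in> borel_measurable (lebesgue_on {0..T})"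
      unfolding k'_def using int by (auto intro!: borel_measurable_diff borel_measurable_min)
    show "AE x in lebesgue_on {0..T}. norm (k' x) \<le> norm (k x)"
      using pos by (intro AE_I2) (auto simp: k'_def min_def)
  qed
  have k'_on: "k' integrable_on {0..T}" using integrable_on_lebesgue_on[OF int'] by simp
  have k'_pos: "0 \<le> k' x" for x by (simp add: k'_def)
  have sub: "k integrable_on {u..v}" "k' integrable_on {u..v}" if "0 \<le> u" "v \<le> T" for u v
    using integrable_on_subinterval[OF k_on] integrable_on_subinterval[OF k'_on] that by auto
  have inc: "integral {0..v} f - integral {0..u} f = integral {u..v} f"
    if "f integrable_on {0..T}" "0 \<le> u" "u \<le> v" "v \<le> T" for f :: "real \<Rightarrow> real" and u v
    using Henstock_Kurzweil_Integration.integral_combine[of 0 u v f] integrable_on_subinterval[OF that(1), of 0 v] that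
    by simp
  \<comment> \<open>The added 1 covers n = 0 and still gives
    \<open>real n * d \<le> e / 2\<close>.\<close>
  define d where "d = e / (2 * (real n + 1))"
  show "\<exists>d>0. \<forall>(m::nat) u v. (\<forall>i<m. 0 \<le> u i \<and> u i \<le> v i \<and> v i \<le> T) \<longrightarrow>
      disjoint_family_on (\<lambda>i. {u i<..<v i}) {..<m} \<longrightarrow> (\<Sum>i<m. v i - u i) < d \<longrightarrow>
      (\<Sum>i<m. norm (integral {0..v i} k - integral {0..u i} k)) < e"
  proof (intro exI[of _ d] conjI allI impI)
    show "0 < d" using e by (simp add: d_def)
    fix m :: nat and u v :: "nat \<Rightarrow> real"
    assume uv: "\<forall>i<m. 0 \<le> u i \<and> u i \<le> v i \<and> v i \<le> T"
      and disj: "disjoint_family_on (\<lambda>i. {u i<..<v i}) {..<m}" and sm: "(\<Sum>i<m. v i - u i) < d"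
    have "(\<Sum>i<m. norm (integral {0..v i} k - integral {0..u i} k))
        \<le> (\<Sum>i<m. (integral {0..v i} k' - integral {0..u i} k') + real n * (v i - u i))"
    proof (rule sum_mono)
      fix i assume "i \<in> {..<m}"
      hence i: "0 \<le> u i" "u i \<le> v i" "v i \<le> T" using uv by auto
      have "integral {u i..v i} k \<le> integral {u i..v i} (\<lambda>x. k' x + real n)"
        using i by (intro integral_le sub integrable_add integrable_const_ivl) (auto simp: k'_def)
      also have "\<dots> = integral {u i..v i} k' + real n * (v i - u i)"
        using i by (subst Henstock_Kurzweil_Integration.integral_add) (auto intro!: sub)
      finally have "integral {u i..v i} k \<le> integral {u i..v i} k' + real n * (v i - u i)" .
      moreover have "0 \<le> integral {u i..v i} k" using i pos by (intro integral_nonneg sub) auto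
      ultimately show "norm (integral {0..v i} k - integral {0..u i} k)
          \<le> (integral {0..v i} k' - integral {0..u i} k') + real n * (v i - u i)"
        using inc[OF k_on i] inc[OF k'_on i] by simp
    qed
    also have "\<dots> = (\<Sum>i<m. integral {0..v i} k' - integral {0..u i} k') + real n * (\<Sum>i<m. v i - u i)"
      by (simp add: sum.distrib sum_distrib_left)
    also have "(\<Sum>i<m. integral {0..v i} k' - integral {0..u i} k') \<le> integral {0..T} k' - integral {0..0} k'"
    proof (rule sum_increments_mono_le[where F="\<lambda>t. integral {0..t} k'", OF _ _ T _ disj])
      show "mono_on {0..T} (\<lambda>t. integral {0..t} k')"
      proof (rule mono_onI)
        fix r s assume "r \<in> {0..T}" "s \<in> {0..T}" "r \<le> s"
        thus "integral {0..r} k' \<le> integral {0..s} k'"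
          using inc[OF k'_on, of r s] integral_nonneg[of k' "{r..s}"] sub(2)[of r s] k'_pos by auto
      qed
    qed (use uv in auto)
    also have "integral {0..T} k' - integral {0..0} k' < e / 2"
      using n lebesgue_integral_eq_integral[OF int'] by (simp add: k'_def)
    also have "real n * (\<Sum>i<m. v i - u i) \<le> e / 2"
    proof -
      have "real n * (\<Sum>i<m. v i - u i) \<le> real n * d" using sm by (intro mult_left_mono) auto
      also have "\<dots> \<le> e / 2" using e by (simp add: d_def field_simps)
      finally show ?thesis .
    qed
    finally show "(\<Sum>i<m. norm (integral {0..v i} k - integral {0..u i} k)) < e" by simp
  qed
qed

text \<open>On a set of finite measure L^d lies in L^1: for finite d through
  \<open>\<bar>k x\<bar> \<le> 1 + \<bar>k x\<bar> powr p\<close>, for infinite d because k is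
  essentially bounded.\<close>

lemma in_Ld_imp_integrable:
  assumes k: "in_Ld d T k" and d: "1 \<le> d" and pos: "\<And>x. x \<in> {0..T} \<Longrightarrow> 0 \<le> k x"
  shows "integrable (lebesgue_on {0..T}) k"
proof -
  interpret finite_measure "lebesgue_on {0..T}"
    by (rule finite_measure_lebesgue_on) simp
  have meas: "k \<in> borel_measurable (lebesgue_on {0..T})" using k by (simp add: in_Ld_def)
  show ?thesis
  proof (cases "d = \<infinity>")
    case True
    then obtain C where C: "AE x in lebesgue_on {0..T}. \<bar>k x\<bar> \<le> C" using k by (auto simp: in_Ld_def)
    show ?thesis by (rule integrable_const_bound[of _ C]) (use C meas in auto)
  next
    case False
    define p where "p = enn2real d"
    have p: "1 \<le> p" using d False unfolding p_def
      by (metis enn2real_1 enn2real_mono infinity_ennreal_def less_top)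
    have int: "integrable (lebesgue_on {0..T}) (\<lambda>x. 1 + \<bar>k x\<bar> powr p)"
      using k False by (auto simp: in_Ld_def p_def)
    show ?thesis
    proof (rule Bochner_Integration.integrable_bound[OF int meas], rule AE_I2)
      fix x
      have "\<bar>k x\<bar> \<le> 1 + \<bar>k x\<bar> powr p"
      proof (cases "\<bar>k x\<bar> \<le> 1")
        case True
        thus ?thesis by (simp add: add_increasing2)
      next
        case False
        hence "\<bar>k x\<bar> powr 1 \<le> \<bar>k x\<bar> powr p" using p by (intro powr_mono) auto
        thus ?thesis using False by simp
      qed
      thus "norm (k x) \<le> norm (1 + \<bar>k x\<bar> powr p)" by simp
    qed
  qed
qed

section \<open>The length-area method\<close>

unbundle no fps_syntax

section \<open>The area of a univalent image as an iterated integral\<close>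

lemma Basis_vec2: "(Basis :: (real^2) set) = {axis 1 1, axis 2 1}"
  by (auto simp: Basis_vec_def UNIV_2)

lemma prod_Basis_vec2: "(\<Prod>b\<in>Basis. f b) = f (axis 1 1 :: real^2) * f (axis 2 1)"
  by (subst Basis_vec2, subst prod.insert) (simp_all add: axis_eq_axis)

text \<open>Two models of the plane meet here: the Jacobian formula for the measure of an image is
  used on \<open>real^2\<close>, iterated integration on the product of two copies of
  \<open>lborel\<close>.\<close>

lemma lborel_vec2_eq_distr:
  "(lborel :: (real^2) measure) = distr (lborel \<Otimes>\<^sub>M lborel) borel (\<lambda>(x, y). vector [x, y])"
    (is "_ = distr _ _ ?g")
proof (rule lborel_eqI)
  have cont: "continuous_on UNIV (\<lambda>p::real \<times> real. vector [fst p, snd p] :: real^2)"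
  proof (rule continuous_on_vec_lambda[THEN continuous_on_eq])
    fix p :: "real \<times> real" 
    show "(\<chi> i. if i = 1 then fst p else snd p) = (vector [fst p, snd p] :: real^2)"
      by (simp add: vec_eq_iff forall_2)
    show "continuous_on UNIV (\<lambda>p::real \<times> real. if i = 1 then fst p else snd p)" for i :: 2
      by (cases "i = 1") (auto intro!: continuous_intros)
  qed
  have meas: "?g \<in> borel_measurable (lborel \<Otimes>\<^sub>M lborel)"
    using borel_measurable_continuous_onI[OF cont] by (simp add: lborel_prod case_prod_unfold)
  fix l u :: "real^2"
  assume le: "\<And>b. b \<in> Basis \<Longrightarrow> l \<bullet> b \<le> u \<bullet> b"
  have l12: "l $ 1 \<le> u $ 1" "l $ 2 \<le> u $ 2"
    using le[of "axis 1 1"] le[of "axis 2 1"] by (auto simp: inner_axis Basis_vec_def)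
  have pre: "?g -` box l u \<inter> space (lborel \<Otimes>\<^sub>M lborel) = {l $ 1 <..< u $ 1} \<times> {l $ 2 <..< u $ 2}"
    by (auto simp: mem_box Basis_vec_def inner_axis forall_2 space_pair_measure)
  have "emeasure (distr (lborel \<Otimes>\<^sub>M lborel) borel ?g) (box l u) = ennreal ((u$1 - l$1) * (u$2 - l$2))"
    by (simp add: emeasure_distr meas pre lborel.emeasure_pair_measure_Times l12 ennreal_mult)
  also have "(u$1 - l$1) * (u$2 - l$2) = (\<Prod>b\<in>Basis. (u - l) \<bullet> b)"
    by (simp add: prod_Basis_vec2 inner_axis)
  finally show "emeasure (distr (lborel \<Otimes>\<^sub>M lborel) borel ?g) (box l u) = (\<Prod>b\<in>Basis. (u - l) \<bullet> b)" .
qed simp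

text \<open>By the Cauchy-Riemann equations the Jacobian determinant of \<Phi> is the square of
  \<open>norm (deriv \<Phi> z)\<close>, so the left side is the area of the image of E. The image
  lies in the square of side 2 R about 0, whence the constant 4.\<close>

lemma nn_integral_area_le:
  fixes \<Phi> :: "complex \<Rightarrow> complex"
  assumes hol: "\<Phi> holomorphic_on E" and opn: "open E" and inj: "inj_on \<Phi> E"
    and bd: "\<And>z. z \<in> E \<Longrightarrow> norm (\<Phi> z) \<le> R"
  shows "(\<integral>\<^sup>+ x. \<integral>\<^sup>+ y. indicator E (Complex x y) * ennreal ((norm (deriv \<Phi> (Complex x y)))\<^sup>2) \<partial>lborel \<partial>lborel)
          \<le> ennreal (4 * R\<^sup>2)"
proof (cases "R \<ge> 0")
  case False
  have "z \<notin> E" for z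
    using bd[of z] False norm_ge_zero[of "\<Phi> z"] by linarith
  thus ?thesis by simp
next
  case True
  define toC :: "real^2 \<Rightarrow> complex" where "toC = (\<lambda>v. Complex (v$1) (v$2))"
  define toV :: "complex \<Rightarrow> real^2" where "toV = (\<lambda>z. vector [Re z, Im z])"
  have toCV: "toC (toV z) = z" for z by (simp add: toC_def toV_def)
  have toVC: "toV (toC v) = v" for v by (simp add: toC_def toV_def vec_eq_iff forall_2)
  have blC: "bounded_linear toC"
    unfolding toC_def
    unfolding linear_conv_bounded_linear[symmetric] by (intro linearI) (auto simp: complex_eq_iff)
  have blV: "bounded_linear toV"
    unfolding toV_def
    unfolding linear_conv_bounded_linear[symmetric] by (intro linearI) (auto simp: vec_eq_iff forall_2)
  define S where "S = toC -` E"
  have opS: "open S" unfolding S_def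
    using opn continuous_open_vimage[of E toC] linear_continuous_at[OF blC] by blast
  define \<Psi> where "\<Psi> = toV \<circ> \<Phi> \<circ> toC"
  define D where "D = (\<lambda>v w. toV (deriv \<Phi> (toC v) * toC w))"
  have der: "(\<Psi> has_derivative D v) (at v within S)" if "v \<in> S" for v
  proof -
    have "(\<Phi> has_field_derivative deriv \<Phi> (toC v)) (at (toC v))"
      using hol opn that by (auto simp: S_def intro: holomorphic_derivI)
    hence 1: "(\<Phi> has_derivative (\<lambda>w. deriv \<Phi> (toC v) * w)) (at (toC v))"
      by (simp add: has_field_derivative_def)
    have 2: "(toC has_derivative toC) (at v within S)"
      by (rule bounded_linear_imp_has_derivative[OF blC])
    have 3: "(toV has_derivative toV) (at x)" for x
      by (rule bounded_linear_imp_has_derivative[OF blV])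
    have "((\<lambda>v. \<Phi> (toC v)) has_derivative (\<lambda>w. deriv \<Phi> (toC v) * toC w)) (at v within S)"
      by (rule has_derivative_compose[OF 2 1])
    from has_derivative_compose[OF this 3] show ?thesis
      by (simp add: \<Psi>_def D_def o_def)
  qed
  have detD: "det (matrix (D v)) = (norm (deriv \<Phi> (toC v)))\<^sup>2" for v
    by (simp add: det_2 matrix_def D_def toV_def toC_def axis_def cmod_power2)
       (simp add: power2_eq_square)
  have injS: "inj_on \<Psi> S"
    unfolding \<Psi>_def S_def using inj by (auto simp: inj_on_def) (metis toCV toVC)
  have Sleb: "S \<in> sets lebesgue" using opS by (intro sets_completionI_sets) simp
  have opI: "open (\<Phi> ` E)" by (rule open_mapping_thm3[OF hol opn inj])
  have "open (toC -` (\<Phi> ` E))"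
    using opI continuous_open_vimage[of "\<Phi> ` E" toC] linear_continuous_at[OF blC] by blast
  moreover have "toC -` (\<Phi> ` E) = \<Psi> ` S"
  proof (intro set_eqI iffI)
    fix x assume "x \<in> toC -` (\<Phi> ` E)"
    then obtain z where "z \<in> E" "toC x = \<Phi> z" by auto
    thus "x \<in> \<Psi> ` S"
      by (intro image_eqI[of _ _ "toV z"]) (metis \<Psi>_def o_apply toCV toVC, simp add: S_def toCV)
  qed (auto simp: \<Psi>_def S_def toCV)
  ultimately have oPS: "open (\<Psi> ` S)" by simp
  have sub: "\<Psi> ` S \<subseteq> cbox (vector [-R,-R]) (vector [R,R])"
  proof
    fix p assume "p \<in> \<Psi> ` S"
    then obtain z where z: "z \<in> E" "p = toV (\<Phi> z)" by (auto simp: \<Psi>_def S_def)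
    have "\<bar>Re (\<Phi> z)\<bar> \<le> R" "\<bar>Im (\<Phi> z)\<bar> \<le> R"
      using bd[OF z(1)] abs_Re_le_cmod abs_Im_le_cmod order_trans by blast+
    thus "p \<in> cbox (vector [-R,-R]) (vector [R,R])"
      by (auto simp: z(2) toV_def mem_box Basis_vec_def inner_axis forall_2)
  qed
  have lm: "\<Psi> ` S \<in> lmeasurable"
    using oPS sub bounded_subset[OF bounded_cbox] lmeasurable_open by blast
  have "measure lebesgue (\<Psi> ` S) \<le> measure lebesgue (cbox (vector [-R,-R]) (vector [R,R]) :: (real^2) set)"
    using sub lm by (intro measure_mono_fmeasurable) (auto intro: fmeasurableD)
  also have "\<dots> = 4 * R\<^sup>2"
  proof -
    have "measure lborel (cbox (vector [-R,-R]) (vector [R,R]) :: (real^2) set)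
        = (\<Prod>i\<in>Basis. (vector [R,R] :: real^2) \<bullet> i - vector [-R,-R] \<bullet> i)"
      using True by (intro content_cbox) (auto simp: Basis_vec_def inner_axis forall_2)
    also have "\<dots> = 4 * R\<^sup>2"
      by (subst prod_Basis_vec2) (simp add: inner_axis power2_eq_square)
    finally show ?thesis by simp
  qed
  finally have mle: "measure lebesgue (\<Psi> ` S) \<le> 4 * R\<^sup>2" .
  have "((\<lambda>x. \<bar>det (matrix (D x))\<bar>) has_integral measure lebesgue (\<Psi> ` S)) S"
    using has_measure_differentiable_image[OF Sleb der injS] lm by blast
  from nn_integral_has_integral_lebesgue[OF _ this]
  have I: "(\<integral>\<^sup>+v. ennreal (indicator S v * (norm (deriv \<Phi> (toC v)))\<^sup>2) \<partial>lborel) = ennreal (measure lebesgue (\<Psi> ` S))"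
    by (simp add: detD)
  define F where "F = (\<lambda>v. indicator S v * ennreal ((norm (deriv \<Phi> (toC v)))\<^sup>2))"
  have c1: "continuous_on E (deriv \<Phi>)"
    by (intro holomorphic_on_imp_continuous_on holomorphic_deriv hol opn)
  have "continuous_on S (deriv \<Phi> \<circ> toC)"
    by (rule continuous_on_compose[OF linear_continuous_on[OF blC]], rule continuous_on_subset[OF c1])
       (auto simp: S_def)
  hence "continuous_on S (\<lambda>v. (norm (deriv \<Phi> (toC v)))\<^sup>2)"
    unfolding o_def by (intro continuous_on_power continuous_on_norm)
  hence "(\<lambda>v. indicator S v *\<^sub>R (norm (deriv \<Phi> (toC v)))\<^sup>2) \<in> borel_measurable borel"
    using opS by (intro borel_measurable_continuous_on_indicator) auto
  hence "(\<lambda>v. ennreal (indicator S v *\<^sub>R (norm (deriv \<Phi> (toC v)))\<^sup>2)) \<in> borel_measurable borel"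
    by measurable
  also have "(\<lambda>v. ennreal (indicator S v *\<^sub>R (norm (deriv \<Phi> (toC v)))\<^sup>2)) = F"
    by (auto simp: F_def fun_eq_iff indicator_def)
  finally have mF: "F \<in> borel_measurable borel" .
  have mg: "(\<lambda>(x, y). vector [x, y] :: real^2) \<in> borel_measurable (lborel \<Otimes>\<^sub>M lborel :: (real \<times> real) measure)"
  proof -
    have "(\<lambda>p. toV (Complex (fst p) (snd p))) \<in> borel_measurable (borel :: (real \<times> real) measure)"
      by (intro borel_measurable_continuous_onI linear_continuous_on_compose[OF _ blV[THEN bounded_linear.linear]]
          continuous_intros)
    thus ?thesis by (simp add: lborel_prod toV_def case_prod_unfold)
  qed
  have "(\<integral>\<^sup>+ x. \<integral>\<^sup>+ y. indicator E (Complex x y) * ennreal ((norm (deriv \<Phi> (Complex x y)))\<^sup>2) \<partial>lborel \<partial>lborel)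
      = (\<integral>\<^sup>+ x. \<integral>\<^sup>+ y. F (vector [x, y]) \<partial>lborel \<partial>lborel)"
    by (simp add: F_def S_def toC_def indicator_def)
  also have "\<dots> = (\<integral>\<^sup>+ p. F (case p of (x, y) \<Rightarrow> vector [x, y]) \<partial>(lborel \<Otimes>\<^sub>M lborel))"
    using lborel.nn_integral_fst[of "\<lambda>p. F (case p of (x, y) \<Rightarrow> vector [x, y])" lborel]
      measurable_compose[OF mg mF] by simp
  also have "\<dots> = (\<integral>\<^sup>+ v. F v \<partial>lborel)"
    by (subst lborel_vec2_eq_distr, subst nn_integral_distr[OF mg]) (use mF in auto)
  also have "\<dots> = ennreal (measure lebesgue (\<Psi> ` S))"
    unfolding I[symmetric] F_def by (intro nn_integral_cong) (auto simp: indicator_def)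
  also have "\<dots> \<le> ennreal (4 * R\<^sup>2)" using mle by (rule ennreal_leI)
  finally show ?thesis .
qed

text \<open>Over each x the image of the segment from p to q has length at least L and comes from
  heights in J, so Cauchy-Schwarz bounds L^2 by m times the integral of the squared derivative over
  that vertical line. Integration over x turns the right side into an area. The cut-off
  \<open>norm (\<Phi> z) < R\<close> keeps the area bounded; it is asked on the open segment only,
  so that the segment may end where the image leaves the disc.\<close>

lemma length_area_le:
  fixes \<Phi> :: "complex \<Rightarrow> complex"
  assumes hol: "\<Phi> holomorphic_on U" and opn: "open U" and inj: "inj_on \<Phi> U"
    and ab: "a \<le> b" and L: "0 \<le> L" and J: "J \<in> sets lborel" "emeasure lborel J \<le> ennreal m" and m: "0 \<le> m"
    and curve: "\<And>x. x \<in> {a..b} \<Longrightarrow> \<exists>p q. p \<le> q \<and> {p<..<q} \<subseteq> J \<and> (\<forall>y\<in>{p..q}. Complex x y \<in> U) \<and>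
        (\<forall>y\<in>{p<..<q}. norm (\<Phi> (Complex x y)) < R) \<and> L \<le> norm (\<Phi> (Complex x q) - \<Phi> (Complex x p))"
  shows "(b - a) * L\<^sup>2 \<le> m * (4 * R\<^sup>2)"
proof -
  define E where "E = {z \<in> U. norm (\<Phi> z) < R}"
  have cont: "continuous_on U \<Phi>" by (rule holomorphic_on_imp_continuous_on[OF hol])
  have opE: "open E"
  proof -
    have "E = U \<inter> \<Phi> -` ball 0 R" by (auto simp: E_def)
    thus ?thesis using continuous_open_preimage[OF cont opn] by simp
  qed
  have EU: "E \<subseteq> U" by (auto simp: E_def)
  have cD: "continuous_on U (deriv \<Phi>)"
    by (intro holomorphic_on_imp_continuous_on holomorphic_deriv hol opn)
  define w where "w = (\<lambda>x y. indicator E (Complex x y) * ennreal ((norm (deriv \<Phi> (Complex x y)))\<^sup>2))"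
  have area: "(\<integral>\<^sup>+ x. \<integral>\<^sup>+ y. w x y \<partial>lborel \<partial>lborel) \<le> ennreal (4 * R\<^sup>2)"
    unfolding w_def
    by (rule nn_integral_area_le[OF holomorphic_on_subset[OF hol EU] opE inj_on_subset[OF inj EU]])
       (auto simp: E_def)
  have sq: "ennreal (L\<^sup>2) \<le> ennreal m * (\<integral>\<^sup>+ y. w x y \<partial>lborel)" if x: "x \<in> {a..b}" for x
  proof -
    obtain p q where pq: "p \<le> q" "{p<..<q} \<subseteq> J" "\<And>y. y \<in> {p..q} \<Longrightarrow> Complex x y \<in> U"
      "\<And>y. y \<in> {p<..<q} \<Longrightarrow> norm (\<Phi> (Complex x y)) < R" "L \<le> norm (\<Phi> (Complex x q) - \<Phi> (Complex x p))"
      using curve[OF x] by blast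
    define n where "n = (\<lambda>y. norm (deriv \<Phi> (Complex x y)))"
    have cC: "continuous_on A (Complex x)" for A
      unfolding Complex_eq by (intro continuous_intros)
    have cn: "continuous_on {p..q} n"
      unfolding n_def by (intro continuous_on_norm continuous_on_compose2[OF cD cC]) (use pq in auto)
    have der: "((\<lambda>y. \<Phi> (Complex x y)) has_vector_derivative \<i> * deriv \<Phi> (Complex x y)) (at y within {p..q})"
      if "y \<in> {p..q}" for y
    proof -
      have "((\<lambda>y. Complex x y) has_vector_derivative \<i>) (at y within {p..q})"
        unfolding Complex_eq by (auto intro!: derivative_eq_intros)
      moreover have "(\<Phi> has_field_derivative deriv \<Phi> (Complex x y)) (at (Complex x y) within (Complex x ` {p..q}))"
        using holomorphic_derivI[OF hol opn pq(3)[OF that]] by (rule has_field_derivative_at_within)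
      ultimately show ?thesis
        using field_vector_diff_chain_within by (fastforce simp: o_def)
    qed
    have I: "((\<lambda>y. \<i> * deriv \<Phi> (Complex x y)) has_integral (\<Phi> (Complex x q) - \<Phi> (Complex x p))) {p..q}"
      by (rule fundamental_theorem_of_calculus[OF pq(1)]) (rule der)
    have N: "(n has_integral integral {p..q} n) {p..q}"
      by (rule integrable_integral, rule integrable_continuous_real[OF cn])
    have "norm (\<Phi> (Complex x q) - \<Phi> (Complex x p)) \<le> integral {p..q} n"
      unfolding integral_unique[OF I, symmetric]
      by (rule integral_norm_bound_integral) (use I N in \<open>auto simp: n_def norm_mult\<close>)
    hence "ennreal L \<le> ennreal (integral {p..q} n)" using pq(5) by (intro ennreal_leI) simp
    also have "\<dots> = (\<integral>\<^sup>+ y. ennreal (n y) * indicator {p<..<q} y \<partial>lborel)"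
      by (rule nn_integral_has_integral_lebesgue'[symmetric])
         (use N in \<open>auto simp: n_def has_integral_Icc_iff_Ioo\<close>)
    also have "\<dots> \<le> (\<integral>\<^sup>+ y. indicator J y * (indicator E (Complex x y) * ennreal (n y)) \<partial>lborel)"
      using pq by (intro nn_integral_mono) (auto simp: indicator_def E_def)
    finally have 1: "ennreal L \<le> (\<integral>\<^sup>+ y. indicator J y * (indicator E (Complex x y) * ennreal (n y)) \<partial>lborel)" .
    have "(\<lambda>z. indicator E z *\<^sub>R norm (deriv \<Phi> z)) \<in> borel_measurable borel"
      using opE by (intro borel_measurable_continuous_on_indicator)
        (auto intro!: continuous_on_norm continuous_on_subset[OF cD EU])
    hence "(\<lambda>y. indicator E (Complex x y) *\<^sub>R n y) \<in> borel_measurable borel"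
      unfolding n_def
      using measurable_compose[OF borel_measurable_continuous_onI[OF cC[of UNIV]]] by (auto simp: o_def)
    hence "(\<lambda>y. ennreal (indicator E (Complex x y) *\<^sub>R n y)) \<in> borel_measurable lborel" by simp
    also have "(\<lambda>y. ennreal (indicator E (Complex x y) *\<^sub>R n y)) = (\<lambda>y. indicator E (Complex x y) * ennreal (n y))"
      by (auto simp: fun_eq_iff indicator_def)
    finally have me: "(\<lambda>y. indicator E (Complex x y) * ennreal (n y)) \<in> borel_measurable lborel" .
    have "ennreal (L\<^sup>2) = (ennreal L)\<^sup>2" using L by (simp add: ennreal_power)
    also have "\<dots> \<le> (\<integral>\<^sup>+ y. indicator J y * (indicator E (Complex x y) * ennreal (n y)) \<partial>lborel)\<^sup>2"
      by (rule power_mono[OF 1]) simp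
    also have "\<dots> \<le> (\<integral>\<^sup>+ y. (indicator J y)\<^sup>2 \<partial>lborel) * (\<integral>\<^sup>+ y. (indicator E (Complex x y) * ennreal (n y))\<^sup>2 \<partial>lborel)"
      using J(1) by (intro Cauchy_Schwarz_nn_integral me) simp
    also have "(\<integral>\<^sup>+ y. (indicator J y)\<^sup>2 \<partial>lborel) = (\<integral>\<^sup>+ y. indicator J y \<partial>lborel)"
      by (intro nn_integral_cong) (auto simp: indicator_def)
    also have "\<dots> = emeasure lborel J" using J(1) by simp
    also have "(\<integral>\<^sup>+ y. (indicator E (Complex x y) * ennreal (n y))\<^sup>2 \<partial>lborel) = (\<integral>\<^sup>+ y. w x y \<partial>lborel)"
      by (intro nn_integral_cong) (auto simp: w_def n_def indicator_def ennreal_power)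
    finally have "ennreal (L\<^sup>2) \<le> emeasure lborel J * (\<integral>\<^sup>+ y. w x y \<partial>lborel)" .
    also have "\<dots> \<le> ennreal m * (\<integral>\<^sup>+ y. w x y \<partial>lborel)" by (intro mult_right_mono J(2)) simp
    finally show ?thesis .
  qed
  have "(\<lambda>z. indicator E z *\<^sub>R (norm (deriv \<Phi> z))\<^sup>2) \<in> borel_measurable borel"
    using opE by (intro borel_measurable_continuous_on_indicator)
      (auto intro!: continuous_on_norm continuous_on_power continuous_on_subset[OF cD EU])
  hence "(\<lambda>z. ennreal (indicator E z *\<^sub>R (norm (deriv \<Phi> z))\<^sup>2)) \<in> borel_measurable borel" by simp
  moreover have "(\<lambda>p. Complex (fst p) (snd p)) \<in> borel_measurable borel"
    unfolding Complex_eq by (intro borel_measurable_continuous_onI continuous_intros)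
  ultimately have "(\<lambda>p. ennreal (indicator E (Complex (fst p) (snd p)) *\<^sub>R (norm (deriv \<Phi> (Complex (fst p) (snd p))))\<^sup>2))
      \<in> borel_measurable (borel :: (real \<times> real) measure)"
    by (rule measurable_compose[rotated])
  also have "(\<lambda>p. ennreal (indicator E (Complex (fst p) (snd p)) *\<^sub>R (norm (deriv \<Phi> (Complex (fst p) (snd p))))\<^sup>2))
      = (\<lambda>p. w (fst p) (snd p))"
    by (auto simp: w_def fun_eq_iff indicator_def)
  finally have mw: "(\<lambda>p. w (fst p) (snd p)) \<in> borel_measurable (lborel \<Otimes>\<^sub>M lborel :: (real \<times> real) measure)"
    by (simp add: lborel_prod)
  have mI: "(\<lambda>x. \<integral>\<^sup>+ y. w x y \<partial>lborel) \<in> borel_measurable lborel"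
    using lborel.borel_measurable_nn_integral_fst[OF mw] by simp
  have "ennreal ((b - a) * L\<^sup>2) = ennreal (L\<^sup>2) * emeasure lborel {a..b}"
    using ab by (simp add: ennreal_mult[symmetric] mult.commute)
  also have "\<dots> = (\<integral>\<^sup>+ x. ennreal (L\<^sup>2) * indicator {a..b} x \<partial>lborel)"
    by (simp add: nn_integral_cmult)
  also have "\<dots> \<le> (\<integral>\<^sup>+ x. ennreal m * (\<integral>\<^sup>+ y. w x y \<partial>lborel) \<partial>lborel)"
    using sq by (intro nn_integral_mono) (auto simp: indicator_def)
  also have "\<dots> = ennreal m * (\<integral>\<^sup>+ x. \<integral>\<^sup>+ y. w x y \<partial>lborel \<partial>lborel)"
    by (rule nn_integral_cmult[OF mI])
  also have "\<dots> \<le> ennreal m * ennreal (4 * R\<^sup>2)" by (intro mult_left_mono area) simp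
  also have "\<dots> = ennreal (m * (4 * R\<^sup>2))" using m by (simp add: ennreal_mult)
  finally show ?thesis using m by (simp add: ennreal_le_iff)
qed

text \<open>Supplies segments for \<open>length_area_le\<close>: a path that leaves the ball is
  stopped when it first reaches norm R, and by then it has moved at least
  \<open>R - norm (c p) \<ge> L\<close> away from its start.\<close>

lemma initial_subpath_in_ball:
  fixes c :: "real \<Rightarrow> 'a::real_normed_vector"
  assumes cont: "continuous_on {p..q} c" and pq: "p \<le> q" and L: "L \<le> norm (c q - c p)" "norm (c p) + L \<le> R" "0 < L"
  obtains q' where "p \<le> q'" "q' \<le> q" "\<And>y. y \<in> {p<..<q'} \<Longrightarrow> norm (c y) < R" "L \<le> norm (c q' - c p)"
proof (cases "\<forall>y\<in>{p..q}. norm (c y) < R")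
  case True
  thus ?thesis using that[of q] pq L by auto
next
  case False
  define S where "S = {y \<in> {p..q}. R \<le> norm (c y)}"
  have ne: "S \<noteq> {}" using False by (auto simp: S_def not_less)
  have "closed ({p..q} \<inter> (\<lambda>y. norm (c y)) -` {R..})"
    by (intro continuous_closed_preimage continuous_on_norm cont) auto
  also have "{p..q} \<inter> (\<lambda>y. norm (c y)) -` {R..} = S" by (auto simp: S_def)
  finally have cl: "closed S" .
  have bb: "bdd_below S" by (rule bdd_belowI[of _ p]) (auto simp: S_def)
  have "Inf S \<in> S" by (rule closed_contains_Inf[OF ne bb cl])
  hence q': "p \<le> Inf S" "Inf S \<le> q" "R \<le> norm (c (Inf S))" by (auto simp: S_def)
  moreover have "norm (c y) < R" if "y \<in> {p<..<Inf S}" for y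
    using that cInf_lower[OF _ bb, of y] q' by (force simp: S_def not_less[symmetric])
  moreover have "L \<le> norm (c (Inf S) - c p)"
    using norm_triangle_ineq2[of "c (Inf S)" "c p"] q' L by linarith
  ultimately show ?thesis using that by blast
qed

section \<open>Angular slopes at infinity in the half-plane\<close>

definition half_plane :: "complex set" where
  "half_plane = {z. 0 < Re z}"

text \<open>The sets \<open>norm z < N * Re z\<close> are the open sectors of half-angle arccos
  (1/N) about the positive axis. As in \<open>angular_at\<close>, the supremum of filters demands
  convergence in each of them.\<close>

definition sector_infinity :: "complex filter" where
  "sector_infinity = (SUP N\<in>{1<..}. inf at_infinity (principal {z. norm z < N * Re z}))"

text \<open>For a pole this is the residue up to a constant factor; for a self-map with nonzero
  slope, the reciprocal of the angular derivative.\<close>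

definition angular_slope :: "(complex \<Rightarrow> complex) \<Rightarrow> complex \<Rightarrow> bool" where
  "angular_slope g a \<longleftrightarrow> ((\<lambda>z. g z / z) \<longlongrightarrow> a) sector_infinity"

lemma open_half_plane: "open half_plane"
  by (simp add: half_plane_def open_halfspace_Re_gt)

lemma eventually_sector_infinity:
  "eventually P sector_infinity \<longleftrightarrow> (\<forall>N>1. \<exists>r. \<forall>z. r \<le> norm z \<and> norm z < N * Re z \<longrightarrow> P z)"
  unfolding sector_infinity_def
  by (simp add: eventually_Sup eventually_inf_principal eventually_at_infinity)
     (metis greaterThan_iff)

lemma eventually_sector_infinityD:
  assumes "eventually P sector_infinity" "1 < N"
  obtains r where "0 < r" "\<And>z. r \<le> norm z \<Longrightarrow> norm z < N * Re z \<Longrightarrow> P z"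
proof -
  obtain r where r: "\<And>z. r \<le> norm z \<Longrightarrow> norm z < N * Re z \<Longrightarrow> P z"
    using assms unfolding eventually_sector_infinity by metis
  show ?thesis by (rule that[of "max r 1"]) (use r in auto)
qed

lemma eventually_sector_infinity_norm_ge: "\<forall>\<^sub>F z in sector_infinity. r \<le> norm z"
  unfolding eventually_sector_infinity by blast

lemma eventually_sector_infinity_Re_pos: "\<forall>\<^sub>F z in sector_infinity. 0 < Re z"
  unfolding eventually_sector_infinity
proof (intro allI impI exI[of _ 1])
  fix N :: real and z :: complex assume "1 < N" "1 \<le> norm z \<and> norm z < N * Re z"
  hence "0 < N * Re z" by linarith
  thus "0 < Re z" using \<open>1 < N\<close> by (simp add: zero_less_mult_iff)
qed

lemma eventually_sector_infinity_nonzero: "\<forall>\<^sub>F z in sector_infinity. z \<noteq> 0"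
  using eventually_sector_infinity_Re_pos by (rule eventually_mono) auto

text \<open>A disc of radius \<open>norm z\<^sub>0 / (2 * N)\<close> costs at most half of the lower
  bound \<open>norm z\<^sub>0 / N\<close> for \<open>Re z\<^sub>0\<close>, while the norm at most
  doubles; hence the wider aperture 4 N.\<close>

lemma sector_perturb:
  assumes "1 < N" "norm z\<^sub>0 < N * Re z\<^sub>0" "norm (z - z\<^sub>0) \<le> norm z\<^sub>0 / (2 * N)"
  shows "norm z < 4 * N * Re z" "norm z\<^sub>0 / 2 \<le> norm z" "norm z \<le> 2 * norm z\<^sub>0" "0 < Re z"
proof -
  have z0: "0 < norm z\<^sub>0"
  proof -
    have "z\<^sub>0 \<noteq> 0" using assms(2) by auto
    thus ?thesis by simp
  qed
  have le: "norm z\<^sub>0 / (2 * N) \<le> norm z\<^sub>0 / 2"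
    using assms(1) z0 by (intro divide_left_mono) auto
  have d: "norm z\<^sub>0 - norm (z - z\<^sub>0) \<le> norm z" "norm z \<le> norm z\<^sub>0 + norm (z - z\<^sub>0)"
    using norm_triangle_ineq2[of z\<^sub>0 "z\<^sub>0 - z"] norm_triangle_ineq[of z\<^sub>0 "z - z\<^sub>0"]
    by (simp_all add: norm_minus_commute)
  show "norm z\<^sub>0 / 2 \<le> norm z" using d(1) le assms(3) by linarith
  have u: "norm z < 2 * norm z\<^sub>0" using d(2) le assms(3) z0 by linarith
  thus "norm z \<le> 2 * norm z\<^sub>0" by simp
  have "\<bar>Re z - Re z\<^sub>0\<bar> \<le> norm (z - z\<^sub>0)" using abs_Re_le_cmod[of "z - z\<^sub>0"] by simp
  moreover have "norm z\<^sub>0 / N < Re z\<^sub>0" using assms(1,2) by (simp add: field_simps)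
  moreover have "norm z\<^sub>0 / N = 2 * (norm z\<^sub>0 / (2 * N))" using assms(1) by simp
  ultimately have R: "norm z\<^sub>0 / (2 * N) < Re z" using assms(3) by linarith
  hence "2 * norm z\<^sub>0 < 4 * N * Re z" using assms(1) by (simp add: field_simps)
  thus "norm z < 4 * N * Re z" using u by linarith
  have "0 < norm z\<^sub>0 / (2 * N)" using z0 assms(1) by simp
  thus "0 < Re z" using R by linarith
qed

lemma filterlim_sector_infinityI:
  assumes lim: "((\<lambda>x. k x / of_real x) \<longlongrightarrow> p) at_top" and p: "0 < Re p"
  shows "filterlim k sector_infinity at_top"
  unfolding filterlim_iff
proof (intro allI impI)
  fix P :: "complex \<Rightarrow> bool" assume P: "eventually P sector_infinity"
  \<comment> \<open>Twice the critical aperture \<open>norm p / Re p\<close>, so that p lies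
    strictly inside the sector.\<close>
  define N where "N = 2 * norm p / Re p"
  have pp: "0 < norm p" "Re p \<le> norm p" using p complex_Re_le_cmod[of p] by auto
  hence N: "1 < N" "norm p < N * Re p" using p by (auto simp: N_def field_simps)
  have N4: "1 < 4 * N" using N by simp
  obtain r where r: "0 < r" "\<And>z. r \<le> norm z \<Longrightarrow> norm z < 4 * N * Re z \<Longrightarrow> P z"
    by (rule eventually_sector_infinityD[OF P N4]) blast
  have "0 < norm p / (2 * N)" using pp N by simp
  from tendstoD[OF lim this] have e1: "\<forall>\<^sub>F x in at_top. norm (k x / of_real x - p) < norm p / (2 * N)"
    by (simp add: dist_norm)
  show "\<forall>\<^sub>F x in at_top. P (k x)"
    using e1 eventually_gt_at_top[of 0] eventually_ge_at_top[of "2 * r / norm p"]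
  proof eventually_elim
    case (elim x)
    define z\<^sub>0 where "z\<^sub>0 = of_real x * p"
    have n0: "norm z\<^sub>0 = x * norm p" using elim by (simp add: z\<^sub>0_def norm_mult)
    have "k x - z\<^sub>0 = of_real x * (k x / of_real x - p)"
      using elim by (simp add: z\<^sub>0_def field_simps)
    hence "norm (k x - z\<^sub>0) = x * norm (k x / of_real x - p)" using elim by (simp add: norm_mult)
    also have "\<dots> \<le> x * (norm p / (2 * N))" using elim by (intro mult_left_mono) auto
    finally have 1: "norm (k x - z\<^sub>0) \<le> norm z\<^sub>0 / (2 * N)" by (simp add: n0)
    have 2: "norm z\<^sub>0 < N * Re z\<^sub>0" using N elim by (simp add: n0) (simp add: z\<^sub>0_def)
    have "r \<le> norm z\<^sub>0 / 2" using elim pp by (simp add: n0 field_simps)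
    thus ?case using sector_perturb[OF N(1) 2 1] r by auto
  qed
qed

lemma filterlim_ray_sector_infinity:
  "0 < Re p \<Longrightarrow> filterlim (\<lambda>x. of_real x * p) sector_infinity at_top"
  by (rule filterlim_sector_infinityI[of _ p], rule tendsto_eventually,
      rule eventually_mono[OF eventually_gt_at_top[of 0]]) auto

lemma sector_infinity_neq_bot: "sector_infinity \<noteq> bot"
proof
  assume "sector_infinity = bot"
  hence "eventually (\<lambda>_. False) sector_infinity" by simp
  from eventually_compose_filterlim[OF this filterlim_ray_sector_infinity[of 1]]
  show False by simp
qed

section \<open>Schwarz-Pick and Julia-Wolff in the half-plane\<close>

lemma norm_add_cnj_diff_norm_diff:
  "(norm (a + cnj b))\<^sup>2 - (norm (a - b))\<^sup>2 = 4 * Re a * Re b"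
  unfolding cmod_power2 by (simp add: power2_eq_square algebra_simps)

text \<open>The Schwarz lemma after Cayley maps send \<open>z\<^sub>0\<close> and
  \<open>G z\<^sub>0\<close> to 0; \<kappa> is the inverse of the first of them. What matters is the
  factor \<open>Re (G z\<^sub>0)\<close> on the right: if it is small compared with
  \<open>Re z\<^sub>0\<close> at one single point, G grows slowly in every sector, up to an
  imaginary constant.\<close>

lemma half_plane_schwarz_pick_strict:
  assumes hol: "G holomorphic_on half_plane" and pos: "\<And>z. 0 < Re z \<Longrightarrow> 0 < Re (G z)"
    and z: "0 < Re z" and z0: "0 < Re z\<^sub>0"
  shows "norm (G z - \<i> * Im (G z\<^sub>0)) \<le> Re (G z\<^sub>0) * (norm (z + cnj z\<^sub>0))\<^sup>2 / (Re z * Re z\<^sub>0)"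
proof -
  define \<kappa> where "\<kappa> = (\<lambda>w. (z\<^sub>0 + cnj z\<^sub>0 * w) / (1 - w))"
  define \<psi> where "\<psi> = (\<lambda>w. (G (\<kappa> w) - G z\<^sub>0) / (G (\<kappa> w) + cnj (G z\<^sub>0)))"
  have k_pos: "0 < Re (\<kappa> w)" if "norm w < 1" for w
  proof -
    have w1: "1 - w \<noteq> 0" using that by auto
    have "(norm w)\<^sup>2 < 1" using that by (simp add: abs_square_less_1)
    hence "0 < Re z\<^sub>0 * (1 - (norm w)\<^sup>2)" using z0 by simp
    also have "\<dots> = Re ((z\<^sub>0 + cnj z\<^sub>0 * w) * cnj (1 - w))"
      unfolding cmod_power2 by (simp add: algebra_simps power2_eq_square)
    finally show ?thesis
      unfolding \<kappa>_def Re_divide_numeral using w1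
      by (simp add: complex_div_cnj[of _ "1 - w"] zero_less_divide_iff del: complex_cnj_diff)
  qed
  have den: "a + cnj b \<noteq> 0" if "0 < Re a" "0 < Re b" for a b
    using that by (auto simp: complex_eq_iff)
  have hk: "\<kappa> holomorphic_on ball 0 1"
    unfolding \<kappa>_def by (intro holomorphic_intros) auto
  have hG: "(\<lambda>w. G (\<kappa> w)) holomorphic_on ball 0 1"
    using holomorphic_on_compose_gen[OF hk hol] k_pos by (simp add: half_plane_def o_def image_subset_iff)
  have h\<psi>: "\<psi> holomorphic_on ball 0 1"
    unfolding \<psi>_def by (intro holomorphic_intros hG den pos k_pos z0) simp
  have lt1: "norm ((a - b) / (a + cnj b)) < 1" if "0 < Re a" "0 < Re b" for a b
  proof -
    have "0 < 4 * Re a * Re b" using that by simp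
    hence "(norm (a - b))\<^sup>2 < (norm (a + cnj b))\<^sup>2"
      using norm_add_cnj_diff_norm_diff[of a b] by linarith
    hence "norm (a - b) < norm (a + cnj b)" by (rule power2_less_imp_less) simp
    thus ?thesis using den[OF that] by (simp add: norm_divide)
  qed
  define w where "w = (z - z\<^sub>0) / (z + cnj z\<^sub>0)"
  have w: "norm w < 1" unfolding w_def by (rule lt1[OF z z0])
  have kw: "\<kappa> w = z"
  proof -
    have nz: "z + cnj z\<^sub>0 \<noteq> 0" "z\<^sub>0 + cnj z\<^sub>0 \<noteq> 0" using den[OF z z0] den[OF z0 z0] by auto
    have "1 - w = (z\<^sub>0 + cnj z\<^sub>0) / (z + cnj z\<^sub>0)" using nz by (simp add: w_def field_simps)
    moreover have "z\<^sub>0 + cnj z\<^sub>0 * w = z * (z\<^sub>0 + cnj z\<^sub>0) / (z + cnj z\<^sub>0)"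
      using nz by (simp add: w_def field_simps)
    ultimately show ?thesis using nz by (simp add: \<kappa>_def)
  qed
  have "norm (\<psi> w) \<le> norm w"
  proof (rule Schwarz_Lemma(1)[OF h\<psi> _ _ w])
    show "\<psi> 0 = 0" by (simp add: \<psi>_def \<kappa>_def)
    show "norm (\<psi> v) < 1" if "norm v < 1" for v
      unfolding \<psi>_def by (rule lt1) (use that k_pos pos z0 in auto)
  qed
  hence 1: "norm (G z - G z\<^sub>0) \<le> norm w * norm (G z + cnj (G z\<^sub>0))"
    using den[of "G z" "G z\<^sub>0"] pos z z0 by (simp add: \<psi>_def kw norm_divide field_simps)
  define X where "X = G z - \<i> * Im (G z\<^sub>0)"
  define r where "r = Re (G z\<^sub>0)"
  define \<rho> where "\<rho> = norm w"
  have r: "0 < r" using pos z0 by (simp add: r_def)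
  have \<rho>: "0 \<le> \<rho>" "\<rho> < 1" using w by (auto simp: \<rho>_def)
  have "G z - G z\<^sub>0 = X - of_real r" "G z + cnj (G z\<^sub>0) = X + of_real r"
    by (auto simp: X_def r_def complex_eq_iff)
  with 1 have "norm (X - of_real r) \<le> \<rho> * norm (X + of_real r)" by (simp add: \<rho>_def)
  moreover have "norm X - r \<le> norm (X - of_real r)"
    using norm_triangle_ineq2[of X "of_real r"] r by simp
  moreover have "\<rho> * norm (X + of_real r) \<le> \<rho> * (norm X + r)"
    using norm_triangle_ineq[of X "of_real r"] r \<rho> by (intro mult_left_mono) auto
  ultimately have 2: "norm X * (1 - \<rho>) \<le> r * (1 + \<rho>)" by (simp add: algebra_simps)
  \<comment> \<open>The factor 1 + \<rho> produces 1 - \<rho>^2, which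
    \<open>norm_add_cnj_diff_norm_diff\<close> evaluates exactly; the crude bound 4 for the square
    of 1 + \<rho> cancels against the 4 in that identity.\<close>
  have "norm X * (1 - \<rho>\<^sup>2) = norm X * (1 - \<rho>) * (1 + \<rho>)" by (simp add: algebra_simps power2_eq_square)
  also have "\<dots> \<le> r * (1 + \<rho>) * (1 + \<rho>)" using 2 \<rho> by (intro mult_right_mono) auto
  also have "\<dots> \<le> r * 2 * 2" using r \<rho> by (intro mult_mono) auto
  finally have 3: "norm X * (1 - \<rho>\<^sup>2) \<le> 4 * r" by simp
  define n where "n = (norm (z + cnj z\<^sub>0))\<^sup>2"
  have n: "0 < n" using den[OF z z0] by (simp add: n_def)
  have "\<rho>\<^sup>2 = (norm (z - z\<^sub>0))\<^sup>2 / n" by (simp add: \<rho>_def w_def norm_divide power_divide n_def)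
  hence "1 - \<rho>\<^sup>2 = (n - (norm (z - z\<^sub>0))\<^sup>2) / n" using n by (simp add: diff_divide_distrib)
  also have "n - (norm (z - z\<^sub>0))\<^sup>2 = 4 * Re z * Re z\<^sub>0"
    unfolding n_def by (rule norm_add_cnj_diff_norm_diff)
  finally have "1 - \<rho>\<^sup>2 = 4 * Re z * Re z\<^sub>0 / n" .
  with 3 have "norm X * (4 * Re z * Re z\<^sub>0) \<le> 4 * r * n" using n by (simp add: field_simps)
  hence "norm X \<le> r * n / (Re z * Re z\<^sub>0)" using z z0 by (simp add: field_simps)
  thus ?thesis by (simp add: X_def r_def n_def)
qed

text \<open>The strict version applies to G + e for each e > 0, and both sides are continuous in e.
  This form suits h - c z with the best constant c, where an infimum gives only a nonnegative real
  part.\<close>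

lemma half_plane_schwarz_pick:
  assumes hol: "G holomorphic_on half_plane" and nonneg: "\<And>z. 0 < Re z \<Longrightarrow> 0 \<le> Re (G z)"
    and z: "0 < Re z" and z0: "0 < Re z\<^sub>0"
  shows "norm (G z - \<i> * Im (G z\<^sub>0)) \<le> Re (G z\<^sub>0) * (norm (z + cnj z\<^sub>0))\<^sup>2 / (Re z * Re z\<^sub>0)"
proof -
  have "((\<lambda>e. norm (G z + of_real e - \<i> * Im (G z\<^sub>0))) \<longlongrightarrow> norm (G z + of_real 0 - \<i> * Im (G z\<^sub>0))) (at_right 0)"
    by (intro tendsto_intros)
  moreover have "((\<lambda>e. (Re (G z\<^sub>0) + e) * (norm (z + cnj z\<^sub>0))\<^sup>2 / (Re z * Re z\<^sub>0)) \<longlongrightarrow>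
      (Re (G z\<^sub>0) + 0) * (norm (z + cnj z\<^sub>0))\<^sup>2 / (Re z * Re z\<^sub>0)) (at_right 0)"
    using z z0 by (intro tendsto_intros) auto
  moreover have "\<forall>\<^sub>F e in at_right 0. norm (G z + of_real e - \<i> * Im (G z\<^sub>0))
      \<le> (Re (G z\<^sub>0) + e) * (norm (z + cnj z\<^sub>0))\<^sup>2 / (Re z * Re z\<^sub>0)"
    using eventually_at_right_less[of 0]
  proof eventually_elim
    case (elim e)
    have "norm ((\<lambda>z. G z + of_real e) z - \<i> * Im ((\<lambda>z. G z + of_real e) z\<^sub>0))
        \<le> Re ((\<lambda>z. G z + of_real e) z\<^sub>0) * (norm (z + cnj z\<^sub>0))\<^sup>2 / (Re z * Re z\<^sub>0)"
      by (rule half_plane_schwarz_pick_strict)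
         (use elim nonneg z z0 in \<open>auto intro!: holomorphic_intros hol add_nonneg_pos\<close>)
    thus ?case by simp
  qed
  ultimately have "norm (G z + of_real 0 - \<i> * Im (G z\<^sub>0)) \<le> (Re (G z\<^sub>0) + 0) * (norm (z + cnj z\<^sub>0))\<^sup>2 / (Re z * Re z\<^sub>0)"
    using tendsto_le[OF trivial_limit_at_right_real] by blast
  thus ?thesis by simp
qed

text \<open>The constant is the infimum of \<open>Re (h z) / Re z\<close>. At a point
  \<open>z\<^sub>0\<close> where the quotient is within \<epsilon> of it, the remainder
  \<open>G z = h z - of_real c * z\<close> has real part at most
  \<open>\<epsilon> * Re z\<^sub>0\<close>, and its real part is nonnegative everywhere;
  Schwarz-Pick then makes G a small multiple of norm z in the given sector.\<close>

lemma half_plane_julia_wolff: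
  assumes hol: "h holomorphic_on half_plane" and pos: "\<And>z. 0 < Re z \<Longrightarrow> 0 < Re (h z)"
  obtains c where "0 \<le> c" "\<And>z. 0 < Re z \<Longrightarrow> c * Re z \<le> Re (h z)" "angular_slope h (of_real c)"
proof -
  define c where "c = (INF z\<in>half_plane. Re (h z) / Re z)"
  have bb: "bdd_below ((\<lambda>z. Re (h z) / Re z) ` half_plane)"
    by (rule bdd_belowI[of _ 0]) (auto simp: half_plane_def less_imp_le pos)
  have ne: "half_plane \<noteq> {}" by (auto simp: half_plane_def intro: exI[of _ 1])
  have c0: "0 \<le> c" unfolding c_def
    by (rule cINF_greatest[OF ne]) (auto simp: half_plane_def less_imp_le pos)
  have cle: "c * Re z \<le> Re (h z)" if "0 < Re z" for z
  proof -
    have "c \<le> Re (h z) / Re z" unfolding c_def using that by (intro cINF_lower[OF bb]) (simp add: half_plane_def)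
    thus ?thesis using that by (simp add: field_simps)
  qed
  have "((\<lambda>z. h z / z) \<longlongrightarrow> of_real c) sector_infinity"
  proof (rule tendstoI)
    fix e :: real assume e: "0 < e"
    show "\<forall>\<^sub>F z in sector_infinity. dist (h z / z) (of_real c) < e"
      unfolding eventually_sector_infinity
    proof (intro allI impI)
      fix N :: real assume N: "1 < N"
      \<comment> \<open>Schwarz-Pick loses 4 N in the sector: 4 from
        \<open>(2 * norm z)\<^sup>2\<close> and N from \<open>norm z / Re z\<close>. What remains is
        e / 2, and the imaginary constant takes another e / 4.\<close>
      define \<epsilon> where "\<epsilon> = e / (8 * N)"
      have \<epsilon>: "0 < \<epsilon>" using e N by (simp add: \<epsilon>_def)
      have "\<exists>z\<in>half_plane. Re (h z) / Re z < c + \<epsilon>"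
        using cINF_less_iff[OF ne bb, of "c + \<epsilon>"] \<epsilon> by (auto simp: c_def)
      then obtain z\<^sub>0 where z0: "0 < Re z\<^sub>0" "Re (h z\<^sub>0) / Re z\<^sub>0 < c + \<epsilon>" by (auto simp: half_plane_def)
      define G where "G = (\<lambda>z. h z - of_real c * z)"
      have G0: "Re (G z\<^sub>0) \<le> \<epsilon> * Re z\<^sub>0" using z0 by (simp add: G_def field_simps)
      define r where "r = max (max 1 (norm z\<^sub>0)) (4 * \<bar>Im (G z\<^sub>0)\<bar> / e)"
      show "\<exists>r. \<forall>z. r \<le> norm z \<and> norm z < N * Re z \<longrightarrow> dist (h z / z) (of_real c) < e"
      proof (intro exI allI impI)
        fix z assume z: "r \<le> norm z \<and> norm z < N * Re z"
        have nz: "1 \<le> norm z" "norm z\<^sub>0 \<le> norm z" "4 * \<bar>Im (G z\<^sub>0)\<bar> / e \<le> norm z"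
          using z by (auto simp: r_def)
        have "0 < N * Re z" using z nz by linarith
        hence Rz: "0 < Re z" using N by (simp add: zero_less_mult_iff)
        have "norm (G z - \<i> * Im (G z\<^sub>0)) \<le> Re (G z\<^sub>0) * (norm (z + cnj z\<^sub>0))\<^sup>2 / (Re z * Re z\<^sub>0)"
          by (rule half_plane_schwarz_pick)
             (use hol cle Rz z0 in \<open>auto simp: G_def intro!: holomorphic_intros\<close>)
        also have "\<dots> \<le> (\<epsilon> * Re z\<^sub>0) * (2 * norm z)\<^sup>2 / (Re z * Re z\<^sub>0)"
        proof (intro divide_right_mono mult_mono power_mono G0)
          show "norm (z + cnj z\<^sub>0) \<le> 2 * norm z"
            using norm_triangle_ineq[of z "cnj z\<^sub>0"] nz by simp
        qed (use \<epsilon> z0 Rz in auto)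
        also have "\<dots> = 4 * \<epsilon> * norm z * (norm z / Re z)" using z0 Rz by (simp add: power2_eq_square)
        also have "\<dots> \<le> 4 * \<epsilon> * norm z * N"
          using z Rz \<epsilon> by (intro mult_left_mono) (auto simp: field_simps)
        also have "\<dots> = e / 2 * norm z" using N by (simp add: \<epsilon>_def)
        finally have 1: "norm (G z - \<i> * Im (G z\<^sub>0)) \<le> e / 2 * norm z" .
        have "norm (\<i> * Im (G z\<^sub>0)) \<le> e / 4 * norm z" using nz(3) e by (simp add: norm_mult field_simps)
        moreover have "norm (G z) \<le> norm (G z - \<i> * Im (G z\<^sub>0)) + norm (\<i> * Im (G z\<^sub>0))"
          using norm_triangle_ineq[of "G z - \<i> * Im (G z\<^sub>0)" "\<i> * Im (G z\<^sub>0)"] by simp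
        ultimately have "norm (G z) \<le> e / 2 * norm z + e / 4 * norm z" using 1 by linarith
        also have "\<dots> = (3 / 4 * e) * norm z" by simp
        also have "\<dots> < e * norm z" using e nz by (intro mult_strict_right_mono) auto
        finally have "norm (G z) < e * norm z" .
        moreover have "z \<noteq> 0" using nz(1) by auto
        hence "h z / z - of_real c = G z / z" by (simp add: G_def field_simps)
        moreover have "0 < norm z" using nz(1) by linarith
        ultimately show "dist (h z / z) (of_real c) < e" by (simp add: dist_norm norm_divide divide_less_eq)
      qed
    qed
  qed
  thus ?thesis using that c0 cle by (simp add: angular_slope_def)
qed

section \<open>Slopes under composition and local inversion\<close>

lemma angular_slope_eventually:
  assumes "angular_slope g a" "0 < e"
  shows "\<forall>\<^sub>F z in sector_infinity. norm (g z - a * z) \<le> e * norm z"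
proof -
  from tendstoD[OF assms(1)[unfolded angular_slope_def] assms(2)]
  show ?thesis using eventually_sector_infinity_nonzero
  proof eventually_elim
    case (elim z)
    have "g z - a * z = (g z / z - a) * z" using elim by (simp add: field_simps)
    hence "norm (g z - a * z) = norm (g z / z - a) * norm z" by (simp only: norm_mult)
    also have "\<dots> \<le> e * norm z" using elim by (intro mult_right_mono) (auto simp: dist_norm)
    finally show ?case .
  qed
qed

lemma angular_slope_unique:
  "angular_slope g a \<Longrightarrow> angular_slope g b \<Longrightarrow> a = b"
  unfolding angular_slope_def using tendsto_unique[OF sector_infinity_neq_bot] by blast

lemma angular_slope_cong:
  assumes "\<And>z. 0 < Re z \<Longrightarrow> g z = k z"
  shows "angular_slope g a \<longleftrightarrow> angular_slope k a"
  unfolding angular_slope_def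
  by (intro tendsto_cong eventually_mono[OF eventually_sector_infinity_Re_pos]) (simp add: assms)

text \<open>A Rouche argument: on the circle of radius \<open>d * norm z\<^sub>0\<close> about
  \<open>z\<^sub>0\<close> the linear term \<open>a * (z - z\<^sub>0)\<close> outweighs the error g
  z - a z, so g takes the value of its linear model close to where the model takes it.\<close>

lemma angular_slope_local_inverse:
  assumes hol: "g holomorphic_on half_plane" and sl: "angular_slope g a" and a: "a \<noteq> 0" and e: "0 < e"
  shows "\<forall>\<^sub>F z\<^sub>0 in sector_infinity. \<exists>z. 0 < Re z \<and> norm (z - z\<^sub>0) < e * norm z\<^sub>0 \<and> g z = a * z\<^sub>0"
  unfolding eventually_sector_infinity
proof (intro allI impI)
  fix N :: real assume N: "1 < N"
  define d where "d = min (e / 2) (1 / (2 * N))"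
  have d: "0 < d" "d < e" "d \<le> 1 / (2 * N)" using e N by (auto simp: d_def)
  \<comment> \<open>In units of \<open>\<eta> * norm z\<^sub>0\<close> the function F is at most 2
    at the centre and at least 8 - 2 = 6 on the circle.\<close>
  define \<eta> where "\<eta> = norm a * d / 8"
  have \<eta>: "0 < \<eta>" using a d by (simp add: \<eta>_def)
  have N4: "1 < 4 * N" using N by simp
  obtain r where r: "0 < r" "\<And>z. r \<le> norm z \<Longrightarrow> norm z < 4 * N * Re z \<Longrightarrow> norm (g z - a * z) \<le> \<eta> * norm z"
    by (rule eventually_sector_infinityD[OF angular_slope_eventually[OF sl \<eta>] N4]) blast
  show "\<exists>r. \<forall>z\<^sub>0. r \<le> norm z\<^sub>0 \<and> norm z\<^sub>0 < N * Re z\<^sub>0 \<longrightarrow>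
      (\<exists>z. 0 < Re z \<and> norm (z - z\<^sub>0) < e * norm z\<^sub>0 \<and> g z = a * z\<^sub>0)"
  proof (intro exI[of _ "2 * r"] allI impI)
    fix z\<^sub>0 assume z0: "2 * r \<le> norm z\<^sub>0 \<and> norm z\<^sub>0 < N * Re z\<^sub>0"
    have z0p: "0 < norm z\<^sub>0" using z0 r by linarith
    have near: "norm (z - z\<^sub>0) \<le> norm z\<^sub>0 / (2 * N)" if "norm (z - z\<^sub>0) \<le> d * norm z\<^sub>0" for z
    proof -
      have "d * norm z\<^sub>0 \<le> 1 / (2 * N) * norm z\<^sub>0" using d by (intro mult_right_mono) auto
      thus ?thesis using that by simp
    qed
    have bnd: "0 < Re z \<and> norm (g z - a * z) \<le> 2 * \<eta> * norm z\<^sub>0" if "norm (z - z\<^sub>0) \<le> d * norm z\<^sub>0" for z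
    proof -
      note p = sector_perturb[OF N conjunct2[OF z0] near[OF that]]
      have "norm (g z - a * z) \<le> \<eta> * norm z" using p z0 by (intro r) auto
      also have "\<dots> \<le> \<eta> * (2 * norm z\<^sub>0)" using p \<eta> by (intro mult_left_mono) auto
      finally show ?thesis using p by simp
    qed
    define F where "F = (\<lambda>z. g z - a * z\<^sub>0)"
    have sub: "cball z\<^sub>0 (d * norm z\<^sub>0) \<subseteq> half_plane"
      using bnd by (auto simp: half_plane_def dist_norm norm_minus_commute)
    have hF: "F holomorphic_on cball z\<^sub>0 (d * norm z\<^sub>0)"
      unfolding F_def by (intro holomorphic_intros holomorphic_on_subset[OF hol] sub)
    obtain z where z: "z \<in> ball z\<^sub>0 (d * norm z\<^sub>0)" "F z = 0"
    proof (rule holomorphic_contract_to_zero[of z\<^sub>0 "d * norm z\<^sub>0" F])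
      show "continuous_on (cball z\<^sub>0 (d * norm z\<^sub>0)) F" by (rule holomorphic_on_imp_continuous_on[OF hF])
      show "F holomorphic_on ball z\<^sub>0 (d * norm z\<^sub>0)" by (rule holomorphic_on_subset[OF hF]) auto
      show "0 < d * norm z\<^sub>0" using d z0p by simp
      show "norm (F z\<^sub>0) < norm (F z)" if "norm (z\<^sub>0 - z) = d * norm z\<^sub>0" for z
      proof -
        have "norm (F z\<^sub>0) \<le> 2 * \<eta> * norm z\<^sub>0" using bnd[of z\<^sub>0] d z0p by (simp add: F_def)
        moreover have "norm (g z - a * z) \<le> 2 * \<eta> * norm z\<^sub>0" using bnd[of z] that by (simp add: norm_minus_commute)
        moreover have "norm (a * (z - z\<^sub>0)) = 8 * \<eta> * norm z\<^sub>0"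
          using that by (simp add: norm_mult norm_minus_commute \<eta>_def)
        moreover have "norm (a * (z - z\<^sub>0)) \<le> norm (F z) + norm (g z - a * z)"
          using norm_triangle_ineq4[of "F z" "g z - a * z"] by (simp add: F_def algebra_simps)
        moreover have "0 < \<eta> * norm z\<^sub>0" using \<eta> z0p by simp
        ultimately show ?thesis by linarith
      qed
    qed
    have "norm (z - z\<^sub>0) < d * norm z\<^sub>0" using z by (simp add: dist_norm norm_minus_commute)
    moreover have "d * norm z\<^sub>0 \<le> e * norm z\<^sub>0" using d by (intro mult_right_mono) auto
    ultimately show "\<exists>z. 0 < Re z \<and> norm (z - z\<^sub>0) < e * norm z\<^sub>0 \<and> g z = a * z\<^sub>0"
      using z bnd[of z] by (intro exI[of _ z]) (auto simp: F_def)
  qed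
qed

text \<open>Multiplication by a positive real preserves every sector, and a small relative error
  only widens it. Slope 0 would leave the direction of h z uncontrolled.\<close>

lemma filterlim_angular_slope:
  assumes sl: "angular_slope h (of_real c)" and c: "0 < c"
  shows "filterlim h sector_infinity sector_infinity"
  unfolding filterlim_iff
proof (intro allI impI)
  fix P :: "complex \<Rightarrow> bool" assume P: "eventually P sector_infinity"
  show "\<forall>\<^sub>F z in sector_infinity. P (h z)"
    unfolding eventually_sector_infinity
  proof (intro allI impI)
    fix N :: real assume N: "1 < N"
    have N4: "1 < 4 * N" using N by simp
    obtain r where r: "0 < r" "\<And>z. r \<le> norm z \<Longrightarrow> norm z < 4 * N * Re z \<Longrightarrow> P z"
      by (rule eventually_sector_infinityD[OF P N4]) blast
    have "0 < c / (2 * N)" using c N by simp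
    from eventually_sector_infinityD[OF angular_slope_eventually[OF sl this] N]
    obtain s where s: "0 < s" "\<And>z. s \<le> norm z \<Longrightarrow> norm z < N * Re z \<Longrightarrow>
        norm (h z - of_real c * z) \<le> c / (2 * N) * norm z" by blast
    show "\<exists>r. \<forall>z. r \<le> norm z \<and> norm z < N * Re z \<longrightarrow> P (h z)"
    proof (intro exI[of _ "max s (2 * r / c)"] allI impI)
      fix z assume z: "max s (2 * r / c) \<le> norm z \<and> norm z < N * Re z"
      define z\<^sub>0 where "z\<^sub>0 = of_real c * z"
      have n0: "norm z\<^sub>0 = c * norm z" using c by (simp add: z\<^sub>0_def norm_mult)
      have 1: "norm (h z - z\<^sub>0) \<le> norm z\<^sub>0 / (2 * N)" using s(2)[of z] z c by (simp add: n0) (simp add: z\<^sub>0_def)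
      have 2: "norm z\<^sub>0 < N * Re z\<^sub>0" using z c by (simp add: n0) (simp add: z\<^sub>0_def)
      have "r \<le> norm z\<^sub>0 / 2" using z c by (simp add: n0 field_simps)
      thus "P (h z)" using sector_perturb[OF N 2 1] r(2)[of "h z"] by auto
    qed
  qed
qed

lemma angular_slope_compose:
  assumes g: "angular_slope g a" and h: "angular_slope h (of_real c)" and c: "0 < c"
  shows "angular_slope (\<lambda>z. g (h z)) (a * of_real c)"
proof -
  note fl = filterlim_angular_slope[OF h c]
  have "((\<lambda>z. g (h z) / h z * (h z / z)) \<longlongrightarrow> a * of_real c) sector_infinity"
    by (intro tendsto_mult filterlim_compose[OF g[unfolded angular_slope_def] fl] h[unfolded angular_slope_def])
  moreover have "\<forall>\<^sub>F z in sector_infinity. g (h z) / h z * (h z / z) = g (h z) / z"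
    using eventually_compose_filterlim[OF eventually_sector_infinity_nonzero fl]
    by eventually_elim simp
  ultimately show ?thesis unfolding angular_slope_def by (rule Lim_transform_eventually)
qed

text \<open>The values of h must be seen to fill sectors: by
  \<open>angular_slope_local_inverse\<close> every far y is \<open>h z\<close> with z close to y /
  c, and there the slope of the composition determines g y up to a small relative error.\<close>

lemma angular_slope_compose_cancel:
  assumes gh: "angular_slope (\<lambda>z. g (h z)) b" and h: "angular_slope h (of_real c)" and c: "0 < c"
    and hol: "h holomorphic_on half_plane"
  shows "angular_slope g (b / of_real c)"
  unfolding angular_slope_def
proof (rule tendstoI)
  fix e :: real assume e: "0 < e"
  show "\<forall>\<^sub>F y in sector_infinity. dist (g y / y) (b / of_real c) < e"
    unfolding eventually_sector_infinity
  proof (intro allI impI)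
    fix N :: real assume N: "1 < N"
    have N4: "1 < 4 * N" using N by simp
    define B where "B = norm b + 1"
    define e1 where "e1 = min 1 (c * e / 4)"
    have e1: "0 < e1" "e1 \<le> 1" "e1 \<le> c * e / 4" using c e by (auto simp: e1_def)
    define d where "d = min (1 / (2 * N)) (c * e / (4 * B))"
    have B: "0 < B" by (simp add: B_def add_nonneg_pos)
    have d: "0 < d" "d \<le> 1 / (2 * N)" "d \<le> c * e / (4 * B)" using N B c e by (auto simp: d_def)
    from eventually_sector_infinityD[OF tendstoD[OF gh[unfolded angular_slope_def] e1(1)] N4]
    obtain r where r: "0 < r" "\<And>z. r \<le> norm z \<Longrightarrow> norm z < 4 * N * Re z \<Longrightarrow> dist (g (h z) / z) b < e1" by blast
    have c0: "complex_of_real c \<noteq> 0" using c by simp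
    from eventually_sector_infinityD[OF angular_slope_local_inverse[OF hol h c0 d(1)] N]
    obtain s where s: "0 < s" "\<And>z\<^sub>0. s \<le> norm z\<^sub>0 \<Longrightarrow> norm z\<^sub>0 < N * Re z\<^sub>0 \<Longrightarrow>
      \<exists>z. 0 < Re z \<and> norm (z - z\<^sub>0) < d * norm z\<^sub>0 \<and> h z = of_real c * z\<^sub>0" by blast
    show "\<exists>r. \<forall>z. r \<le> norm z \<and> norm z < N * Re z \<longrightarrow> dist (g z / z) (b / of_real c) < e"
    proof (intro exI[of _ "c * max s (2 * r)"] allI impI)
      fix y assume y: "c * max s (2 * r) \<le> norm y \<and> norm y < N * Re y"
      hence y': "max s (2 * r) * c \<le> norm y" by (simp only: mult.commute)
      define z\<^sub>0 where "z\<^sub>0 = y / of_real c"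
      have n0: "norm z\<^sub>0 = norm y / c" using c by (simp add: z\<^sub>0_def norm_divide)
      have ge: "max s (2 * r) \<le> norm z\<^sub>0" using y' c by (simp only: n0 le_divide_eq if_True)
      have z0s: "norm z\<^sub>0 < N * Re z\<^sub>0" using y c by (simp add: n0 divide_strict_right_mono) (simp add: z\<^sub>0_def Re_divide_of_real divide_strict_right_mono)
      obtain z where z: "0 < Re z" "norm (z - z\<^sub>0) < d * norm z\<^sub>0" "h z = of_real c * z\<^sub>0"
        using s(2)[of z\<^sub>0] ge z0s by auto
      have hy: "h z = y" using z c by (simp add: z\<^sub>0_def)
      have "d * norm z\<^sub>0 \<le> 1 / (2 * N) * norm z\<^sub>0" using d by (intro mult_right_mono) auto
      hence near: "norm (z - z\<^sub>0) \<le> norm z\<^sub>0 / (2 * N)" using z by simp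
      note p = sector_perturb[OF N z0s near]
      have z0p: "0 < norm z\<^sub>0" using ge s by linarith
      have zne: "z \<noteq> 0" "z\<^sub>0 \<noteq> 0" "y \<noteq> 0" using z(1) z0p by (auto simp: z\<^sub>0_def)
      define q where "q = g y / z"
      have q: "norm (q - b) < e1" using r(2)[of z] p ge by (simp add: q_def hy dist_norm)
      hence qB: "norm q \<le> B" using norm_triangle_ineq[of "q - b" b] e1 by (simp add: B_def)
      have "g y / y = q * (z / z\<^sub>0) / of_real c" using zne c by (simp add: q_def z\<^sub>0_def field_simps)
      hence "g y / y - b / of_real c = (q * (z / z\<^sub>0 - 1) + (q - b)) / of_real c"
        using c by (simp add: field_simps)
      hence "norm (g y / y - b / of_real c) = norm (q * (z / z\<^sub>0 - 1) + (q - b)) / c"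
        using c by (simp add: norm_divide)
      also have "\<dots> \<le> (norm q * norm (z / z\<^sub>0 - 1) + norm (q - b)) / c"
        using c norm_triangle_ineq[of "q * (z / z\<^sub>0 - 1)" "q - b"] by (intro divide_right_mono) (auto simp: norm_mult)
      also have "\<dots> \<le> (B * d + e1) / c"
      proof (intro divide_right_mono add_mono mult_mono qB)
        have "z / z\<^sub>0 - 1 = (z - z\<^sub>0) / z\<^sub>0" using zne by (simp add: field_simps)
        thus "norm (z / z\<^sub>0 - 1) \<le> d" using z z0p by (simp add: norm_divide field_simps)
      qed (use c q B in auto)
      also have "B * d \<le> c * e / 4" using d(3) B by (simp add: field_simps)
      hence "(B * d + e1) / c \<le> (c * e / 4 + c * e / 4) / c" using e1 c by (intro divide_right_mono) auto
      also have "\<dots> = e / 2" using c by simp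
      also have "\<dots> < e" using e by simp
      finally show "dist (g y / y) (b / of_real c) < e" by (simp add: dist_norm)
    qed
  qed
qed

text \<open>
  The two image sectors of \<open>g \<circ> h\<close> and \<open>g\<close> overlap unless \<open>b / a\<close> is negative; \<open>csqrt\<close> picks
  a direction in the overlap.
\<close>
lemma angular_slope_quotient:
  assumes gh: "angular_slope (\<lambda>z. g (h z)) b" and g: "angular_slope g a" and h: "angular_slope h c"
    and hol: "g holomorphic_on half_plane" and inj: "inj_on g half_plane"
    and hpos: "\<And>z. 0 < Re z \<Longrightarrow> 0 < Re (h z)"
    and a: "a \<noteq> 0" and ba: "b / a \<notin> \<real>\<^sub>\<le>\<^sub>0"
  shows "c = b / a"
proof -
  define q where "q = csqrt (b / a)"
  have q2: "q\<^sup>2 = b / a" by (simp add: q_def)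
  have Rq: "0 < Re q"
  proof (rule ccontr)
    assume "\<not> 0 < Re q"
    hence "Re q = 0" using csqrt_principal[of "b / a"] by (auto simp: q_def)
    hence "q = \<i> * of_real (Im q)" by (simp add: complex_eq_iff)
    hence "q\<^sup>2 = (\<i> * of_real (Im q))\<^sup>2" by simp
    also have "\<dots> = of_real (- (Im q)\<^sup>2)" by (simp add: power_mult_distrib)
    finally have "b / a = of_real (- (Im q)\<^sup>2)" using q2 by simp
    hence "b / a \<in> \<real>\<^sub>\<le>\<^sub>0" by (simp only: nonpos_Reals_of_real_iff) simp
    thus False using ba by simp
  qed
  have b0: "b / a \<noteq> 0" using ba by auto
  \<comment> \<open>The rotation by b / a is split symmetrically: the direction cnj q is turned into
    \<open>b / a * cnj q = of_real ((norm q)\<^sup>2) * q\<close>, and both cnj q and q have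
    positive real part.\<close>
  define z where "z = (\<lambda>x. of_real x * cnj q)"
  have fz: "filterlim z sector_infinity at_top"
    unfolding z_def by (rule filterlim_ray_sector_infinity) (simp add: Rq)
  define y where "y = (\<lambda>x. g (h (z x)) / a)"
  have l1: "((\<lambda>x. g (h (z x)) / z x) \<longlongrightarrow> b) at_top"
    using filterlim_compose[OF gh[unfolded angular_slope_def] fz] .
  hence l2: "((\<lambda>x. y x / z x) \<longlongrightarrow> b / a) at_top"
    using tendsto_divide[OF l1 tendsto_const a] by (simp add: y_def field_simps)
  have "((\<lambda>x. y x / z x * cnj q) \<longlongrightarrow> b / a * cnj q) at_top"
    by (intro tendsto_mult l2 tendsto_const)
  moreover have "\<forall>\<^sub>F x in at_top. y x / z x * cnj q = y x / of_real x"
    using eventually_gt_at_top[of 0] by eventually_elim (use Rq in \<open>auto simp: z_def\<close>)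
  ultimately have "((\<lambda>x. y x / of_real x) \<longlongrightarrow> b / a * cnj q) at_top"
    by (rule Lim_transform_eventually)
  moreover have "b / a * cnj q = of_real ((norm q)\<^sup>2) * q"
    unfolding complex_norm_square q2[symmetric] by (simp add: power2_eq_square)
  moreover have "0 < Re (of_real ((norm q)\<^sup>2) * q)"
  proof -
    have "q \<noteq> 0" using Rq by auto
    thus ?thesis using Rq by simp
  qed
  ultimately have fy: "filterlim y sector_infinity at_top"
    using filterlim_sector_infinityI by metis
  have lh: "((\<lambda>x. h (z x) / z x) \<longlongrightarrow> c) at_top"
    using filterlim_compose[OF h[unfolded angular_slope_def] fz] .
  have "((\<lambda>x. (h (z x) / z x) / (y x / z x)) \<longlongrightarrow> c / (b / a)) at_top"
    by (intro tendsto_divide lh l2 b0)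
  moreover have "\<forall>\<^sub>F x in at_top. (h (z x) / z x) / (y x / z x) = h (z x) / y x"
    using eventually_compose_filterlim[OF eventually_sector_infinity_nonzero fz]
    by eventually_elim auto
  ultimately have lq: "((\<lambda>x. h (z x) / y x) \<longlongrightarrow> c / (b / a)) at_top"
    by (rule Lim_transform_eventually)
  \<comment> \<open>Near \<open>y x\<close> there is v with
    \<open>g v = a * y x = g (h (z x))\<close>. Injectivity identifies v with
    \<open>h (z x)\<close>, so the quotient \<open>h (z x) / y x\<close> tends to 1.\<close>
  have le: "norm (c / (b / a) - 1) \<le> e" if e: "0 < e" for e
  proof (rule Lim_norm_ubound[of at_top])
    show "((\<lambda>x. h (z x) / y x - 1) \<longlongrightarrow> c / (b / a) - 1) at_top" by (intro tendsto_diff lq tendsto_const)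
    show "\<forall>\<^sub>F x in at_top. norm (h (z x) / y x - 1) \<le> e"
      using eventually_compose_filterlim[OF angular_slope_local_inverse[OF hol g a e] fy]
        eventually_compose_filterlim[OF eventually_sector_infinity_nonzero fy]
        eventually_compose_filterlim[OF eventually_sector_infinity_Re_pos fz]
    proof eventually_elim
      case (elim x)
      then obtain v where v: "0 < Re v" "norm (v - y x) < e * norm (y x)" "g v = a * y x" by blast
      have "g v = g (h (z x))" using v a by (simp add: y_def)
      hence "v = h (z x)" using inj v hpos elim by (auto simp: inj_on_def half_plane_def)
      moreover have "h (z x) / y x - 1 = (h (z x) - y x) / y x" using elim by (simp add: field_simps)
      moreover have "0 < norm (y x)" using elim by simp
      ultimately show ?case using v by (simp add: norm_divide field_simps)
    qed
  qed simp
  have "norm (c / (b / a) - 1) \<le> 0"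
    by (rule field_le_epsilon) (simp only: add_0 le)
  hence "c / (b / a) = 1" by simp
  thus ?thesis using b0 divide_eq_1_iff by blast
qed

section \<open>Left limits of the slopes\<close>

lemma inj_on_exp_strip: "inj_on exp {z. \<bar>Im z\<bar> < pi / 2}"
proof (rule inj_onI)
  fix z w :: complex
  assume zw: "z \<in> {z. \<bar>Im z\<bar> < pi / 2}" "w \<in> {z. \<bar>Im z\<bar> < pi / 2}" "exp z = exp w"
  have "Ln (exp v) = v" if "\<bar>Im v\<bar> < pi / 2" for v
    using that pi_gt_zero by (intro Ln_exp) auto
  with zw show "z = w" by (metis mem_Collect_eq)
qed

text \<open>
  Under these hypotheses the curve \<open>\<gamma>\<close> has to run from \<open>norm z = \<rho>\<close> to \<open>norm z = e * \<rho>\<close> within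
  the angle \<open>1/1000\<close> of the boundary of the half-plane. On each arc \<open>norm z = const\<close> the images of
  this thin part have length at least \<open>\<alpha> \<rho> / 2\<close>, which contradicts the boundedness of the
  area swept out by them.
\<close>
lemma no_thin_crossing:
  fixes \<gamma> :: "real \<Rightarrow> complex"
  assumes hol: "g holomorphic_on half_plane" and inj: "inj_on g half_plane"
    and \<alpha>: "0 < \<alpha>"
    and near: "\<And>x y. ln \<rho> \<le> x \<Longrightarrow> x \<le> ln \<rho> + 1 \<Longrightarrow> \<bar>y\<bar> \<le> pi / 2 - 1 / 1000 \<Longrightarrow>
        norm (g (exp (Complex x y)) + \<alpha> * exp (Complex x y)) \<le> \<alpha> * exp x / 5"
    and \<rho>: "0 < \<rho>"
    and cont: "continuous_on {1..} \<gamma>" and \<gamma>: "\<And>x. 1 \<le> x \<Longrightarrow> 0 < Re (\<gamma> x)"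
    and start: "norm (\<gamma> 1) \<le> \<rho>" and far: "1 \<le> X" "exp 1 * \<rho> \<le> norm (\<gamma> X)"
    and sep: "\<And>x z. 1 \<le> x \<Longrightarrow> 0 \<le> Re z \<Longrightarrow> \<rho> \<le> norm z \<Longrightarrow> 7 / 10 * \<alpha> * norm z \<le> norm (g (\<gamma> x) + \<alpha> * z)"
  shows False
proof -
  define U where "U = {z. \<bar>Im z\<bar> < pi / 2}"
  define \<theta> where "\<theta> = pi / 2 - 1 / 1000"
  have \<theta>: "0 < \<theta>" "\<theta> < pi / 2" using pi_gt3 by (auto simp: \<theta>_def)
  \<comment> \<open>Logarithmic coordinates: the arcs \<open>norm z = exp x\<close> become vertical
    segments of the strip U, and the crossing from \<rho> to \<open>exp 1 * \<rho>\<close> has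
    horizontal width 1.\<close>
  define \<Phi> where "\<Phi> = (\<lambda>z. g (exp z))"
  have opU: "open U"
  proof -
    have "U = {z. Im z < pi / 2} \<inter> {z. - (pi / 2) < Im z}" by (auto simp: U_def)
    thus ?thesis by (simp only: open_Int open_halfspace_Im_lt open_halfspace_Im_gt)
  qed
  have expU: "exp z \<in> half_plane" if "z \<in> U" for z
    using that cos_gt_zero_pi[of "Im z"] by (auto simp: U_def half_plane_def Re_exp abs_less_iff)
  have hol\<Phi>: "\<Phi> holomorphic_on U"
    unfolding \<Phi>_def using holomorphic_on_compose_gen[OF holomorphic_on_exp hol, of U] expU
    by (auto simp: o_def)
  have inj\<Phi>: "inj_on \<Phi> U"
    unfolding \<Phi>_def using inj inj_on_exp_strip expU by (auto simp: inj_on_def U_def)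
  have cont\<Phi>: "continuous_on A (\<lambda>y. \<Phi> (Complex x y))" if "\<And>y. y \<in> A \<Longrightarrow> \<bar>y\<bar> < pi / 2" for x A
    by (rule continuous_on_compose2[OF holomorphic_on_imp_continuous_on[OF hol\<Phi>]])
       (use that in \<open>auto simp: U_def Complex_eq intro!: continuous_intros\<close>)
  define J where "J = {\<theta><..<pi / 2} \<union> {- (pi / 2)<..<-\<theta>}"
  have J: "J \<in> sets lborel" "emeasure lborel J \<le> ennreal (2 / 1000)"
  proof -
    show "J \<in> sets lborel" by (simp add: J_def)
    have "emeasure lborel J \<le> emeasure lborel {\<theta><..<pi / 2} + emeasure lborel {- (pi / 2)<..<-\<theta>}"
      unfolding J_def by (rule emeasure_subadditive) auto
    also have "\<dots> = ennreal (1 / 1000) + ennreal (1 / 1000)"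
      using \<theta> by (simp add: \<theta>_def)
    also have "\<dots> = ennreal (2 / 1000)" by (simp flip: ennreal_plus)
    finally show "emeasure lborel J \<le> ennreal (2 / 1000)" .
  qed
  \<comment> \<open>L reflects 7/10 - 1/5 = 1/2, the distance kept by \<open>sep\<close> less the
    error allowed by \<open>near\<close>. At the edge of the thin part the image has norm at most
    6/5 times 2.72 \<alpha> \<rho>; adding L still stays below R.\<close>
  define R where "R = 4 * \<alpha> * \<rho>"
  define L where "L = \<alpha> * \<rho> / 2"
  have L: "0 < L" using \<alpha> \<rho> by (simp add: L_def)
  have e3: "exp 1 < (272 / 100 :: real)" using e_less_272 by simp
  \<comment> \<open>Divided by \<open>(\<alpha> * \<rho>)\<^sup>2\<close> this reads 1/4 \<le>
    128/1000; the thinness 1/1000 is small enough to make it false.\<close>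
  have "(ln \<rho> + 1 - ln \<rho>) * L\<^sup>2 \<le> (2 / 1000) * (4 * R\<^sup>2)"
  proof (rule length_area_le[OF hol\<Phi> opU inj\<Phi> _ less_imp_le[OF L] J])
    fix x assume x: "x \<in> {ln \<rho>..ln \<rho> + 1}"
    have ex: "\<rho> \<le> exp x" "exp x \<le> exp 1 * \<rho>"
    proof -
      show "\<rho> \<le> exp x" using x \<rho> by (metis atLeastAtMost_iff exp_le_cancel_iff exp_ln)
      have "exp x \<le> exp (ln \<rho> + 1)" using x by simp
      thus "exp x \<le> exp 1 * \<rho>" using \<rho> by (simp add: exp_add mult.commute)
    qed
    have "\<exists>t\<ge>1. t \<le> X \<and> norm (\<gamma> t) = exp x"
      by (rule IVT'[of "\<lambda>t. norm (\<gamma> t)"])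
         (use ex start far cont in \<open>auto intro!: continuous_on_norm intro: continuous_on_subset\<close>)
    then obtain t where t: "1 \<le> t" "norm (\<gamma> t) = exp x" by blast
    define \<theta>' where "\<theta>' = Arg (\<gamma> t)"
    have g0: "\<gamma> t \<noteq> 0" using \<gamma>[OF t(1)] by auto
    have th': "\<bar>\<theta>'\<bar> < pi / 2" using \<gamma>[OF t(1)] Arg_Re_pos[of "\<gamma> t"] by (simp add: \<theta>'_def)
    have gt: "\<gamma> t = exp (Complex x \<theta>')"
    proof -
      have "\<gamma> t = of_real (exp x) * exp (\<i> * of_real \<theta>')"
        using Arg_eq[OF g0] by (simp only: t \<theta>'_def)
      also have "\<dots> = exp (Complex x \<theta>')" by (simp only: Complex_eq exp_add exp_of_real)
      finally show ?thesis .
    qed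
    have ne: "norm (exp (Complex x y)) = exp x" for y by simp
    have Re0: "0 \<le> Re (exp (Complex x y))" if "\<bar>y\<bar> < pi / 2" for y
      using expU[of "Complex x y"] that by (simp add: U_def half_plane_def)
    \<comment> \<open>Outside the thin part \<open>near\<close> and \<open>sep\<close>, both taken
      at the point \<open>\<gamma> t\<close> itself, contradict each other.\<close>
    have out: "\<theta> < \<bar>\<theta>'\<bar>"
    proof (rule ccontr)
      assume "\<not> \<theta> < \<bar>\<theta>'\<bar>"
      hence "norm (g (\<gamma> t) + \<alpha> * \<gamma> t) \<le> \<alpha> * exp x / 5"
        using near[of x \<theta>'] x by (simp add: gt \<theta>_def)
      moreover have "7 / 10 * \<alpha> * norm (\<gamma> t) \<le> norm (g (\<gamma> t) + \<alpha> * \<gamma> t)"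
        using \<gamma>[OF t(1)] t ex by (intro sep) auto
      ultimately have "7 / 10 * \<alpha> * exp x \<le> \<alpha> * exp x / 5" using t by simp
      moreover have "0 < \<alpha> * exp x" using \<alpha> by simp
      ultimately show False by linarith
    qed
    have key: "L \<le> norm (\<Phi> (Complex x \<theta>') - \<Phi> (Complex x y)) \<and> norm (\<Phi> (Complex x y)) + L \<le> R"
      if y: "\<bar>y\<bar> = \<theta>" for y
    proof -
      define z where "z = exp (Complex x y)"
      have nz: "norm z = exp x" by (simp add: z_def)
      have n: "norm (g z + \<alpha> * z) \<le> \<alpha> * exp x / 5"
        using near[of x y] x y by (simp add: z_def \<theta>_def)
      have "7 / 10 * \<alpha> * norm z \<le> norm (g (\<gamma> t) + \<alpha> * z)"
        using Re0[of y] y \<theta> t ex by (intro sep) (auto simp: z_def)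
      also have "\<dots> \<le> norm (g (\<gamma> t) - g z) + norm (g z + \<alpha> * z)"
        using norm_triangle_ineq[of "g (\<gamma> t) - g z" "g z + \<alpha> * z"] by simp
      finally have 1: "\<alpha> * exp x / 2 \<le> norm (g (\<gamma> t) - g z)" using n nz by simp
      have a1: "\<alpha> * \<rho> \<le> \<alpha> * exp x" using ex \<alpha> by simp
      have a2: "\<alpha> * exp x \<le> 272 / 100 * (\<alpha> * \<rho>)"
      proof -
        have "exp x \<le> 272 / 100 * \<rho>" using ex e3 \<rho> by (smt (verit) mult_right_mono)
        thus ?thesis using \<alpha> by (simp add: mult.left_commute)
      qed
      have "norm (g z) \<le> norm (g z + \<alpha> * z) + norm (\<alpha> * z)"
        using norm_triangle_ineq4[of "g z + \<alpha> * z" "\<alpha> * z"] by simp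
      also have "norm (complex_of_real \<alpha> * z) = \<alpha> * exp x" using \<alpha> nz by (simp add: norm_mult)
      finally have "norm (g z) + L \<le> R" using n a1 a2 unfolding L_def R_def by linarith
      thus ?thesis using 1 a1 by (simp add: \<Phi>_def gt z_def L_def)
    qed
    show "\<exists>p q. p \<le> q \<and> {p<..<q} \<subseteq> J \<and> (\<forall>y\<in>{p..q}. Complex x y \<in> U) \<and>
        (\<forall>y\<in>{p<..<q}. norm (\<Phi> (Complex x y)) < R) \<and> L \<le> norm (\<Phi> (Complex x q) - \<Phi> (Complex x p))"
    proof (cases "0 < \<theta>'")
      case True
      hence th: "\<theta> < \<theta>'" "\<theta>' < pi / 2" using out th' by auto
      have "continuous_on {\<theta>..\<theta>'} (\<lambda>y. \<Phi> (Complex x y))"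
        using th \<theta> by (intro cont\<Phi>) auto
      then obtain q where q: "\<theta> \<le> q" "q \<le> \<theta>'" "\<And>y. y \<in> {\<theta><..<q} \<Longrightarrow> norm (\<Phi> (Complex x y)) < R"
          "L \<le> norm (\<Phi> (Complex x q) - \<Phi> (Complex x \<theta>))"
        by (rule initial_subpath_in_ball[of \<theta> \<theta>' _ L R]) (use th key[of \<theta>] \<theta> L in auto)
      show ?thesis
        by (rule exI[of _ \<theta>], rule exI[of _ q]) (use q th \<theta> in \<open>auto simp: J_def U_def\<close>)
    next
      case False
      hence th: "\<theta> < - \<theta>'" "- \<theta>' < pi / 2" using out th' by auto
      \<comment> \<open>The segment is traversed from the edge -\<theta> downwards, because the norm
        bound that \<open>initial_subpath_in_ball\<close> asks of the starting point is known at the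
        edge.\<close>
      have "continuous_on {\<theta>..- \<theta>'} (\<lambda>y. \<Phi> (Complex x (- y)))"
        by (rule continuous_on_compose2[of "{\<theta>'..-\<theta>}" "\<lambda>y. \<Phi> (Complex x y)" _ uminus])
           (use th \<theta> in \<open>auto intro!: cont\<Phi> continuous_intros\<close>)
      then obtain q where q: "\<theta> \<le> q" "q \<le> - \<theta>'" "\<And>y. y \<in> {\<theta><..<q} \<Longrightarrow> norm (\<Phi> (Complex x (- y))) < R"
          "L \<le> norm (\<Phi> (Complex x (- q)) - \<Phi> (Complex x (- \<theta>)))"
        by (rule initial_subpath_in_ball[of \<theta> "-\<theta>'" _ L R]) (use th key[of "-\<theta>"] \<theta> L in auto)
      have "norm (\<Phi> (Complex x y)) < R" if "y \<in> {-q<..<-\<theta>}" for y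
        using q(3)[of "-y"] that by auto
      thus ?thesis
        by (intro exI[of _ "-q"] exI[of _ "-\<theta>"])
           (use q th \<theta> in \<open>auto simp: J_def U_def norm_minus_commute\<close>)
    qed
  qed auto
  moreover have "(\<alpha> * \<rho>)\<^sup>2 > 0" using \<alpha> \<rho> by simp
  ultimately show False by (simp add: L_def R_def power_divide power_mult_distrib)
qed

lemma angular_slope_divide:
  "angular_slope g a \<Longrightarrow> angular_slope (\<lambda>z. g z / b) (a / b)"
  unfolding angular_slope_def using tendsto_mult_right[of "\<lambda>z. g z / z" a sector_infinity "1 / b"]
  by (simp add: mult.commute)

lemma angular_slope_along_ray:
  assumes "angular_slope g a"
  shows "((\<lambda>x. g (of_real x) / of_real x) \<longlongrightarrow> a) at_top"
  using filterlim_compose[OF assms[unfolded angular_slope_def] filterlim_ray_sector_infinity[of 1]] by simp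

text \<open>
  The slopes \<open>a u\<close> of the maps \<open>g u\<close> cannot jump to the opposite direction at \<open>t\<close>: the curve
  \<open>h u\<close> of the positive axis would satisfy the hypotheses of \<open>no_thin_crossing\<close>.
\<close>
lemma no_opposite_left_limit:
  fixes g h :: "real \<Rightarrow> complex \<Rightarrow> complex"
  assumes st: "s < t"
    and hol: "\<And>u. s \<le> u \<Longrightarrow> u \<le> t \<Longrightarrow> g u holomorphic_on half_plane"
    and inj: "\<And>u. s \<le> u \<Longrightarrow> u \<le> t \<Longrightarrow> inj_on (g u) half_plane"
    and hhol: "\<And>u. s \<le> u \<Longrightarrow> u < t \<Longrightarrow> h u holomorphic_on half_plane"
    and hpos: "\<And>u z. s \<le> u \<Longrightarrow> u < t \<Longrightarrow> 0 < Re z \<Longrightarrow> 0 < Re (h u z)"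
    and gh: "\<And>u z. s \<le> u \<Longrightarrow> u < t \<Longrightarrow> 0 < Re z \<Longrightarrow> g u (h u z) = g s z"
    and hslope: "\<And>u. s \<le> u \<Longrightarrow> u < t \<Longrightarrow> \<exists>c>0. angular_slope (h u) (complex_of_real c)"
    and slope_s: "angular_slope (g s) a" and a: "a \<noteq> 0"
    and slope_t: "angular_slope (g t) b" and \<alpha>: "0 < \<alpha>" "b / a = - complex_of_real \<alpha>"
    and unif: "\<And>K e. compact K \<Longrightarrow> K \<subseteq> half_plane \<Longrightarrow> 0 < e \<Longrightarrow>
        \<forall>\<^sub>F u in at_left t. \<forall>z\<in>K. norm (g u z - g t z) < e"
    and bound: "\<forall>\<^sub>F u in at_left t. norm (h u 1) \<le> B"
  shows False
proof -
  \<comment> \<open>By \<open>gh\<close>, for x > 0 this is also \<open>g u (h u x) / a\<close> for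
    every u in \<open>{s..<t}\<close>: the image of the moving curve is fixed.\<close>
  define p where "p = (\<lambda>x::real. g s (of_real x) / a)"
  have "((\<lambda>x. p x / of_real x) \<longlongrightarrow> 1) at_top"
    unfolding p_def using angular_slope_along_ray[OF angular_slope_divide[OF slope_s, of a]] a by simp
  from tendstoD[OF this, of "1 / 20"]
  obtain X\<^sub>0 where "\<And>x. X\<^sub>0 \<le> x \<Longrightarrow> dist (p x / of_real x) 1 < 1 / 20"
    by (auto simp: eventually_at_top_linorder)
  then obtain X\<^sub>1 where X1: "1 \<le> X\<^sub>1" "\<And>x. X\<^sub>1 \<le> x \<Longrightarrow> dist (p x / of_real x) 1 < 1 / 20"
    by (metis max.cobounded1 max.cobounded2 order_trans)
  have p_near: "norm (p x - of_real x) \<le> x / 20" if "X\<^sub>1 \<le> x" for x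
  proof -
    have x: "0 < x" using that X1 by linarith
    have "p x - of_real x = (p x / of_real x - 1) * of_real x" using x by (simp add: field_simps)
    hence "norm (p x - of_real x) = norm (p x / of_real x - 1) * x" using x by (simp add: norm_mult)
    also have "\<dots> \<le> 1 / 20 * x" using X1(2)[OF that] x by (intro mult_right_mono) (auto simp: dist_norm)
    finally show ?thesis by simp
  qed
  have "continuous_on {1..X\<^sub>1} p"
    unfolding p_def
    by (intro continuous_on_divide continuous_on_const
          continuous_on_compose2[OF holomorphic_on_imp_continuous_on[OF hol[of s]]] continuous_on_of_real)
       (use st a in \<open>auto simp: half_plane_def\<close>)
  hence "bounded (p ` {1..X\<^sub>1})" by (intro compact_imp_bounded compact_continuous_image) auto
  then obtain C where C: "0 < C" "\<And>x. x \<in> {1..X\<^sub>1} \<Longrightarrow> norm (p x) \<le> C"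
    by (auto simp: bounded_pos)
  define \<theta> where "\<theta> = pi / 2 - 1 / 1000"
  have \<theta>: "0 < \<theta>" "\<theta> < pi / 2" using pi_gt3 by (auto simp: \<theta>_def)
  have cos\<theta>: "0 < cos \<theta>" "cos \<theta> \<le> 1" using \<theta> by (auto intro: cos_gt_zero)
  \<comment> \<open>The factor 2 makes \<open>norm z < N * Re z\<close> strict up to and including
    the angle \<theta>.\<close>
  define N where "N = 2 / cos \<theta>"
  have "cos \<theta> < 2" using cos\<theta> by linarith
  hence N: "1 < N" using cos\<theta>(1) by (simp only: N_def less_divide_eq if_True mult_1)
  have slope_t': "angular_slope (\<lambda>z. g t z / a) (- of_real \<alpha>)"
    using angular_slope_divide[OF slope_t, of a] \<alpha> by simp
  have "0 < \<alpha> / 10" using \<alpha> by simp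
  from eventually_sector_infinityD[OF angular_slope_eventually[OF slope_t' this] N]
  obtain r where r: "0 < r" "\<And>z. r \<le> norm z \<Longrightarrow> norm z < N * Re z \<Longrightarrow>
      norm (g t z / a - - of_real \<alpha> * z) \<le> \<alpha> / 10 * norm z" by blast
  \<comment> \<open>This must not depend on u, which is chosen only after K. So r comes from the
    limit map \<open>g t\<close>, B bounds the starting points of the curves, and
    \<open>4 * C / \<alpha>\<close> makes the initial piece of p small against
    \<open>\<alpha> * norm z\<close>.\<close>
  define \<rho> where "\<rho> = Max {1, r, B, 4 * C / \<alpha>}"
  have \<rho>: "1 \<le> \<rho>" "r \<le> \<rho>" "B \<le> \<rho>" "4 * C / \<alpha> \<le> \<rho>" by (auto simp: \<rho>_def)
  \<comment> \<open>For large x, the positive number x and \<alpha> z, whose real part is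
    nonnegative, cannot cancel: with y = \<alpha> norm z the norm of their sum is at least the root
    of x^2 + y^2, hence at least (3 x + 4 y) / 5. The error x / 20 of p is absorbed by 3 x / 5,
    leaving 4/5 of y. For small x, C is at most a quarter of y, leaving 3/4.\<close>
  have sep: "7 / 10 * \<alpha> * norm z \<le> norm (p x + of_real \<alpha> * z)"
    if x: "1 \<le> x" and z: "0 \<le> Re z" "\<rho> \<le> norm z" for x z
  proof (cases "X\<^sub>1 \<le> x")
    case True
    define y where "y = \<alpha> * norm z"
    have y: "0 \<le> y" using \<alpha> by (simp add: y_def)
    have "x\<^sup>2 + y\<^sup>2 \<le> (norm (of_real x + of_real \<alpha> * z))\<^sup>2"
      using x z \<alpha> unfolding y_def power_mult_distrib cmod_power2
      by (simp add: power2_eq_square algebra_simps)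
    moreover have "((3 * x + 4 * y) / 5)\<^sup>2 \<le> x\<^sup>2 + y\<^sup>2"
    proof -
      have "0 \<le> (4 * x - 3 * y)\<^sup>2" by simp
      thus ?thesis by (simp add: power2_eq_square field_simps)
    qed
    ultimately have "((3 * x + 4 * y) / 5)\<^sup>2 \<le> (norm (of_real x + of_real \<alpha> * z))\<^sup>2" by linarith
    hence "(3 * x + 4 * y) / 5 \<le> norm (of_real x + of_real \<alpha> * z)" by (rule power2_le_imp_le) simp
    moreover have "norm (of_real x + of_real \<alpha> * z) \<le> norm (p x + of_real \<alpha> * z) + norm (p x - of_real x)"
      using norm_triangle_ineq4[of "p x + of_real \<alpha> * z" "p x - of_real x"] by (simp add: algebra_simps)
    ultimately show ?thesis using p_near[OF True] x y by (simp add: y_def)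
  next
    case False
    have "norm (complex_of_real \<alpha> * z) \<le> norm (p x + of_real \<alpha> * z) + norm (p x)"
      using norm_triangle_ineq4[of "p x + of_real \<alpha> * z" "p x"] by simp
    moreover have "norm (p x) \<le> C" using C False x by auto
    moreover have "4 * C \<le> \<alpha> * norm z"
    proof -
      have "4 * C \<le> \<alpha> * \<rho>" using \<rho>(4) \<alpha> by (simp add: field_simps)
      also have "\<dots> \<le> \<alpha> * norm z" using z \<alpha> by simp
      finally show ?thesis .
    qed
    moreover have "norm (complex_of_real \<alpha> * z) = \<alpha> * norm z" using \<alpha> by (simp add: norm_mult)
    ultimately show ?thesis using C(1) by linarith
  qed
  \<comment> \<open>A closed polar rectangle, where locally uniform convergence of
    \<open>g u\<close> to \<open>g t\<close> is available. The slope error and the convergence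
    error, each a tenth of \<open>\<alpha> * norm z\<close>, add up to the 1/5 in
    \<open>near\<close>.\<close>
  define K where "K = exp ` ((\<lambda>(x, y). Complex x y) ` ({ln \<rho>..ln \<rho> + 1} \<times> {-\<theta>..\<theta>}))"
  have cK: "compact K"
    unfolding K_def case_prod_unfold Complex_eq
    by (intro compact_continuous_image continuous_intros compact_Times) auto
  have Re_exp_ge: "cos \<theta> * exp x \<le> Re (exp (Complex x y))" if "\<bar>y\<bar> \<le> \<theta>" for x y
  proof -
    have "cos \<theta> \<le> cos \<bar>y\<bar>" using that \<theta> by (intro cos_monotone_0_pi_le) auto
    thus ?thesis by (simp add: Re_exp mult.commute)
  qed
  have KH: "K \<subseteq> half_plane"
  proof
    fix z assume "z \<in> K"
    then obtain q where "z = exp (Complex (fst q) (snd q))" "q \<in> {ln \<rho>..ln \<rho> + 1} \<times> {-\<theta>..\<theta>}"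
      unfolding K_def case_prod_unfold by blast
    moreover from this(2) have "\<bar>snd q\<bar> \<le> \<theta>" by (auto simp: mem_Times_iff)
    from Re_exp_ge[OF this, of "fst q"] have "0 < Re (exp (Complex (fst q) (snd q)))"
      by (rule order_less_le_trans[rotated]) (use cos\<theta> in simp)
    ultimately show "z \<in> half_plane" by (simp only: half_plane_def mem_Collect_eq)
  qed
  have "0 < \<alpha> * \<rho> / 10 * norm a" using \<alpha> \<rho> a by simp
  from unif[OF cK KH this] bound eventually_at_left_real[OF st]
  have "\<forall>\<^sub>F u in at_left t. (\<forall>z\<in>K. norm (g u z - g t z) < \<alpha> * \<rho> / 10 * norm a) \<and> norm (h u 1) \<le> B \<and> u \<in> {s<..<t}"
    by eventually_elim blast
  then obtain u where u: "\<And>z. z \<in> K \<Longrightarrow> norm (g u z - g t z) < \<alpha> * \<rho> / 10 * norm a"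
      "norm (h u 1) \<le> B" "s < u" "u < t"
    using eventually_happens'[OF trivial_limit_at_left_real] by (metis (no_types, lifting) greaterThanLessThan_iff)
  \<comment> \<open>The positive slope at u < t sends the curve to infinity, so it does cross from
    radius \<rho> to \<open>exp 1 * \<rho>\<close>.\<close>
  obtain c where c: "0 < c" "angular_slope (h u) (of_real c)" using hslope[of u] u by auto
  have "filterlim (\<lambda>x. h u (of_real x)) sector_infinity at_top"
    by (rule filterlim_sector_infinityI[OF angular_slope_along_ray[OF c(2)]]) (use c in simp)
  from eventually_compose_filterlim[OF eventually_sector_infinity_norm_ge this, of "exp 1 * \<rho>"]
  obtain X\<^sub>2 where X2: "\<And>x. X\<^sub>2 \<le> x \<Longrightarrow> exp 1 * \<rho> \<le> norm (h u (of_real x))"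
    by (auto simp: eventually_at_top_linorder)
  show False
  proof (rule no_thin_crossing[of "\<lambda>z. g u z / a" \<alpha> \<rho> "\<lambda>x. h u (of_real x)" "max 1 X\<^sub>2"])
    show "(\<lambda>z. g u z / a) holomorphic_on half_plane" using u a by (intro holomorphic_intros hol) auto
    show "inj_on (\<lambda>z. g u z / a) half_plane" using inj[of u] u a by (auto simp: inj_on_def)
    show "norm (g u (exp (Complex x y)) / a + \<alpha> * exp (Complex x y)) \<le> \<alpha> * exp x / 5"
      if xy: "ln \<rho> \<le> x" "x \<le> ln \<rho> + 1" "\<bar>y\<bar> \<le> pi / 2 - 1 / 1000" for x y
    proof -
      define z where "z = exp (Complex x y)"
      have y: "\<bar>y\<bar> \<le> \<theta>" using xy by (simp add: \<theta>_def)
      have zK: "z \<in> K" unfolding K_def z_def using xy y by (intro imageI image_eqI[of _ _ "(x, y)"]) auto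
      have nz: "norm z = exp x" by (simp add: z_def)
      have "exp (ln \<rho>) \<le> exp x" using xy by simp
      hence \<rho>z: "\<rho> \<le> norm z" using nz \<rho> by simp
      have "norm z < N * Re z"
      proof -
        have "exp x \<le> Re z / cos \<theta>" using Re_exp_ge[OF y, of x] cos\<theta> by (simp add: z_def field_simps)
        moreover have "N * Re z = 2 * (Re z / cos \<theta>)" by (simp add: N_def)
        moreover have "0 < exp x" by simp
        ultimately show ?thesis using nz by linarith
      qed
      hence 1: "norm (g t z / a + of_real \<alpha> * z) \<le> \<alpha> / 10 * norm z" using r(2)[of z] \<rho> \<rho>z by simp
      have "norm (g u z / a - g t z / a) = norm (g u z - g t z) / norm a"
        by (simp add: norm_divide flip: diff_divide_distrib)
      also have "\<dots> \<le> \<alpha> * \<rho> / 10" using u(1)[OF zK] a by (simp add: divide_le_eq)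
      also have "\<dots> \<le> \<alpha> * norm z / 10" using \<rho>z \<alpha> by simp
      finally have 2: "norm (g u z / a - g t z / a) \<le> \<alpha> * norm z / 10" .
      have "norm (g u z / a + of_real \<alpha> * z) \<le> norm (g t z / a + of_real \<alpha> * z) + norm (g u z / a - g t z / a)"
        using norm_triangle_ineq[of "g t z / a + of_real \<alpha> * z" "g u z / a - g t z / a"] by (simp add: algebra_simps)
      thus ?thesis using 1 2 nz by (simp add: z_def)
    qed
    show "continuous_on {1..} (\<lambda>x. h u (of_real x))"
      by (rule continuous_on_compose2[OF holomorphic_on_imp_continuous_on[OF hhol]])
         (use u in \<open>auto simp: half_plane_def intro!: continuous_intros\<close>)
    show "0 < Re (h u (of_real x))" if "1 \<le> x" for x using hpos[of u "of_real x"] u that by simp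
    show "norm (h u (of_real 1)) \<le> \<rho>" using u \<rho> by simp
    show "exp 1 * \<rho> \<le> norm (h u (of_real (max 1 X\<^sub>2)))" by (rule X2) simp
    show "7 / 10 * \<alpha> * norm z \<le> norm (g u (h u (of_real x)) / a + of_real \<alpha> * z)"
      if "1 \<le> x" "0 \<le> Re z" "\<rho> \<le> norm z" for x z
      using sep[OF that] gh[of u "of_real x"] u that by (simp add: p_def)
  qed (use \<alpha> \<rho> in auto)
qed

section \<open>Chains in the half-plane\<close>

text \<open>The integral bound in the definition of a Loewner chain is encoded by the absolutely
  continuous function \<open>I\<close>, the indefinite integral of the majorant.\<close>

locale half_plane_chain =
  fixes g :: "real \<Rightarrow> complex \<Rightarrow> complex"
  assumes hol: "0 \<le> t \<Longrightarrow> g t holomorphic_on half_plane"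
    and inj: "0 \<le> t \<Longrightarrow> inj_on (g t) half_plane"
    and sub: "0 \<le> s \<Longrightarrow> s \<le> t \<Longrightarrow> g s ` half_plane \<subseteq> g t ` half_plane"
    and ctrl: "compact K \<Longrightarrow> K \<subseteq> half_plane \<Longrightarrow> 0 < T \<Longrightarrow>
      \<exists>I::real \<Rightarrow> real. abs_continuous_on_interval 0 T I \<and>
        (\<forall>z\<in>K. \<forall>s t. 0 \<le> s \<and> s \<le> t \<and> t \<le> T \<longrightarrow> norm (g s z - g t z) \<le> I t - I s)"
begin

section \<open>Transition maps, dilations and transport of slopes\<close>

definition transition :: "real \<Rightarrow> real \<Rightarrow> complex \<Rightarrow> complex" where
  "transition s t = inv_into half_plane (g t) \<circ> g s"

lemma
  assumes "0 \<le> s" "s \<le> t" "0 < Re z"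
  shows transition_pos: "0 < Re (transition s t z)"
    and transition_eq: "g t (transition s t z) = g s z"
proof -
  have "g s z \<in> g t ` half_plane" using sub[OF assms(1,2)] assms(3) by (auto simp: half_plane_def)
  thus "0 < Re (transition s t z)" "g t (transition s t z) = g s z"
    using inv_into_into[of "g s z" "g t" half_plane] f_inv_into_f[of "g s z" "g t" half_plane]
    by (auto simp: transition_def half_plane_def)
qed

lemma transition_unique:
  assumes "0 \<le> s" "s \<le> t" "0 < Re z" "0 < Re w" "g t w = g s z"
  shows "transition s t z = w"
  using inj[of t] transition_pos[OF assms(1-3)] transition_eq[OF assms(1-3)] assms
  by (auto simp: inj_on_def half_plane_def)

lemma transition_self: "0 \<le> s \<Longrightarrow> 0 < Re z \<Longrightarrow> transition s s z = z"
  by (rule transition_unique) auto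

lemma transition_compose:
  assumes "0 \<le> s" "s \<le> u" "u \<le> t" "0 < Re z"
  shows "transition u t (transition s u z) = transition s t z"
  using assms transition_pos transition_eq by (intro transition_unique[symmetric]) auto

lemma transition_holomorphic:
  assumes "0 \<le> s" "s \<le> t"
  shows "transition s t holomorphic_on half_plane"
proof -
  have t: "0 \<le> t" using assms by simp
  obtain i where i: "i holomorphic_on (g t ` half_plane)" "\<And>z. z \<in> half_plane \<Longrightarrow> i (g t z) = z"
    using holomorphic_has_inverse[OF hol[OF t] open_half_plane inj[OF t]] by metis
  have "i \<circ> g s holomorphic_on half_plane"
    by (rule holomorphic_on_compose_gen[OF hol[OF assms(1)] i(1) sub[OF assms]])
  moreover have "(i \<circ> g s) z = transition s t z" if "z \<in> half_plane" for z
  proof -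
    have z: "0 < Re z" using that by (simp add: half_plane_def)
    show ?thesis
      using i(2)[of "transition s t z"] transition_eq[OF assms z] transition_pos[OF assms z]
      by (simp add: half_plane_def)
  qed
  ultimately show ?thesis by (rule holomorphic_transform)
qed

text \<open>\<open>SOME\<close> selects the constant of the Julia-Wolff theorem, unique because it
  is a slope. Zero is a legitimate value.\<close>

definition dilation :: "real \<Rightarrow> real \<Rightarrow> real" where
  "dilation s t = (SOME c. 0 \<le> c \<and> (\<forall>z. 0 < Re z \<longrightarrow> c * Re z \<le> Re (transition s t z)) \<and>
     angular_slope (transition s t) (of_real c))"

lemma
  assumes "0 \<le> s" "s \<le> t"
  shows dilation_nonneg: "0 \<le> dilation s t"
    and dilation_julia: "0 < Re z \<Longrightarrow> dilation s t * Re z \<le> Re (transition s t z)"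
    and dilation_slope: "angular_slope (transition s t) (of_real (dilation s t))"
proof -
  have "\<exists>c. 0 \<le> c \<and> (\<forall>z. 0 < Re z \<longrightarrow> c * Re z \<le> Re (transition s t z)) \<and>
     angular_slope (transition s t) (complex_of_real c)"
    using half_plane_julia_wolff[OF transition_holomorphic[OF assms] transition_pos[OF assms]] by metis
  from someI_ex[OF this]
  show "0 \<le> dilation s t" "angular_slope (transition s t) (of_real (dilation s t))"
    "0 < Re z \<Longrightarrow> dilation s t * Re z \<le> Re (transition s t z)"
    unfolding dilation_def by blast+
qed

lemma dilation_self: "0 \<le> s \<Longrightarrow> dilation s s = 1"
proof -
  assume s: "0 \<le> s"
  have "angular_slope (transition s s) 1 \<longleftrightarrow> angular_slope (\<lambda>z. z) 1"
    by (rule angular_slope_cong) (rule transition_self[OF s])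
  moreover have "angular_slope (\<lambda>z. z) 1"
    unfolding angular_slope_def
    by (rule tendsto_eventually, rule eventually_mono[OF eventually_sector_infinity_nonzero]) simp
  ultimately have "complex_of_real (dilation s s) = 1"
    using angular_slope_unique dilation_slope[OF s order.refl] by blast
  thus ?thesis by simp
qed

text \<open>The chain rule at infinity. With \<open>dilation s u = 0\<close> the inner map may carry
  infinity to another boundary point, at which the outer slope gives no information.\<close>

lemma dilation_compose:
  assumes "0 \<le> s" "s \<le> u" "u \<le> t" "0 < dilation s u"
  shows "dilation s t = dilation s u * dilation u t"
proof -
  have "angular_slope (\<lambda>z. transition u t (transition s u z)) (of_real (dilation u t) * of_real (dilation s u))"
    using assms by (intro angular_slope_compose dilation_slope) auto
  hence "angular_slope (transition s t) (of_real (dilation u t) * of_real (dilation s u))"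
    using angular_slope_cong[OF transition_compose[OF assms(1-3)]] by simp
  moreover have "0 \<le> s" "s \<le> t" using assms by auto
  note dilation_slope[OF this]
  ultimately have "complex_of_real (dilation s t) = of_real (dilation u t * dilation s u)"
    using angular_slope_unique by simp
  thus ?thesis by (simp only: of_real_eq_iff mult.commute)
qed

lemma slope_transition_cong:
  assumes "0 \<le> s" "s \<le> t"
  shows "angular_slope (\<lambda>z. g t (transition s t z)) a \<longleftrightarrow> angular_slope (g s) a"
  by (rule angular_slope_cong) (rule transition_eq[OF assms])

lemma slope_pullback:
  assumes "0 \<le> s" "s \<le> t" "0 < dilation s t" "angular_slope (g t) a"
  shows "angular_slope (g s) (a * of_real (dilation s t))"
  using angular_slope_compose[OF assms(4) dilation_slope[OF assms(1,2)] assms(3)]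
    slope_transition_cong[OF assms(1,2)] by simp

text \<open>Forward in time the later map is not a composition of earlier ones; instead the
  transition map is cancelled from \<open>g s\<close>.\<close>

lemma slope_pushforward:
  assumes "0 \<le> s" "s \<le> t" "0 < dilation s t" "angular_slope (g s) a"
  shows "angular_slope (g t) (a / of_real (dilation s t))"
  using angular_slope_compose_cancel[OF _ dilation_slope[OF assms(1,2)] assms(3) transition_holomorphic[OF assms(1,2)]]
    slope_transition_cong[OF assms(1,2)] assms(4) by blast

lemma dilation_pos_of_slopes:
  assumes "0 \<le> s" "s \<le> t" "angular_slope (g s) b" "angular_slope (g t) a" "a \<noteq> 0" "b / a \<notin> \<real>\<^sub>\<le>\<^sub>0"
  shows "0 < dilation s t"
proof -
  have t: "0 \<le> t" using assms by simp
  have "complex_of_real (dilation s t) = b / a"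
    by (rule angular_slope_quotient[OF _ assms(4) dilation_slope[OF assms(1,2)] hol[OF t] inj[OF t]
          transition_pos[OF assms(1,2)] assms(5,6)])
       (use slope_transition_cong[OF assms(1,2)] assms(3) in auto)
  hence "dilation s t \<noteq> 0" using assms(6) by auto
  thus ?thesis using dilation_nonneg[OF assms(1,2)] by simp
qed

section \<open>Regularity in time\<close>

lemma uniformly_close:
  assumes K: "compact K" "K \<subseteq> half_plane" and t: "0 \<le> t" and e: "0 < e"
  obtains d where "0 < d" "\<And>u z. 0 \<le> u \<Longrightarrow> \<bar>u - t\<bar> < d \<Longrightarrow> z \<in> K \<Longrightarrow> norm (g u z - g t z) < e"
proof -
  have "0 < t + 1" using t by simp
  from ctrl[OF K this] obtain I :: "real \<Rightarrow> real" where I: "abs_continuous_on_interval 0 (t + 1) I"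
    "\<And>z s u. z \<in> K \<Longrightarrow> 0 \<le> s \<Longrightarrow> s \<le> u \<Longrightarrow> u \<le> t + 1 \<Longrightarrow> norm (g s z - g u z) \<le> I u - I s"
    by blast
  obtain d where d: "0 < d" "\<And>u v. 0 \<le> u \<Longrightarrow> u \<le> v \<Longrightarrow> v \<le> t + 1 \<Longrightarrow> v - u < d \<Longrightarrow> norm (I v - I u) < e"
    by (rule abs_continuous_on_interval_imp_uniform[OF I(1) e]) blast
  show ?thesis
  proof (rule that[of "min d 1"])
    show "0 < min d 1" using d by simp
    fix u z assume u: "0 \<le> u" "\<bar>u - t\<bar> < min d 1" and z: "z \<in> K"
    show "norm (g u z - g t z) < e"
    proof (cases "u \<le> t")
      case True
      thus ?thesis using I(2)[OF z, of u t] d(2)[of u t] u t by auto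
    next
      case False
      thus ?thesis using I(2)[OF z, of t u] d(2)[of t u] u t by (auto simp: norm_minus_commute)
    qed
  qed
qed

text \<open>Hurwitz: \<open>g u\<close> takes the value \<open>g s z\<close> near \<open>transition s t z\<close> as \<open>u\<close> tends to \<open>t\<close>.\<close>
lemma transition_continuous:
  assumes st: "0 \<le> s" "s \<le> t" and z: "0 < Re z" and e: "0 < e"
  obtains d where "0 < d"
    "\<And>u. s \<le> u \<Longrightarrow> \<bar>u - t\<bar> < d \<Longrightarrow> norm (transition s u z - transition s t z) < e"
proof -
  define w where "w = transition s t z"
  have t: "0 \<le> t" using st by simp
  have w: "w \<in> half_plane" using transition_pos[OF st z] by (simp add: w_def half_plane_def)
  obtain r0 where r0: "0 < r0" "cball w r0 \<subseteq> half_plane"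
    using open_contains_cball open_half_plane w by blast
  define r where "r = min r0 e"
  have r: "0 < r" "r \<le> e" using r0 e by (auto simp: r_def)
  have cb: "cball w r \<subseteq> half_plane" using r0 by (auto simp: r_def)
  have cont: "continuous_on (cball w r) (g u)" if "0 \<le> u" for u
    by (rule continuous_on_subset[OF holomorphic_on_imp_continuous_on[OF hol[OF that]] cb])
  have "compact ((\<lambda>v. norm (g t v - g t w)) ` sphere w r)"
    by (intro compact_continuous_image continuous_intros continuous_on_subset[OF cont[OF t]]) auto
  moreover have "(\<lambda>v. norm (g t v - g t w)) ` sphere w r \<noteq> {}" using r by simp
  ultimately obtain m0 where m0: "m0 \<in> (\<lambda>v. norm (g t v - g t w)) ` sphere w r"
      "\<forall>x\<in>(\<lambda>v. norm (g t v - g t w)) ` sphere w r. m0 \<le> x"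
    using compact_attains_inf by blast
  then obtain v0 where v0: "v0 \<in> sphere w r" "m0 = norm (g t v0 - g t w)" by blast
  have v0_min: "m0 \<le> norm (g t v - g t w)" if "v \<in> sphere w r" for v
    using m0(2) that by blast
  define m where "m = norm (g t v0 - g t w)"
  have "v0 \<in> half_plane" "v0 \<noteq> w" using v0(1) cb r by auto
  hence m: "0 < m" using inj[OF t] w by (auto simp: m_def inj_on_def)
  \<comment> \<open>With thirds, F is below m / 3 at w and above 2 m / 3 on the circle, which forces
    a zero inside.\<close>
  have m3: "0 < m / 3" using m by simp
  obtain d where d: "0 < d" "\<And>u v. 0 \<le> u \<Longrightarrow> \<bar>u - t\<bar> < d \<Longrightarrow> v \<in> cball w r \<Longrightarrow> norm (g u v - g t v) < m / 3"
    by (rule uniformly_close[OF compact_cball cb t m3]) blast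
  show ?thesis
  proof (rule that[OF d(1)])
    fix u assume u: "s \<le> u" "\<bar>u - t\<bar> < d"
    have u0: "0 \<le> u" using u st by simp
    have gw: "g t w = g s z" using transition_eq[OF st z] by (simp add: w_def)
    define F where "F = (\<lambda>v. g u v - g s z)"
    obtain v where v: "v \<in> ball w r" "F v = 0"
    proof (rule holomorphic_contract_to_zero[of w r F])
      show "continuous_on (cball w r) F" unfolding F_def by (intro continuous_intros cont u0)
      show "F holomorphic_on ball w r" unfolding F_def
        by (intro holomorphic_intros holomorphic_on_subset[OF hol[OF u0]]) (use cb in auto)
      show "norm (F w) < norm (F v)" if "norm (w - v) = r" for v
      proof -
        have "norm (F w) < m / 3" using d(2)[OF u0 u(2), of w] r by (simp add: F_def gw[symmetric])
        moreover have "norm (g u v - g t v) < m / 3" using d(2)[OF u0 u(2), of v] that by (simp add: dist_norm)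
        moreover have "m \<le> norm (g t v - g t w)" using v0_min[of v] v0(2) that by (simp add: m_def dist_norm)
        moreover have "norm (g t v - g t w) \<le> norm (F v) + norm (g u v - g t v)"
          using norm_triangle_ineq4[of "F v" "g u v - g t v"] by (simp add: F_def gw)
        ultimately show ?thesis using m by linarith
      qed
    qed (use r in auto)
    have "transition s u z = v"
    proof (rule transition_unique[OF st(1) u(1) z])
      show "0 < Re v" using v(1) cb by (simp add: half_plane_def subset_iff)
      show "g u v = g s z" using v(2) by (simp add: F_def)
    qed
    thus "norm (transition s u z - transition s t z) < e"
      using v(1) r by (simp add: w_def[symmetric] dist_norm norm_minus_commute)
  qed
qed

lemma continuous_on_transition:
  assumes "0 \<le> s" "0 < Re z"
  shows "continuous_on {s..} (\<lambda>t. transition s t z)"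
  unfolding continuous_on_iff
proof (intro ballI allI impI)
  fix t e :: real assume te: "t \<in> {s..}" "0 < e"
  hence "s \<le> t" by simp
  then obtain d where "0 < d" "\<And>u. s \<le> u \<Longrightarrow> \<bar>u - t\<bar> < d \<Longrightarrow> norm (transition s u z - transition s t z) < e"
    using transition_continuous[OF assms(1) _ assms(2) te(2)] by metis
  thus "\<exists>d>0. \<forall>u\<in>{s..}. dist u t < d \<longrightarrow> dist (transition s u z) (transition s t z) < e"
    by (intro exI[of _ d]) (auto simp: dist_norm)
qed

text \<open>Univalence makes D = \<open>deriv (g t) w\<close> nonzero. Uniform closeness of values
  passes to derivatives by Cauchy's estimate, so for u near t the map \<open>g u\<close> is D v up
  to an error with Lipschitz constant \<open>norm D / 2\<close>. Uniformity in u is the point: it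
  allows comparing two points of a trajectory under one map \<open>g u\<close>.\<close>

lemma univalent_lower_bound:
  assumes t: "0 \<le> t" and w: "0 < Re w"
  obtains C \<rho> d where "0 < C" "0 < \<rho>" "0 < d"
    "\<And>u v v'. 0 \<le> u \<Longrightarrow> \<bar>u - t\<bar> < d \<Longrightarrow> v \<in> ball w \<rho> \<Longrightarrow> v' \<in> ball w \<rho> \<Longrightarrow> norm (v - v') \<le> C * norm (g u v - g u v')"
proof -
  have wH: "w \<in> half_plane" using w by (simp add: half_plane_def)
  define D where "D = deriv (g t) w"
  have D: "D \<noteq> 0"
    unfolding D_def by (rule holomorphic_injective_imp_regular[OF hol[OF t] open_half_plane inj[OF t] wH])
  have "continuous_on half_plane (deriv (g t))"
    by (intro holomorphic_on_imp_continuous_on holomorphic_deriv hol t open_half_plane)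
  hence "isCont (deriv (g t)) w"
    using wH open_half_plane continuous_on_eq_continuous_at by blast
  moreover have D4: "0 < norm D / 4" using D by simp
  ultimately obtain r1 where r1: "0 < r1" "\<And>v. dist v w < r1 \<Longrightarrow> dist (deriv (g t) v) D < norm D / 4"
    unfolding continuous_at_eps_delta D_def by blast
  obtain r2 where r2: "0 < r2" "ball w r2 \<subseteq> half_plane"
    using open_half_plane wH openE by blast
  \<comment> \<open>Values are controlled on radius 2 \<rho>, so that Cauchy circles of radius
    \<rho> fit around every point of \<open>ball w \<rho>\<close>; a value error
    \<open>norm D * \<rho> / 4\<close> becomes \<open>norm D / 4\<close> for derivatives.\<close>
  define \<rho> where "\<rho> = min r1 r2 / 3"
  have \<rho>: "0 < \<rho>" "2 * \<rho> < r1" "2 * \<rho> < r2" using r1 r2 by (auto simp: \<rho>_def)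
  have cb: "cball w (2 * \<rho>) \<subseteq> half_plane" using r2(2) \<rho> by (auto simp: subset_iff)
  have e: "0 < norm D * \<rho> / 4" using D \<rho> by simp
  obtain d where d: "0 < d" "\<And>u v. 0 \<le> u \<Longrightarrow> \<bar>u - t\<bar> < d \<Longrightarrow> v \<in> cball w (2 * \<rho>) \<Longrightarrow> norm (g u v - g t v) < norm D * \<rho> / 4"
    by (rule uniformly_close[OF compact_cball cb t e]) blast
  show ?thesis
  proof (rule that[of "2 / norm D" \<rho> d])
    show "0 < 2 / norm D" using D by simp
    fix u v v' assume u: "0 \<le> u" "\<bar>u - t\<bar> < d" and v: "v \<in> ball w \<rho>" "v' \<in> ball w \<rho>"
    define F where "F = (\<lambda>x. g u x - D * x)"
    have "norm (F v - F v') \<le> norm D / 2 * norm (v - v')"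
    proof (rule field_differentiable_bound[OF convex_ball _ _ v])
      fix x assume x: "x \<in> ball w \<rho>"
      have xH: "x \<in> half_plane" using x cb \<rho> by (auto simp: subset_iff)
      have cbx: "cball x \<rho> \<subseteq> cball w (2 * \<rho>)"
      proof
        fix y assume "y \<in> cball x \<rho>"
        thus "y \<in> cball w (2 * \<rho>)" using x dist_triangle[of w y x] by auto
      qed
      have du: "(g u has_field_derivative deriv (g u) x) (at x)" if "0 \<le> u" for u
        by (rule holomorphic_derivI[OF hol[OF that] open_half_plane xH])
      show "(F has_field_derivative (deriv (g u) x - D)) (at x within ball w \<rho>)"
        unfolding F_def by (rule has_field_derivative_at_within) (auto intro!: derivative_eq_intros du u)
      define k where "k = (\<lambda>x. g u x - g t x)"
      have hk: "k holomorphic_on cball x \<rho>"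
        unfolding k_def by (intro holomorphic_intros holomorphic_on_subset[OF hol] u t) (use cbx cb in auto)
      have "norm ((deriv ^^ 1) k x) \<le> fact 1 * (norm D * \<rho> / 4) / \<rho> ^ 1"
      proof (rule Cauchy_inequality)
        show "k holomorphic_on ball x \<rho>" by (rule holomorphic_on_subset[OF hk]) auto
        show "continuous_on (cball x \<rho>) k" by (rule holomorphic_on_imp_continuous_on[OF hk])
        show "norm (k y) \<le> norm D * \<rho> / 4" if "norm (x - y) = \<rho>" for y
        proof -
          have "y \<in> cball x \<rho>" using that by (simp add: dist_norm)
          thus ?thesis using d(2)[OF u, of y] cbx by (force simp: k_def)
        qed
      qed (rule \<rho>)
      moreover have "deriv k x = deriv (g u) x - deriv (g t) x"
        unfolding k_def by (rule DERIV_imp_deriv[OF DERIV_diff[OF du[OF u(1)] du[OF t]]])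
      ultimately have "norm (deriv (g u) x - deriv (g t) x) \<le> norm D / 4" using \<rho> by simp
      moreover have "dist x w < r1" using x \<rho> by (simp add: dist_commute)
      hence "norm (deriv (g t) x - D) < norm D / 4" using r1(2) by (simp add: dist_norm)
      ultimately show "norm (deriv (g u) x - D) \<le> norm D / 2"
        using norm_triangle_ineq[of "deriv (g u) x - deriv (g t) x" "deriv (g t) x - D"] by simp
    qed
    moreover have "norm (D * (v - v')) \<le> norm (g u v - g u v') + norm (F v - F v')"
      using norm_triangle_ineq4[of "g u v - g u v'" "F v - F v'"] by (simp add: F_def algebra_simps)
    ultimately have "norm D * norm (v - v') / 2 \<le> norm (g u v - g u v')" by (simp add: norm_mult)
    thus "norm (v - v') \<le> 2 / norm D * norm (g u v - g u v')" using D by (simp add: field_simps)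
  qed (use \<rho> d in auto)
qed

text \<open>At their respective points of the trajectory \<open>g u\<close> and \<open>g v\<close>
  share the value \<open>g 0 z\<close>. So the increment of the trajectory, measured through
  \<open>g u\<close>, equals the change of g from time u to time v at a single point, which
  \<open>I\<close> controls.\<close>

lemma abs_continuous_transition:
  assumes T: "0 < T" and z: "0 < Re z"
  shows "abs_continuous_on_interval 0 T (\<lambda>t. transition 0 t z)"
proof -
  define K where "K = (\<lambda>t. transition 0 t z) ` {0..T}"
  have cK: "compact K" unfolding K_def
    by (intro compact_continuous_image continuous_on_subset[OF continuous_on_transition[OF order.refl z]]) auto
  have KH: "K \<subseteq> half_plane" using transition_pos[OF order.refl _ z] by (auto simp: K_def half_plane_def)
  from ctrl[OF cK KH T] obtain I :: "real \<Rightarrow> real" where I: "abs_continuous_on_interval 0 T I"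
    "\<And>w s u. w \<in> K \<Longrightarrow> 0 \<le> s \<Longrightarrow> s \<le> u \<Longrightarrow> u \<le> T \<Longrightarrow> norm (g s w - g u w) \<le> I u - I s"
    by blast
  \<comment> \<open>Bisection joins the constants found near single times into one for
    \<open>{0..T}\<close>. The clauses \<open>0 \<le> u\<close> and \<open>v \<le> T\<close> are
    there because the local intervals of \<open>Bolzano\<close> may reach beyond the ends.\<close>
  define P where "P = (\<lambda>a b. \<exists>C. \<forall>u v. 0 \<le> u \<and> u \<le> v \<and> v \<le> T \<and> a \<le> u \<and> v \<le> b \<longrightarrow>
      norm (transition 0 v z - transition 0 u z) \<le> C * (I v - I u))"
  have I_mono: "0 \<le> I v - I u" if "0 \<le> u" "u \<le> v" "v \<le> T" for u v
  proof -
    have "transition 0 u z \<in> K" using that by (auto simp: K_def)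
    from order_trans[OF norm_ge_zero I(2)[OF this that]] show ?thesis .
  qed
  have "0 \<le> T" using T by simp
  hence "P 0 T"
  proof (induction rule: Bolzano)
    case (trans a b c)
    then obtain C1 C2 where C:
      "\<And>u v. 0 \<le> u \<Longrightarrow> u \<le> v \<Longrightarrow> v \<le> T \<Longrightarrow> a \<le> u \<Longrightarrow> v \<le> b \<Longrightarrow> norm (transition 0 v z - transition 0 u z) \<le> C1 * (I v - I u)"
      "\<And>u v. 0 \<le> u \<Longrightarrow> u \<le> v \<Longrightarrow> v \<le> T \<Longrightarrow> b \<le> u \<Longrightarrow> v \<le> c \<Longrightarrow> norm (transition 0 v z - transition 0 u z) \<le> C2 * (I v - I u)"
      unfolding P_def by metis
    define C where "C = max C1 C2"
    have up: "C1 * (I v - I u) \<le> C * (I v - I u)" "C2 * (I v - I u) \<le> C * (I v - I u)"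
      if "0 \<le> u" "u \<le> v" "v \<le> T" for u v
      using I_mono[OF that] by (auto simp: C_def intro: mult_right_mono)
    show ?case unfolding P_def
    proof (intro exI[of _ C] allI impI)
      fix u v assume uv: "0 \<le> u \<and> u \<le> v \<and> v \<le> T \<and> a \<le> u \<and> v \<le> c"
      consider "v \<le> b" | "b \<le> u" | "u \<le> b" "b \<le> v" by linarith
      thus "norm (transition 0 v z - transition 0 u z) \<le> C * (I v - I u)"
      proof cases
        case 1
        thus ?thesis using C(1)[of u v] up(1)[of u v] uv by linarith
      next
        case 2
        thus ?thesis using C(2)[of u v] up(2)[of u v] uv by linarith
      next
        case 3
        have "norm (transition 0 v z - transition 0 u z)
            \<le> norm (transition 0 v z - transition 0 b z) + norm (transition 0 b z - transition 0 u z)"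
          using norm_triangle_ineq[of "transition 0 v z - transition 0 b z" "transition 0 b z - transition 0 u z"] by simp
        also have "\<dots> \<le> C * (I v - I b) + C * (I b - I u)"
        proof (rule add_mono)
          show "norm (transition 0 v z - transition 0 b z) \<le> C * (I v - I b)"
            using C(2)[of b v] up(2)[of b v] uv 3 by linarith
          show "norm (transition 0 b z - transition 0 u z) \<le> C * (I b - I u)"
            using C(1)[of u b] up(1)[of u b] uv 3 by linarith
        qed
        finally show ?thesis by (simp add: algebra_simps)
      qed
    qed
  next
    case (local x)
    hence x0: "0 \<le> x" by simp
    define w where "w = transition 0 x z"
    have w: "0 < Re w" using transition_pos[OF order.refl x0 z] by (simp add: w_def)
    obtain C \<rho> d where C: "0 < C" "0 < \<rho>" "0 < d"
      "\<And>u v v'. 0 \<le> u \<Longrightarrow> \<bar>u - x\<bar> < d \<Longrightarrow> v \<in> ball w \<rho> \<Longrightarrow> v' \<in> ball w \<rho> \<Longrightarrow> norm (v - v') \<le> C * norm (g u v - g u v')"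
      by (rule univalent_lower_bound[OF x0 w]) blast
    obtain d' where d': "0 < d'" "\<And>u. 0 \<le> u \<Longrightarrow> \<bar>u - x\<bar> < d' \<Longrightarrow> norm (transition 0 u z - transition 0 x z) < \<rho>"
      by (rule transition_continuous[OF order.refl x0 z C(2)]) blast
    show ?case
    proof (intro exI[of _ "min d d'"] conjI allI impI)
      show "0 < min d d'" using C d' by simp
      fix a b assume ab: "a \<le> x \<and> x \<le> b \<and> b - a < min d d'"
      show "P a b" unfolding P_def
      proof (intro exI[of _ C] allI impI)
        fix u v assume uv: "0 \<le> u \<and> u \<le> v \<and> v \<le> T \<and> a \<le> u \<and> v \<le> b"
        define hu hv where "hu = transition 0 u z" and "hv = transition 0 v z"
        have v0: "0 \<le> v" "\<bar>u - x\<bar> < d" "\<bar>u - x\<bar> < d'" "\<bar>v - x\<bar> < d'" using uv ab by auto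
        have "norm (hv - hu) \<le> C * norm (g u hv - g u hu)"
          using d'(2)[of u] d'(2)[of v] uv v0
          by (intro C(4)) (auto simp: hu_def hv_def w_def dist_norm norm_minus_commute)
        also have "g u hu = g v hv"
          using transition_eq[OF order.refl _ z, of u] transition_eq[OF order.refl _ z, of v] uv v0
          by (simp add: hu_def hv_def)
        also have "norm (g u hv - g v hv) \<le> I v - I u"
          using uv v0 by (intro I(2)) (auto simp: K_def hv_def)
        finally show "norm (transition 0 v z - transition 0 u z) \<le> C * (I v - I u)"
          using C(1) by (simp add: hu_def hv_def)
      qed
    qed
  qed
  then obtain C where C: "\<And>u v. 0 \<le> u \<Longrightarrow> u \<le> v \<Longrightarrow> v \<le> T \<Longrightarrow> norm (transition 0 v z - transition 0 u z) \<le> C * (I v - I u)"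
    unfolding P_def by blast
  show ?thesis
    by (rule abs_continuous_on_interval_dominated[OF I(1), of _ C]) (use C I_mono in fastforce)
qed

text \<open>
  By Julia's inequality \<open>Re (transition 0 t x) / dilation 0 t\<close> is nondecreasing in \<open>t\<close>, and its total
  increment over \<open>[0, T]\<close> is \<open>o(x)\<close>; so up to small variation \<open>1 / dilation 0 t\<close> is the absolutely
  continuous function \<open>x / Re (transition 0 t x)\<close>.
\<close>
lemma abs_continuous_inverse_dilation:
  assumes T: "0 < T" and pos: "\<And>s t. 0 \<le> s \<Longrightarrow> s \<le> t \<Longrightarrow> 0 < dilation s t"
  shows "abs_continuous_on_interval 0 T (\<lambda>t. 1 / dilation 0 t)"
proof -
  define X where "X = (\<lambda>t x. Re (transition 0 t (complex_of_real x)))"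
  define c where "c = dilation 0"
  \<comment> \<open>For fixed x > 0 this does not decrease in t, starts at 1 and ends at a value
    that tends to 1 as x grows; times \<open>x / X t x\<close> it is exactly
    \<open>1 / c t\<close>.\<close>
  define y where "y = (\<lambda>x t. X t x / c t / x)"
  have c: "0 < c t" if "0 \<le> t" for t using pos[of 0 t] that by (simp add: c_def)
  have Xpos: "0 < X t x" if "0 \<le> t" "0 < x" for t x
    using transition_pos[OF order.refl that(1), of "of_real x"] that(2) by (simp add: X_def)
  have y0: "y x 0 = 1" if "0 < x" for x
    using transition_self[of 0 "of_real x"] dilation_self[of 0] that by (simp add: y_def X_def c_def)
  have ymono: "y x s \<le> y x t" if "0 \<le> s" "s \<le> t" "0 < x" for s t x
  proof -
    have t: "0 \<le> t" using that by simp
    have ct: "c t = c s * dilation s t" using dilation_compose[OF order.refl that(1,2)] pos that by (simp add: c_def)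
    have "dilation s t * X s x \<le> X t x"
      using dilation_julia[OF that(1,2), of "transition 0 s (of_real x)"]
        transition_compose[OF order.refl that(1,2), of "of_real x"] transition_pos[OF order.refl that(1), of "of_real x"] that
      by (simp add: X_def)
    hence "X s x \<le> X t x / dilation s t" using pos[OF that(1,2)] by (simp add: field_simps)
    hence "X s x / c s \<le> X t x / dilation s t / c s" using c[OF that(1)] by (intro divide_right_mono) auto
    also have "\<dots> = X t x / c t" by (simp add: ct)
    finally have "X s x / c s / x \<le> X t x / c t / x" using that by (intro divide_right_mono) auto
    thus ?thesis by (simp add: y_def)
  qed
  have inv_c: "1 / c t = y x t * (x / X t x)" if "0 \<le> t" "0 < x" for t x
    using Xpos[OF that] c[OF that(1)] that by (simp add: y_def)
  have acX: "abs_continuous_on_interval 0 T (\<lambda>t. x / X t x) \<and> (\<exists>m>0. \<forall>t\<in>{0..T}. m \<le> X t x)" if x: "0 < x" for x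
  proof -
    have rx: "0 < Re (complex_of_real x)" using x by simp
    have ac: "abs_continuous_on_interval 0 T (\<lambda>t. transition 0 t (of_real x))"
      by (rule abs_continuous_transition[OF T rx])
    have "continuous_on {0..T} (\<lambda>t. X t x)" unfolding X_def
      by (intro continuous_intros continuous_on_subset[OF continuous_on_transition[OF order.refl rx]]) auto
    hence "\<exists>t0\<in>{0..T}. \<forall>t\<in>{0..T}. X t0 x \<le> X t x"
      using T by (intro continuous_attains_inf) auto
    then obtain t0 where t0: "t0 \<in> {0..T}" "\<And>t. t \<in> {0..T} \<Longrightarrow> X t0 x \<le> X t x" by blast
    define m where "m = X t0 x"
    have m: "0 < m" "\<And>t. t \<in> {0..T} \<Longrightarrow> m \<le> X t x" using t0 x by (auto simp: m_def intro: Xpos)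
    have "abs_continuous_on_interval 0 T (\<lambda>t. x / X t x)"
    proof (rule abs_continuous_on_interval_dominated[OF ac, of _ "x / m\<^sup>2"])
      fix u v assume uv: "0 \<le> u" "u \<le> v" "v \<le> T"
      have mm: "m \<le> X u x" "m \<le> X v x" using m(2) uv by auto
      hence p: "0 < X u x" "0 < X v x" using m(1) by linarith+
      have "x / X v x - x / X u x = x * (X u x - X v x) / (X u x * X v x)" using p by (simp add: field_simps)
      hence "norm (x / X v x - x / X u x) = x * \<bar>X u x - X v x\<bar> / (X u x * X v x)"
        using p x by (simp add: abs_mult abs_divide)
      also have "\<dots> \<le> x * \<bar>X u x - X v x\<bar> / (m * m)"
        using mm m(1) x by (intro divide_left_mono mult_mono mult_pos_pos) auto
      also have "\<dots> \<le> x * norm (transition 0 v (of_real x) - transition 0 u (of_real x)) / (m * m)"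
        using abs_Re_le_cmod[of "transition 0 v (of_real x) - transition 0 u (of_real x)"] x m(1)
        by (intro divide_right_mono mult_left_mono) (auto simp: X_def abs_minus_commute)
      finally show "norm (x / X v x - x / X u x) \<le> x / m\<^sup>2 * norm (transition 0 v (of_real x) - transition 0 u (of_real x))"
        by (simp add: power2_eq_square)
    qed
    thus ?thesis using m by blast
  qed
  obtain m where m: "0 < m" "\<And>t. t \<in> {0..T} \<Longrightarrow> m \<le> X t 1" using acX[of 1] by auto
  define M where "M = y 1 T / m"
  have M: "1 / c t \<le> M" if "t \<in> {0..T}" for t
  proof -
    have "1 / c t = y 1 t / X t 1" using inv_c[of t 1] that by simp
    also have "\<dots> \<le> y 1 T / m"
      using ymono[of t T 1] m that y0[of 1] ymono[of 0 t 1] by (intro frac_le) auto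
    finally show ?thesis by (simp add: M_def)
  qed
  have M0: "0 < M" using M[of 0] c[of 0] T by (smt (verit) atLeastAtMost_iff zero_less_divide_1_iff)
  have "((\<lambda>x. X T x / x) \<longlongrightarrow> c T) at_top"
  proof -
    have "0 \<le> T" using T by simp
    from tendsto_Re[OF angular_slope_along_ray[OF dilation_slope[OF order.refl this]]]
    show ?thesis by (simp add: X_def c_def Re_divide_of_real)
  qed
  hence ylim: "((\<lambda>x. y x T) \<longlongrightarrow> 1) at_top"
    using tendsto_divide[OF _ tendsto_const[of "c T"], of "\<lambda>x. X T x / x" "c T" at_top] c[of T] T
    by (simp add: y_def field_simps)
  show ?thesis unfolding c_def[symmetric]
  proof (rule abs_continuous_on_intervalI)
    fix e :: real assume e: "0 < e"
    \<comment> \<open>The variation of y contributes at most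
      \<open>M * \<epsilon> \<le> e / 2\<close>, the absolutely continuous factor less than twice e
      / 4; the bound 1 on \<epsilon> ensures that y stays at most 2.\<close>
    define \<epsilon> where "\<epsilon> = min 1 (e / (2 * M))"
    have \<epsilon>: "0 < \<epsilon>" "\<epsilon> \<le> 1" "M * \<epsilon> \<le> e / 2" using e M0 by (auto simp: \<epsilon>_def min_def field_simps)
    have "\<forall>\<^sub>F x in at_top. y x T < 1 + \<epsilon> \<and> 0 < x"
      using order_tendstoD(2)[OF ylim, of "1 + \<epsilon>"] \<epsilon> by (intro eventually_conj eventually_gt_at_top) auto
    then obtain x where x: "y x T < 1 + \<epsilon>" "0 < x"
      using eventually_happens'[OF trivial_limit_at_top_linorder] by blast
    have e4: "0 < e / 4" using e by simp
    from acX[OF x(2)] have ac: "abs_continuous_on_interval 0 T (\<lambda>t. x / X t x)" by blast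
    obtain d where d: "0 < d" "\<And>(n::nat) u v. (\<And>i. i < n \<Longrightarrow> 0 \<le> u i \<and> u i \<le> v i \<and> v i \<le> T) \<Longrightarrow>
      disjoint_family_on (\<lambda>i. {u i<..<v i}) {..<n} \<Longrightarrow> (\<Sum>i<n. v i - u i) < d \<Longrightarrow>
      (\<Sum>i<n. norm (x / X (v i) x - x / X (u i) x)) < e / 4"
      by (rule abs_continuous_on_intervalD[OF ac e4]) blast
    show "\<exists>d>0. \<forall>(n::nat) u v. (\<forall>i<n. 0 \<le> u i \<and> u i \<le> v i \<and> v i \<le> T) \<longrightarrow>
        disjoint_family_on (\<lambda>i. {u i<..<v i}) {..<n} \<longrightarrow> (\<Sum>i<n. v i - u i) < d \<longrightarrow>
        (\<Sum>i<n. norm (1 / c (v i) - 1 / c (u i))) < e"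
    proof (intro exI[of _ d] conjI allI impI d(1))
      fix n :: nat and u v :: "nat \<Rightarrow> real"
      assume uv: "\<forall>i<n. 0 \<le> u i \<and> u i \<le> v i \<and> v i \<le> T"
        and disj: "disjoint_family_on (\<lambda>i. {u i<..<v i}) {..<n}" and sm: "(\<Sum>i<n. v i - u i) < d"
      have "(\<Sum>i<n. norm (1 / c (v i) - 1 / c (u i)))
          \<le> (\<Sum>i<n. M * (y x (v i) - y x (u i)) + 2 * norm (x / X (v i) x - x / X (u i) x))"
      proof (rule sum_mono)
        fix i assume "i \<in> {..<n}"
        hence i: "0 \<le> u i" "u i \<le> v i" "v i \<le> T" using uv by auto
        have v0: "0 \<le> v i" using i by simp
        define A B where "A = x / X (u i) x" and "B = x / X (v i) x"
        have yu: "1 \<le> y x (u i)" "y x (u i) \<le> 2" "y x (u i) \<le> y x (v i)" "1 \<le> y x (v i)"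
          using ymono[of 0 "u i" x] ymono[of "u i" T x] ymono[of "u i" "v i" x] ymono[of 0 "v i" x] y0[OF x(2)] x i \<epsilon> by auto
        have B: "0 < B" using Xpos[OF v0 x(2)] x(2) by (simp add: B_def)
        have BM: "B \<le> M"
        proof -
          have "1 * B \<le> y x (v i) * B" using yu B by (intro mult_right_mono) auto
          also have "\<dots> = 1 / c (v i)" using inv_c[OF v0 x(2)] by (simp add: B_def)
          also have "\<dots> \<le> M" using M[of "v i"] i v0 by simp
          finally show ?thesis by simp
        qed
        have "1 / c (v i) - 1 / c (u i) = B * (y x (v i) - y x (u i)) + y x (u i) * (B - A)"
          using inv_c[OF v0 x(2)] inv_c[OF i(1) x(2)] by (simp add: A_def B_def algebra_simps)
        hence "norm (1 / c (v i) - 1 / c (u i)) \<le> norm (B * (y x (v i) - y x (u i))) + norm (y x (u i) * (B - A))"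
          by (metis norm_triangle_ineq)
        also have "\<dots> = B * (y x (v i) - y x (u i)) + y x (u i) * norm (B - A)"
          using yu B by (simp add: abs_mult)
        also have "\<dots> \<le> M * (y x (v i) - y x (u i)) + 2 * norm (B - A)"
          using yu B BM by (intro add_mono mult_right_mono) auto
        finally show "norm (1 / c (v i) - 1 / c (u i))
            \<le> M * (y x (v i) - y x (u i)) + 2 * norm (x / X (v i) x - x / X (u i) x)"
          by (simp add: A_def B_def)
      qed
      also have "\<dots> = M * (\<Sum>i<n. y x (v i) - y x (u i)) + 2 * (\<Sum>i<n. norm (x / X (v i) x - x / X (u i) x))"
        by (simp add: sum.distrib sum_distrib_left)
      also have "(\<Sum>i<n. y x (v i) - y x (u i)) \<le> y x T - y x 0"
      proof (rule sum_increments_mono_le[OF _ _ _ _ disj])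
        show "mono_on {0..T} (y x)" using ymono x by (intro mono_onI) auto
      qed (use uv T in auto)
      also have "y x T - y x 0 \<le> \<epsilon>" using x y0[OF x(2)] by simp
      also have "(\<Sum>i<n. norm (x / X (v i) x - x / X (u i) x)) < e / 4"
        by (rule d(2)) (use uv disj sm in auto)
      finally show "(\<Sum>i<n. norm (1 / c (v i) - 1 / c (u i))) < e" using \<epsilon> M0 by simp
    qed
  qed
qed

text \<open>Let \<tau> be the infimum of the times where positivity fails. If it holds at \<tau>,
  then \<open>right\<close> and the chain rule carry it beyond \<tau>, a contradiction. If it fails
  at \<tau>, the slopes at s and \<tau> have a negative ratio although all earlier dilations are
  positive, which \<open>no_opposite_left_limit\<close> excludes.\<close>

lemma dilation_pos_of_right_condition:
  assumes slope: "\<And>t. 0 \<le> t \<Longrightarrow> angular_slope (g t) (a t)" and a0: "\<And>t. 0 \<le> t \<Longrightarrow> a t \<noteq> 0"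
    and right: "\<And>s. 0 \<le> s \<Longrightarrow> \<forall>\<^sub>F t in at_right s. a s / a t \<notin> \<real>\<^sub>\<le>\<^sub>0"
    and st: "0 \<le> s" "s \<le> t"
  shows "0 < dilation s t"
proof (rule ccontr)
  define B where "B = {t. s \<le> t \<and> \<not> 0 < dilation s t}"
  assume "\<not> 0 < dilation s t"
  hence ne: "B \<noteq> {}" using st by (auto simp: B_def)
  have bb: "bdd_below B" by (rule bdd_belowI[of _ s]) (auto simp: B_def)
  define \<tau> where "\<tau> = Inf B"
  have s\<tau>: "s \<le> \<tau>" unfolding \<tau>_def by (rule cInf_greatest[OF ne]) (auto simp: B_def)
  have \<tau>0: "0 \<le> \<tau>" using s\<tau> st by simp
  have below: "0 < dilation s u" if "s \<le> u" "u < \<tau>" for u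
    using that cInf_lower[OF _ bb, of u] by (force simp: B_def \<tau>_def)
  show False
  proof (cases "\<tau> \<in> B")
    case False
    hence P: "0 < dilation s \<tau>" using s\<tau> by (simp add: B_def)
    obtain b where b: "\<tau> < b" "\<And>u. \<tau> < u \<Longrightarrow> u < b \<Longrightarrow> a \<tau> / a u \<notin> \<real>\<^sub>\<le>\<^sub>0"
      using right[OF \<tau>0] unfolding eventually_at_right_field by blast
    have "u \<notin> B" if u: "u < b" for u
    proof (cases "u \<le> \<tau>")
      case True
      thus ?thesis using P below[of u] by (cases "u = \<tau>") (auto simp: B_def)
    next
      case gt: False
      hence u': "\<tau> < u" "0 \<le> u" "\<tau> \<le> u" using \<tau>0 by auto
      have "0 < dilation \<tau> u"
        using slope[OF \<tau>0] slope[OF u'(2)] a0[OF u'(2)] b(2)[OF u'(1) u]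
        by (intro dilation_pos_of_slopes[OF \<tau>0 u'(3)]) auto
      hence "0 < dilation s u" using dilation_compose[OF st(1) s\<tau> u'(3) P] P by simp
      thus ?thesis by (simp add: B_def)
    qed
    hence "b \<le> Inf B" by (intro cInf_greatest[OF ne]) (meson not_le)
    thus False using b(1) by (simp add: \<tau>_def)
  next
    case True
    have "s \<noteq> \<tau>" using True dilation_self[OF st(1)] by (auto simp: B_def)
    hence lt: "s < \<tau>" using s\<tau> by simp
    have "a s / a \<tau> \<in> \<real>\<^sub>\<le>\<^sub>0"
      using dilation_pos_of_slopes[OF st(1) s\<tau> slope[OF st(1)] slope[OF \<tau>0] a0[OF \<tau>0]] True by (auto simp: B_def)
    then obtain x where x: "a s / a \<tau> = of_real x" "x \<le> 0" by (auto elim: nonpos_Reals_cases)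
    have "x \<noteq> 0" using x a0[OF st(1)] a0[OF \<tau>0] by auto
    hence x0: "x < 0" using x by simp
    \<comment> \<open>The reciprocal appears because \<open>no_opposite_left_limit\<close> divides
      the limiting slope by the initial one.\<close>
    define \<alpha> where "\<alpha> = - 1 / x"
    have \<alpha>: "0 < \<alpha>" using x0 by (simp add: \<alpha>_def divide_neg_neg)
    have "a \<tau> / a s = inverse (of_real x)" using x(1) by (metis inverse_divide)
    hence \<alpha>': "a \<tau> / a s = - complex_of_real \<alpha>" by (simp add: \<alpha>_def divide_inverse)
    have near: "\<forall>\<^sub>F u in at_left \<tau>. Q u" if "0 < d" "\<And>u. s \<le> u \<Longrightarrow> \<bar>u - \<tau>\<bar> < d \<Longrightarrow> Q u" for d Q
      unfolding eventually_at_left_field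
      by (rule exI[of _ "max s (\<tau> - d)"]) (use that lt in auto)
    show False
    proof (rule no_opposite_left_limit[OF lt, of g "transition s" "a s" "a \<tau>" \<alpha>])
      show "\<exists>c>0. angular_slope (transition s u) (complex_of_real c)" if "s \<le> u" "u < \<tau>" for u
        using below[OF that] dilation_slope[OF st(1) that(1)] by blast
      show "\<forall>\<^sub>F u in at_left \<tau>. \<forall>z\<in>K. norm (g u z - g \<tau> z) < e" if K: "compact K" "K \<subseteq> half_plane" "0 < e" for K e
      proof -
        obtain d where "0 < d" "\<And>u z. 0 \<le> u \<Longrightarrow> \<bar>u - \<tau>\<bar> < d \<Longrightarrow> z \<in> K \<Longrightarrow> norm (g u z - g \<tau> z) < e"
          by (rule uniformly_close[OF K(1,2) \<tau>0 K(3)]) blast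
        thus ?thesis using st(1) by (intro near[of d]) auto
      qed
      obtain d where d: "0 < d" "\<And>u. s \<le> u \<Longrightarrow> \<bar>u - \<tau>\<bar> < d \<Longrightarrow> norm (transition s u 1 - transition s \<tau> 1) < 1"
        using transition_continuous[OF st(1) s\<tau>, of 1 1] by auto
      show "\<forall>\<^sub>F u in at_left \<tau>. norm (transition s u 1) \<le> norm (transition s \<tau> 1) + 1"
      proof (rule near[OF d(1)])
        fix u assume "s \<le> u" "\<bar>u - \<tau>\<bar> < d"
        from d(2)[OF this] show "norm (transition s u 1) \<le> norm (transition s \<tau> 1) + 1"
          using norm_triangle_sub[of "transition s u 1" "transition s \<tau> 1"] by simp
      qed
    qed (use st \<tau>0 \<alpha> \<alpha>' in \<open>auto intro!: hol inj slope a0 transition_holomorphic transition_pos transition_eq\<close>)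
  qed
qed

end

section \<open>Transfer to the disc\<close>

text \<open>The Cayley transform normalised by sending 1 to 0 and infinity to \<sigma>.\<close>

definition disc_of_half_plane :: "complex \<Rightarrow> complex \<Rightarrow> complex" where
  "disc_of_half_plane \<sigma> w = \<sigma> * (w - 1) / (w + 1)"

definition half_plane_of_disc :: "complex \<Rightarrow> complex \<Rightarrow> complex" where
  "half_plane_of_disc \<sigma> z = (\<sigma> + z) / (\<sigma> - z)"

lemma plus_1_neq_0: "0 < Re w \<Longrightarrow> w + 1 \<noteq> 0"
  by (auto simp: complex_eq_iff)

lemma disc_of_half_plane_minus:
  "0 < Re w \<Longrightarrow> disc_of_half_plane \<sigma> w - \<sigma> = - 2 * \<sigma> / (w + 1)"
  using plus_1_neq_0[of w] by (simp add: disc_of_half_plane_def field_simps)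

lemma one_minus_norm_disc_of_half_plane:
  assumes "norm \<sigma> = 1" "0 < Re w"
  shows "1 - (norm (disc_of_half_plane \<sigma> w))\<^sup>2 = 4 * Re w / (norm (w + 1))\<^sup>2"
proof -
  have n: "norm (w + 1) \<noteq> 0" using plus_1_neq_0[OF assms(2)] by simp
  have "(norm (disc_of_half_plane \<sigma> w))\<^sup>2 = (norm (w - 1))\<^sup>2 / (norm (w + 1))\<^sup>2"
    using assms by (simp add: disc_of_half_plane_def norm_mult norm_divide power_divide)
  moreover have "(norm (w + 1))\<^sup>2 - (norm (w - 1))\<^sup>2 = 4 * Re w"
    unfolding cmod_power2 by (simp add: power2_eq_square algebra_simps)
  moreover have "1 - (norm (w - 1))\<^sup>2 / (norm (w + 1))\<^sup>2 = ((norm (w + 1))\<^sup>2 - (norm (w - 1))\<^sup>2) / (norm (w + 1))\<^sup>2"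
    using n by (simp add: diff_divide_distrib)
  ultimately show ?thesis by simp
qed

lemma disc_of_half_plane_in_disc:
  assumes "norm \<sigma> = 1" "0 < Re w"
  shows "norm (disc_of_half_plane \<sigma> w) < 1"
proof -
  have "0 < 4 * Re w / (norm (w + 1))\<^sup>2" using assms plus_1_neq_0[OF assms(2)] by simp
  hence "(norm (disc_of_half_plane \<sigma> w))\<^sup>2 < 1" using one_minus_norm_disc_of_half_plane[OF assms] by linarith
  thus ?thesis by (simp add: abs_square_less_1)
qed

lemma
  assumes "norm \<sigma> = 1" "norm z < 1"
  shows disc_of_half_plane_inverse: "disc_of_half_plane \<sigma> (half_plane_of_disc \<sigma> z) = z"
    and half_plane_of_disc_pos: "0 < Re (half_plane_of_disc \<sigma> z)"
proof -
  have s: "\<sigma> - z \<noteq> 0" "\<sigma> \<noteq> 0" using assms by auto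
  have "half_plane_of_disc \<sigma> z - 1 = 2 * z / (\<sigma> - z)" "half_plane_of_disc \<sigma> z + 1 = 2 * \<sigma> / (\<sigma> - z)"
    using s by (simp_all add: half_plane_of_disc_def field_simps)
  thus "disc_of_half_plane \<sigma> (half_plane_of_disc \<sigma> z) = z"
    using s by (simp add: disc_of_half_plane_def)
  have "(norm z)\<^sup>2 < (norm \<sigma>)\<^sup>2" using assms by (simp add: abs_square_less_1)
  moreover have "(norm \<sigma>)\<^sup>2 - (norm z)\<^sup>2 = Re ((\<sigma> + z) * cnj (\<sigma> - z))"
    unfolding cmod_power2 by (simp add: power2_eq_square algebra_simps)
  ultimately have "0 < Re ((\<sigma> + z) * cnj (\<sigma> - z))" by linarith
  thus "0 < Re (half_plane_of_disc \<sigma> z)"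
    using s by (simp add: half_plane_of_disc_def complex_div_cnj[of _ "\<sigma> - z"] zero_less_divide_iff del: complex_cnj_diff)
qed

lemma disc_of_half_plane_inject:
  assumes "norm \<sigma> = 1" "0 < Re w" "0 < Re w'" "disc_of_half_plane \<sigma> w = disc_of_half_plane \<sigma> w'"
  shows "w = w'"
proof -
  have "- 2 * \<sigma> / (w + 1) = - 2 * \<sigma> / (w' + 1)"
    using disc_of_half_plane_minus[OF assms(2)] disc_of_half_plane_minus[OF assms(3)] assms(4) by metis
  moreover have "\<sigma> \<noteq> 0" using assms(1) by auto
  ultimately show ?thesis using plus_1_neq_0[OF assms(2)] plus_1_neq_0[OF assms(3)] by (simp add: field_simps)
qed

lemma disc_of_half_plane_holomorphic: "disc_of_half_plane \<sigma> holomorphic_on half_plane"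
  unfolding disc_of_half_plane_def[abs_def]
  by (intro holomorphic_intros) (auto simp: half_plane_def dest: plus_1_neq_0)

lemma norm_le_norm_plus_1:
  assumes "0 < Re w"
  shows "norm w \<le> norm (w + 1)"
proof (rule power2_le_imp_le)
  show "(norm w)\<^sup>2 \<le> (norm (w + 1))\<^sup>2"
    unfolding cmod_power2 using assms by (simp add: power2_eq_square algebra_simps)
qed simp

text \<open>Stolz regions and sectors correspond up to a factor 2 in the aperture, absorbed by
  letting all apertures occur. With n = \<open>norm (w + 1)\<close> one has
  \<open>dist z \<sigma> = 2 / n\<close>, and
  \<open>1 - (norm z)\<^sup>2 = 4 * Re w / n\<^sup>2\<close> lies between \<open>1 - norm z\<close>
  and twice that.\<close>

lemma eventually_angular_at:
  assumes s: "norm \<sigma> = 1"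
  shows "eventually P (angular_at \<sigma>) \<longleftrightarrow> (\<forall>\<^sub>F w in sector_infinity. P (disc_of_half_plane \<sigma> w))"
proof
  assume P: "eventually P (angular_at \<sigma>)"
  show "\<forall>\<^sub>F w in sector_infinity. P (disc_of_half_plane \<sigma> w)"
    unfolding eventually_sector_infinity
  proof (intro allI impI)
    fix N :: real assume N: "1 < N"
    have "eventually P (at \<sigma> within stolz_region \<sigma> (2 * N))"
      using P N by (auto simp: angular_at_def eventually_Sup)
    then obtain d where d: "0 < d" "\<And>z. z \<in> stolz_region \<sigma> (2 * N) \<Longrightarrow> z \<noteq> \<sigma> \<Longrightarrow> dist z \<sigma> < d \<Longrightarrow> P z"
      unfolding eventually_at by metis
    show "\<exists>r. \<forall>w. r \<le> norm w \<and> norm w < N * Re w \<longrightarrow> P (disc_of_half_plane \<sigma> w)"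
    proof (intro exI[of _ "max 1 (4 / d)"] allI impI)
      fix w assume w: "max 1 (4 / d) \<le> norm w \<and> norm w < N * Re w"
      have "0 < N * Re w" using w by linarith
      hence Rw: "0 < Re w" using N by (simp add: zero_less_mult_iff)
      define z where "z = disc_of_half_plane \<sigma> w"
      define n where "n = norm (w + 1)"
      have n: "norm w \<le> n" "n < 2 * N * Re w"
        using norm_le_norm_plus_1[OF Rw] norm_triangle_ineq[of w 1] w by (auto simp: n_def)
      have n0: "0 < n" "4 / d \<le> n" using n(1) w by linarith+
      have dz: "dist z \<sigma> = 2 / n"
        using disc_of_half_plane_minus[OF Rw, of \<sigma>] s by (simp add: z_def dist_norm norm_divide norm_mult n_def)
      have nz: "norm z < 1" unfolding z_def by (rule disc_of_half_plane_in_disc[OF s Rw])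
      have "1 - (norm z)\<^sup>2 = (1 - norm z) * (1 + norm z)" by (simp add: power2_eq_square algebra_simps)
      also have "\<dots> \<le> (1 - norm z) * 2" using nz by (intro mult_left_mono) auto
      finally have "4 * Re w / n\<^sup>2 \<le> 2 * (1 - norm z)"
        using one_minus_norm_disc_of_half_plane[OF s Rw] by (simp add: z_def n_def)
      hence "2 * N * (2 * Re w / n\<^sup>2) \<le> 2 * N * (1 - norm z)" using N by (intro mult_left_mono) auto
      moreover have "2 / n < 2 * N * (2 * Re w / n\<^sup>2)"
      proof -
        have "2 / n = 2 * n / n\<^sup>2" using n0 by (simp add: power2_eq_square)
        also have "\<dots> < 2 * (2 * N * Re w) / n\<^sup>2" using n n0 by (intro divide_strict_right_mono mult_strict_left_mono) auto
        finally show ?thesis by simp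
      qed
      ultimately have "z \<in> stolz_region \<sigma> (2 * N)" using dz nz by (simp add: stolz_region_def)
      moreover have "z \<noteq> \<sigma>" using nz s by auto
      moreover have "dist z \<sigma> < d"
      proof -
        have "2 / n \<le> d / 2" using n0 d by (simp add: field_simps)
        thus ?thesis using dz d by simp
      qed
      ultimately show "P (disc_of_half_plane \<sigma> w)" using d(2) by (simp add: z_def)
    qed
  qed
next
  assume P: "\<forall>\<^sub>F w in sector_infinity. P (disc_of_half_plane \<sigma> w)"
  have "eventually P (at \<sigma> within stolz_region \<sigma> M)" if M: "1 < M" for M
  proof -
    have M2: "1 < 2 * M" using M by simp
    obtain r where r: "0 < r" "\<And>w. r \<le> norm w \<Longrightarrow> norm w < 2 * M * Re w \<Longrightarrow> P (disc_of_half_plane \<sigma> w)"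
      by (rule eventually_sector_infinityD[OF P M2]) blast
    show ?thesis unfolding eventually_at
    proof (intro exI[of _ "2 / (r + 1)"] conjI ballI impI)
      show "0 < 2 / (r + 1)" using r by simp
      fix z assume z: "z \<in> stolz_region \<sigma> M" "z \<noteq> \<sigma> \<and> dist z \<sigma> < 2 / (r + 1)"
      have nz: "norm z < 1" and st: "dist z \<sigma> < M * (1 - norm z)" using z(1) by (auto simp: stolz_region_def)
      define w where "w = half_plane_of_disc \<sigma> z"
      have Rw: "0 < Re w" unfolding w_def by (rule half_plane_of_disc_pos[OF s nz])
      have zw: "z = disc_of_half_plane \<sigma> w" unfolding w_def by (rule disc_of_half_plane_inverse[OF s nz, symmetric])
      define n where "n = norm (w + 1)"
      have n0: "0 < n" using plus_1_neq_0[OF Rw] by (simp add: n_def)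
      have dz: "dist z \<sigma> = 2 / n"
        using disc_of_half_plane_minus[OF Rw, of \<sigma>] s by (simp add: zw dist_norm norm_divide norm_mult n_def)
      have "r + 1 < n" using z(2) dz n0 r by (simp add: field_simps)
      moreover have "n \<le> norm w + 1" using norm_triangle_ineq[of w 1] by (simp add: n_def)
      ultimately have "r \<le> norm w" by linarith
      moreover have "norm w < 2 * M * Re w"
      proof -
        have "(norm z)\<^sup>2 \<le> norm z" using nz by (simp add: power2_eq_square mult_left_le_one_le)
        hence "1 - norm z \<le> 1 - (norm z)\<^sup>2" by simp
        hence "1 - norm z \<le> 4 * Re w / n\<^sup>2"
          using one_minus_norm_disc_of_half_plane[OF s Rw] by (simp add: zw n_def)
        hence "M * (1 - norm z) \<le> M * (4 * Re w / n\<^sup>2)" using M by (intro mult_left_mono) auto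
        hence "2 / n < M * (4 * Re w / n\<^sup>2)" using st dz by simp
        hence "2 / n * n\<^sup>2 < M * (4 * Re w / n\<^sup>2) * n\<^sup>2" using n0 by (intro mult_strict_right_mono) auto
        hence "2 * n < 2 * (2 * M * Re w)" using n0 by (simp add: power2_eq_square)
        thus ?thesis using norm_le_norm_plus_1[OF Rw] by (simp add: n_def)
      qed
      ultimately show "P z" unfolding zw by (rule r(2))
    qed
  qed
  thus "eventually P (angular_at \<sigma>)" by (auto simp: angular_at_def eventually_Sup)
qed

lemma tendsto_angular_at_sector_iff:
  assumes "norm \<sigma> = 1"
  shows "(F \<longlongrightarrow> l) (angular_at \<sigma>) \<longleftrightarrow> ((\<lambda>w. F (disc_of_half_plane \<sigma> w)) \<longlongrightarrow> l) sector_infinity"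
  by (simp add: tendsto_def eventually_angular_at[OF assms])

section \<open>Residues and boundary fixed points as slopes\<close>

lemma filterlim_sector_infinity_at_infinity: "filterlim (\<lambda>w. w) at_infinity sector_infinity"
  unfolding filterlim_at_infinity[OF order.refl]
  using eventually_sector_infinity_norm_ge by blast

lemma tendsto_plus_1_div: "((\<lambda>w. (w + 1) / w) \<longlongrightarrow> 1) sector_infinity"
proof -
  have "((\<lambda>w. 1 + inverse w) \<longlongrightarrow> 1 + 0) sector_infinity"
    by (intro tendsto_intros filterlim_compose[OF tendsto_inverse_0 filterlim_sector_infinity_at_infinity])
  moreover have "\<forall>\<^sub>F w in sector_infinity. 1 + inverse w = (w + 1) / w"
    using eventually_sector_infinity_nonzero by eventually_elim (simp add: field_simps)
  ultimately show ?thesis by (auto intro: Lim_transform_eventually)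
qed

text \<open>The factor -2 \<sigma> is the residue at \<sigma> of the half-plane coordinate w itself:
  \<open>z - \<sigma> = - 2 * \<sigma> / (w + 1)\<close>, and (w + 1) / w tends to 1.\<close>

lemma tendsto_residue_iff_angular_slope:
  assumes s: "norm \<sigma> = 1"
  shows "((\<lambda>z. (z - \<sigma>) * f z) \<longlongrightarrow> - 2 * \<sigma> * a) (angular_at \<sigma>) \<longleftrightarrow>
    angular_slope (\<lambda>w. f (disc_of_half_plane \<sigma> w)) a" (is "?L \<longleftrightarrow> angular_slope ?g a")
proof -
  have s0: "\<sigma> \<noteq> 0" using s by auto
  have "?L \<longleftrightarrow> ((\<lambda>w. - 2 * \<sigma> / (w + 1) * ?g w) \<longlongrightarrow> - 2 * \<sigma> * a) sector_infinity"
    unfolding tendsto_angular_at_sector_iff[OF s]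
    by (intro tendsto_cong eventually_mono[OF eventually_sector_infinity_Re_pos])
       (simp add: disc_of_half_plane_minus)
  also have "\<dots> \<longleftrightarrow> ((\<lambda>w. ?g w / w) \<longlongrightarrow> a) sector_infinity"
  proof
    assume "((\<lambda>w. - 2 * \<sigma> / (w + 1) * ?g w) \<longlongrightarrow> - 2 * \<sigma> * a) sector_infinity"
    from tendsto_mult[OF tendsto_mult_left[OF this, of "1 / (- 2 * \<sigma>)"] tendsto_plus_1_div]
    have "((\<lambda>w. 1 / (- 2 * \<sigma>) * (- 2 * \<sigma> / (w + 1) * ?g w) * ((w + 1) / w)) \<longlongrightarrow> a) sector_infinity"
      using s0 by simp
    moreover have "\<forall>\<^sub>F w in sector_infinity. 1 / (- 2 * \<sigma>) * (- 2 * \<sigma> / (w + 1) * ?g w) * ((w + 1) / w) = ?g w / w"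
      using eventually_sector_infinity_Re_pos by eventually_elim (use plus_1_neq_0 s0 in auto)
    ultimately show "((\<lambda>w. ?g w / w) \<longlongrightarrow> a) sector_infinity" by (rule Lim_transform_eventually)
  next
    assume "((\<lambda>w. ?g w / w) \<longlongrightarrow> a) sector_infinity"
    from tendsto_divide[OF tendsto_mult_left[OF this, of "- 2 * \<sigma>"] tendsto_plus_1_div]
    have "((\<lambda>w. - 2 * \<sigma> * (?g w / w) / ((w + 1) / w)) \<longlongrightarrow> - 2 * \<sigma> * a) sector_infinity" by simp
    moreover have "\<forall>\<^sub>F w in sector_infinity. - 2 * \<sigma> * (?g w / w) / ((w + 1) / w) = - 2 * \<sigma> / (w + 1) * ?g w"
      using eventually_sector_infinity_Re_pos by eventually_elim auto
    ultimately show "((\<lambda>w. - 2 * \<sigma> / (w + 1) * ?g w) \<longlongrightarrow> - 2 * \<sigma> * a) sector_infinity" by (rule Lim_transform_eventually)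
  qed
  finally show ?thesis by (simp add: angular_slope_def)
qed

lemma has_angular_simple_pole_iff:
  assumes s: "norm \<sigma> = 1"
  shows "has_angular_simple_pole f \<sigma> \<longleftrightarrow> (\<exists>a. a \<noteq> 0 \<and> angular_slope (\<lambda>w. f (disc_of_half_plane \<sigma> w)) a)"
proof -
  have s0: "\<sigma> \<noteq> 0" using s by auto
  show ?thesis
  proof
    assume "has_angular_simple_pole f \<sigma>"
    then obtain c where c: "c \<noteq> 0" "((\<lambda>z. (z - \<sigma>) * f z) \<longlongrightarrow> c) (angular_at \<sigma>)"
      by (auto simp: has_angular_simple_pole_def)
    have "c = - 2 * \<sigma> * (c / (- 2 * \<sigma>))" using s0 by simp
    with c have "((\<lambda>z. (z - \<sigma>) * f z) \<longlongrightarrow> - 2 * \<sigma> * (c / (- 2 * \<sigma>))) (angular_at \<sigma>)" by simp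
    hence "angular_slope (\<lambda>w. f (disc_of_half_plane \<sigma> w)) (c / (- 2 * \<sigma>))"
      by (rule iffD1[OF tendsto_residue_iff_angular_slope[OF s]])
    moreover have "c / (- 2 * \<sigma>) \<noteq> 0" using c(1) s0 by simp
    ultimately show "\<exists>a. a \<noteq> 0 \<and> angular_slope (\<lambda>w. f (disc_of_half_plane \<sigma> w)) a" by blast
  next
    assume "\<exists>a. a \<noteq> 0 \<and> angular_slope (\<lambda>w. f (disc_of_half_plane \<sigma> w)) a"
    then obtain a where "a \<noteq> 0" "((\<lambda>z. (z - \<sigma>) * f z) \<longlongrightarrow> - 2 * \<sigma> * a) (angular_at \<sigma>)"
      using tendsto_residue_iff_angular_slope[OF s] by blast
    thus "has_angular_simple_pole f \<sigma>" unfolding has_angular_simple_pole_def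
      using s0 by (intro exI[of _ "- 2 * \<sigma> * a"]) auto
  qed
qed

lemma angular_residue_eq_slope:
  assumes "norm \<sigma> = 1" "angular_slope (\<lambda>w. f (disc_of_half_plane \<sigma> w)) a"
  shows "angular_residue f \<sigma> = - 2 * \<sigma> * a"
  using angular_residue_eqI[OF assms(1)] tendsto_residue_iff_angular_slope[OF assms(1)] assms(2) by blast

text \<open>The difference quotient of \<phi> is \<open>(w + 1) / (h w + 1)\<close>, and its
  reciprocal tends to c in any case. A finite limit l therefore satisfies l c = 1, so c is not 0.
  For c > 0 the limit is 1 / c, and h w tends to infinity in sectors, so \<phi> tends to
  \<sigma>.\<close>

lemma boundary_regular_fixed_point_iff:
  assumes s: "norm \<sigma> = 1" and hpos: "\<And>w. 0 < Re w \<Longrightarrow> 0 < Re (h w)"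
    and \<phi>: "\<And>w. 0 < Re w \<Longrightarrow> \<phi> (disc_of_half_plane \<sigma> w) = disc_of_half_plane \<sigma> (h w)"
    and h: "angular_slope h (of_real c)" and c: "0 \<le> c"
  shows "boundary_regular_fixed_point \<phi> \<sigma> \<longleftrightarrow> 0 < c"
proof -
  have s0: "\<sigma> \<noteq> 0" using s by auto
  have quot: "(\<phi> (disc_of_half_plane \<sigma> w) - \<sigma>) / (disc_of_half_plane \<sigma> w - \<sigma>) = (w + 1) / (h w + 1)"
    if "0 < Re w" for w
    unfolding \<phi>[OF that] disc_of_half_plane_minus[OF that] disc_of_half_plane_minus[OF hpos[OF that]]
    using s0 by simp
  have "((\<lambda>w. h w / w + inverse w) \<longlongrightarrow> of_real c + 0) sector_infinity"
    using h unfolding angular_slope_def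
    by (intro tendsto_intros filterlim_compose[OF tendsto_inverse_0 filterlim_sector_infinity_at_infinity])
  moreover have "\<forall>\<^sub>F w in sector_infinity. h w / w + inverse w = (h w + 1) / w"
    by (rule always_eventually) (simp add: add_divide_distrib inverse_eq_divide)
  ultimately have "((\<lambda>w. (h w + 1) / w) \<longlongrightarrow> of_real c) sector_infinity" by (auto intro: Lim_transform_eventually)
  from tendsto_divide[OF this tendsto_plus_1_div]
  have "((\<lambda>w. (h w + 1) / w / ((w + 1) / w)) \<longlongrightarrow> of_real c) sector_infinity" by simp
  moreover have "\<forall>\<^sub>F w in sector_infinity. (h w + 1) / w / ((w + 1) / w) = (h w + 1) / (w + 1)"
    using eventually_sector_infinity_nonzero by eventually_elim simp
  ultimately have hw: "((\<lambda>w. (h w + 1) / (w + 1)) \<longlongrightarrow> of_real c) sector_infinity"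
    by (rule Lim_transform_eventually)
  show ?thesis
  proof
    assume "boundary_regular_fixed_point \<phi> \<sigma>"
    then obtain l where "((\<lambda>z. (\<phi> z - \<sigma>) / (z - \<sigma>)) \<longlongrightarrow> l) (angular_at \<sigma>)"
      by (auto simp: boundary_regular_fixed_point_def)
    hence "((\<lambda>w. (\<phi> (disc_of_half_plane \<sigma> w) - \<sigma>) / (disc_of_half_plane \<sigma> w - \<sigma>)) \<longlongrightarrow> l) sector_infinity"
      by (simp only: tendsto_angular_at_sector_iff[OF s])
    from tendsto_mult[OF this hw]
    have "((\<lambda>w. (\<phi> (disc_of_half_plane \<sigma> w) - \<sigma>) / (disc_of_half_plane \<sigma> w - \<sigma>) * ((h w + 1) / (w + 1))) \<longlongrightarrow> l * of_real c) sector_infinity" .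
    moreover have "\<forall>\<^sub>F w in sector_infinity.
        (\<phi> (disc_of_half_plane \<sigma> w) - \<sigma>) / (disc_of_half_plane \<sigma> w - \<sigma>) * ((h w + 1) / (w + 1)) = 1"
      using eventually_sector_infinity_Re_pos
    proof eventually_elim
      case (elim w)
      show ?case using plus_1_neq_0[OF elim] plus_1_neq_0[OF hpos[OF elim]] by (simp add: quot[OF elim])
    qed
    ultimately have "((\<lambda>w. 1) \<longlongrightarrow> l * of_real c) sector_infinity" by (rule Lim_transform_eventually)
    hence "l * of_real c = 1" using tendsto_unique[OF sector_infinity_neq_bot _ tendsto_const] by metis
    hence "c \<noteq> 0" by auto
    thus "0 < c" using c by simp
  next
    assume c0: "0 < c"
    have d0: "((\<lambda>w. - 2 * \<sigma> / (w + 1)) \<longlongrightarrow> 0) sector_infinity"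
    proof (rule tendsto_divide_0[OF tendsto_const])
      have "filterlim (\<lambda>w. w + 1) at_infinity sector_infinity"
        by (rule tendsto_add_filterlim_at_infinity'[OF filterlim_sector_infinity_at_infinity tendsto_const])
      thus "filterlim (\<lambda>w. w + 1) at_infinity sector_infinity" .
    qed
    have "((\<lambda>w. - 2 * \<sigma> / (h w + 1) + \<sigma>) \<longlongrightarrow> 0 + \<sigma>) sector_infinity"
      by (intro tendsto_add tendsto_const filterlim_compose[OF d0 filterlim_angular_slope[OF h c0]])
    moreover have "\<forall>\<^sub>F w in sector_infinity. - 2 * \<sigma> / (h w + 1) + \<sigma> = \<phi> (disc_of_half_plane \<sigma> w)"
      using eventually_sector_infinity_Re_pos
    proof eventually_elim
      case (elim w)
      show ?case using disc_of_half_plane_minus[OF hpos[OF elim], of \<sigma>] by (simp add: \<phi>[OF elim] algebra_simps)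
    qed
    ultimately have "((\<lambda>w. \<phi> (disc_of_half_plane \<sigma> w)) \<longlongrightarrow> \<sigma>) sector_infinity"
      by (auto intro: Lim_transform_eventually)
    moreover have "((\<lambda>w. (\<phi> (disc_of_half_plane \<sigma> w) - \<sigma>) / (disc_of_half_plane \<sigma> w - \<sigma>)) \<longlongrightarrow> inverse (of_real c)) sector_infinity"
    proof -
      have "((\<lambda>w. inverse ((h w + 1) / (w + 1))) \<longlongrightarrow> inverse (of_real c)) sector_infinity"
        using c0 by (intro tendsto_inverse hw) simp
      moreover have "\<forall>\<^sub>F w in sector_infinity. inverse ((h w + 1) / (w + 1))
          = (\<phi> (disc_of_half_plane \<sigma> w) - \<sigma>) / (disc_of_half_plane \<sigma> w - \<sigma>)"
        using eventually_sector_infinity_Re_pos by eventually_elim (simp add: quot)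
      ultimately show ?thesis by (rule Lim_transform_eventually)
    qed
    ultimately show "boundary_regular_fixed_point \<phi> \<sigma>"
      unfolding boundary_regular_fixed_point_def tendsto_angular_at_sector_iff[OF s] by blast
  qed
qed

text \<open>A compact subset of the half-plane has compact image in the disc, and the majorant
  belonging to that image yields \<open>I\<close> by integration.\<close>

lemma loewner_chain_half_plane_chain:
  assumes f: "loewner_chain f" and s: "norm \<sigma> = 1"
  shows "half_plane_chain (\<lambda>t w. f t (disc_of_half_plane \<sigma> w))"
proof -
  let ?\<kappa> = "disc_of_half_plane \<sigma>"
  obtain d where d: "1 \<le> d" "loewner_chain_of_order d f" using f by (auto simp: loewner_chain_def)
  have hol: "f t holomorphic_on \<bbbD>" and inj: "inj_on (f t) \<bbbD>" if "0 \<le> t" for t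
    using d(2) that by (auto simp: loewner_chain_of_order_def)
  have sub: "f s ` \<bbbD> \<subseteq> f t ` \<bbbD>" if "0 \<le> s" "s < t" for s t
    using d(2) that by (simp add: loewner_chain_of_order_def)
  have in_disc: "?\<kappa> w \<in> \<bbbD>" if "w \<in> half_plane" for w
    using disc_of_half_plane_in_disc[OF s, of w] that by (simp add: half_plane_def)
  have im: "?\<kappa> ` half_plane = \<bbbD>"
  proof (intro equalityI subsetI)
    fix z assume "z \<in> \<bbbD>"
    hence z: "norm z < 1" by simp
    show "z \<in> ?\<kappa> ` half_plane"
      by (rule image_eqI[of _ _ "half_plane_of_disc \<sigma> z"])
         (use disc_of_half_plane_inverse[OF s z] half_plane_of_disc_pos[OF s z] in \<open>auto simp: half_plane_def\<close>)
  qed (use in_disc in auto)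
  show ?thesis
  proof
    fix t :: real assume t: "0 \<le> t"
    show "(\<lambda>w. f t (?\<kappa> w)) holomorphic_on half_plane"
      using holomorphic_on_compose_gen[OF disc_of_half_plane_holomorphic hol[OF t], of \<sigma>] im by (simp add: o_def)
    have "inj_on ?\<kappa> half_plane"
      using disc_of_half_plane_inject[OF s] by (auto simp: inj_on_def half_plane_def)
    thus "inj_on (\<lambda>w. f t (?\<kappa> w)) half_plane"
      using comp_inj_on[of ?\<kappa> half_plane "f t"] inj[OF t] im by (simp add: o_def)
  next
    fix u t :: real assume ut: "0 \<le> u" "u \<le> t"
    have "f u ` \<bbbD> \<subseteq> f t ` \<bbbD>" using sub[OF ut(1), of t] ut by (cases "u = t") auto
    thus "(\<lambda>w. f u (?\<kappa> w)) ` half_plane \<subseteq> (\<lambda>w. f t (?\<kappa> w)) ` half_plane"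
      unfolding im[symmetric] image_image .
  next
    fix K :: "complex set" and T :: real
    assume K: "compact K" "K \<subseteq> half_plane" and T: "0 < T"
    have "compact (?\<kappa> ` K)"
      by (intro compact_continuous_image continuous_on_subset[OF _ K(2)] K
          holomorphic_on_imp_continuous_on disc_of_half_plane_holomorphic)
    moreover have "?\<kappa> ` K \<subseteq> \<bbbD>" using im K(2) by blast
    ultimately obtain k where k: "in_Ld d T k" "\<And>\<xi>. \<xi> \<in> {0..T} \<Longrightarrow> 0 \<le> k \<xi>"
      "\<And>z s t. z \<in> ?\<kappa> ` K \<Longrightarrow> 0 \<le> s \<Longrightarrow> s \<le> t \<Longrightarrow> t \<le> T \<Longrightarrow> norm (f s z - f t z) \<le> integral\<^sup>L (lebesgue_on {s..t}) k"
      using d(2) T unfolding loewner_chain_of_order_def by meson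
    have int: "integrable (lebesgue_on {0..T}) k" by (rule in_Ld_imp_integrable[OF k(1) d(1) k(2)])
    have k_on: "k integrable_on {0..T}" using integrable_on_lebesgue_on[OF int] by simp
    have eq: "integral\<^sup>L (lebesgue_on {s..t}) k = integral {0..t} k - integral {0..s} k"
      if "0 \<le> s" "s \<le> t" "t \<le> T" for s t
    proof -
      have "integrable (lebesgue_on {s..t}) k"
        by (rule integrable_subinterval[OF int]) (use that in auto)
      hence "integral\<^sup>L (lebesgue_on {s..t}) k = integral {s..t} k"
        by (rule lebesgue_integral_eq_integral) simp
      moreover have "integral {0..s} k + integral {s..t} k = integral {0..t} k"
        using that by (intro Henstock_Kurzweil_Integration.integral_combine integrable_on_subinterval[OF k_on]) auto
      ultimately show ?thesis by simp
    qed
    show "\<exists>I::real \<Rightarrow> real. abs_continuous_on_interval 0 T I \<and>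
        (\<forall>z\<in>K. \<forall>s t. 0 \<le> s \<and> s \<le> t \<and> t \<le> T \<longrightarrow> norm (f s (?\<kappa> z) - f t (?\<kappa> z)) \<le> I t - I s)"
      using abs_continuous_on_interval_indefinite_integral[OF int k(2)] T k(3) eq
      by (intro exI[of _ "\<lambda>t. integral {0..t} k"]) fastforce
  qed
qed

theorem corollary6p1:
  fixes f :: "real \<Rightarrow> complex \<Rightarrow> complex"
    and \<phi> :: "real \<Rightarrow> real \<Rightarrow> complex \<Rightarrow> complex"
    and \<sigma> :: complex
    and t\<^sub>0 :: real
  assumes "loewner_chain f"
    and "\<phi> = evolution_family_of f"
    and "norm \<sigma> = 1"
    and "t\<^sub>0 \<ge> 0"
    and "has_angular_simple_pole (f t\<^sub>0) \<sigma>"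
  shows "let cond_i =
               (\<forall>s\<ge>0. has_angular_simple_pole (f s) \<sigma> \<and>
                  Limsup (at_right s)
                    (\<lambda>t. ereal \<bar>Arg (angular_residue (f s) \<sigma> / angular_residue (f t) \<sigma>)\<bar>)
                  < ereal pi);
             cond_ii = family_boundary_regular_fixed_point \<phi> \<sigma>
         in (cond_i \<longleftrightarrow> cond_ii) \<and>
            (cond_i \<and> cond_ii \<longrightarrow>
               locally_abs_continuous_on_nonneg (\<lambda>t. angular_residue (f t) \<sigma>) \<and>
               (\<exists>\<theta>. \<forall>t\<ge>0. Arg (angular_residue (f t) \<sigma>) = \<theta>))"
proof -
  define g where "g = (\<lambda>t w. f t (disc_of_half_plane \<sigma> w))"
  note s = \<open>norm \<sigma> = 1\<close>
  have s0: "\<sigma> \<noteq> 0" using s by auto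
  interpret half_plane_chain g
    unfolding g_def by (rule loewner_chain_half_plane_chain[OF assms(1) s])
  have pole: "has_angular_simple_pole (f t) \<sigma> \<longleftrightarrow> (\<exists>a. a \<noteq> 0 \<and> angular_slope (g t) a)" for t
    unfolding g_def by (rule has_angular_simple_pole_iff[OF s])
  have res: "angular_residue (f t) \<sigma> = - 2 * \<sigma> * a" if "angular_slope (g t) a" for t a
    using that unfolding g_def by (rule angular_residue_eq_slope[OF s])
  have \<phi>: "\<phi> u t (disc_of_half_plane \<sigma> w) = disc_of_half_plane \<sigma> (transition u t w)"
    if ut: "0 \<le> u" "u \<le> t" and w: "0 < Re w" for u t w
  proof -
    have "inj_on (f t) \<bbbD>"
      using assms(1) ut by (auto simp: loewner_chain_def loewner_chain_of_order_def)
    moreover have "disc_of_half_plane \<sigma> (transition u t w) \<in> \<bbbD>"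
      using disc_of_half_plane_in_disc[OF s transition_pos[OF ut w]] by simp
    moreover have "f u (disc_of_half_plane \<sigma> w) = f t (disc_of_half_plane \<sigma> (transition u t w))"
      using transition_eq[OF ut w] by (simp add: g_def)
    ultimately show ?thesis by (simp add: assms(2) evolution_family_of_def inv_into_f_f)
  qed
  have ii: "family_boundary_regular_fixed_point \<phi> \<sigma> \<longleftrightarrow> (\<forall>u t. 0 \<le> u \<and> u \<le> t \<longrightarrow> 0 < dilation u t)"
    unfolding family_boundary_regular_fixed_point_def
    using boundary_regular_fixed_point_iff[OF s transition_pos \<phi> dilation_slope dilation_nonneg] by blast
  define cond_i where "cond_i \<longleftrightarrow> (\<forall>s\<ge>0. has_angular_simple_pole (f s) \<sigma> \<and>
      Limsup (at_right s) (\<lambda>t. ereal \<bar>Arg (angular_residue (f s) \<sigma> / angular_residue (f t) \<sigma>)\<bar>) < ereal pi)"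
  have dir1: "0 < dilation u t" if ci: cond_i and ut: "0 \<le> u" "u \<le> t" for u t
  proof -
    have "\<forall>t. \<exists>a. 0 \<le> t \<longrightarrow> a \<noteq> 0 \<and> angular_slope (g t) a" using ci pole by (auto simp: cond_i_def)
    then obtain a where a: "\<And>t. 0 \<le> t \<Longrightarrow> a t \<noteq> 0" "\<And>t. 0 \<le> t \<Longrightarrow> angular_slope (g t) (a t)" by metis
    have "\<forall>\<^sub>F t in at_right v. a v / a t \<notin> \<real>\<^sub>\<le>\<^sub>0" if v: "0 \<le> v" for v
    proof -
      \<comment> \<open>A limit superior below pi means that \<open>Arg\<close> eventually differs
        from pi; since the quotient is also nonzero, it is off the closed negative axis.\<close>
      have "Limsup (at_right v) (\<lambda>t. ereal \<bar>Arg (angular_residue (f v) \<sigma> / angular_residue (f t) \<sigma>)\<bar>) < ereal pi"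
        using ci v by (auto simp: cond_i_def)
      from Limsup_lessD[OF this] show ?thesis using eventually_at_right_less[of v]
      proof eventually_elim
        case (elim t)
        hence t: "0 \<le> t" using v by simp
        have "angular_residue (f v) \<sigma> / angular_residue (f t) \<sigma> = a v / a t"
          using res[OF a(2)[OF v]] res[OF a(2)[OF t]] s0 by simp
        hence "Arg (a v / a t) \<noteq> pi" using elim by auto
        hence "\<not> (Re (a v / a t) < 0 \<and> Im (a v / a t) = 0)" using Arg_eq_pi by blast
        moreover have "a v / a t \<noteq> 0" using a(1) v t by simp
        ultimately show ?case by (auto simp: complex_nonpos_Reals_iff complex_eq_iff simp del: Re_divide Im_divide)
      qed
    qed
    thus ?thesis using a ut by (intro dilation_pos_of_right_condition[of a]) auto
  qed
  have rest: "cond_i \<and> locally_abs_continuous_on_nonneg (\<lambda>t. angular_residue (f t) \<sigma>) \<and>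
      (\<exists>\<theta>. \<forall>t\<ge>0. Arg (angular_residue (f t) \<sigma>) = \<theta>)"
    if pos: "\<And>u t. 0 \<le> u \<Longrightarrow> u \<le> t \<Longrightarrow> 0 < dilation u t"
  proof -
    obtain b where b: "b \<noteq> 0" "angular_slope (g t\<^sub>0) b" using assms(5) pole by blast
    \<comment> \<open>The pole given at \<open>t\<^sub>0\<close> is first pulled back to time 0;
      pushing forward from there reaches times before and after \<open>t\<^sub>0\<close>
      alike.\<close>
    define a where "a = b * of_real (dilation 0 t\<^sub>0)"
    have a0: "a \<noteq> 0" using b pos[of 0 t\<^sub>0] assms(4) by (simp add: a_def)
    have sl0: "angular_slope (g 0) a"
      unfolding a_def using assms(4) pos by (intro slope_pullback b) auto
    have sl: "angular_slope (g t) (a / of_real (dilation 0 t))" if "0 \<le> t" for t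
      using that pos sl0 by (intro slope_pushforward) auto
    \<comment> \<open>All residues are positive multiples of one number: quotients have argument 0,
      the argument is constant, and absolute continuity is inherited from
      \<open>1 / dilation 0 t\<close>.\<close>
    have R: "angular_residue (f t) \<sigma> = of_real (1 / dilation 0 t) * (- 2 * \<sigma> * a)" if "0 \<le> t" for t
      using res[OF sl[OF that]] by (simp add: divide_inverse)
    have ci: cond_i unfolding cond_i_def
    proof (intro allI impI conjI)
      fix v :: real assume v: "0 \<le> v"
      show "has_angular_simple_pole (f v) \<sigma>"
        unfolding pole using sl[OF v] a0 pos[of 0 v] v by (intro exI[of _ "a / of_real (dilation 0 v)"]) auto
      have "\<forall>\<^sub>F t in at_right v. ereal \<bar>Arg (angular_residue (f v) \<sigma> / angular_residue (f t) \<sigma>)\<bar> = 0"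
        using eventually_at_right_less[of v]
      proof eventually_elim
        case (elim t)
        hence t: "0 \<le> t" using v by simp
        have "angular_residue (f v) \<sigma> / angular_residue (f t) \<sigma> = of_real (dilation 0 t / dilation 0 v)"
          using R[OF v] R[OF t] a0 s0 by simp
        moreover have "0 < dilation 0 t / dilation 0 v" using pos v t by simp
        ultimately have "Arg (angular_residue (f v) \<sigma> / angular_residue (f t) \<sigma>) = 0"
          by (simp only: Arg_of_real) simp
        thus ?case by simp
      qed
      hence "Limsup (at_right v) (\<lambda>t. ereal \<bar>Arg (angular_residue (f v) \<sigma> / angular_residue (f t) \<sigma>)\<bar>)
          = Limsup (at_right v) (\<lambda>t. 0)"
        by (rule Limsup_eq)
      also have "\<dots> = 0" by (rule Limsup_const[OF trivial_limit_at_right_real])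
      finally show "Limsup (at_right v) (\<lambda>t. ereal \<bar>Arg (angular_residue (f v) \<sigma> / angular_residue (f t) \<sigma>)\<bar>) < ereal pi"
        by simp
    qed
    moreover have "locally_abs_continuous_on_nonneg (\<lambda>t. angular_residue (f t) \<sigma>)"
      unfolding locally_abs_continuous_on_nonneg_def
    proof (intro allI impI)
      fix x y :: real assume xy: "0 \<le> x \<and> x \<le> y"
      \<comment> \<open>\<open>y + 1\<close> replaces y because y may be 0, while
        \<open>abs_continuous_inverse_dilation\<close> is about a nondegenerate
        \<open>{0..T}\<close>.\<close>
      have "0 < y + 1" using xy by simp
      have "abs_continuous_on_interval x y (\<lambda>t. 1 / dilation 0 t)"
        by (rule abs_continuous_on_interval_subset[OF abs_continuous_inverse_dilation[OF \<open>0 < y + 1\<close> pos]])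
           (use xy in auto)
      thus "abs_continuous_on_interval x y (\<lambda>t. angular_residue (f t) \<sigma>)"
      proof (rule abs_continuous_on_interval_dominated[where C="norm (- 2 * \<sigma> * a)"])
        fix u v assume "x \<le> u" "u \<le> v" "v \<le> y"
        hence "0 \<le> u" "0 \<le> v" using xy by auto
        hence "angular_residue (f v) \<sigma> - angular_residue (f u) \<sigma>
            = of_real (1 / dilation 0 v - 1 / dilation 0 u) * (- 2 * \<sigma> * a)"
          by (simp only: R of_real_diff left_diff_distrib)
        thus "norm (angular_residue (f v) \<sigma> - angular_residue (f u) \<sigma>)
            \<le> norm (- 2 * \<sigma> * a) * norm (1 / dilation 0 v - 1 / dilation 0 u)"
          by (simp only: norm_mult norm_of_real real_norm_def mult.commute order.refl)
      qed
    qed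
    moreover have "Arg (angular_residue (f t) \<sigma>) = Arg (- 2 * \<sigma> * a)" if t: "0 \<le> t" for t
      unfolding R[OF t] using pos[of 0 t] t by (intro Arg_times_of_real) simp
    ultimately show ?thesis by blast
  qed
  show ?thesis
    unfolding Let_def cond_i_def[symmetric] ii using dir1 rest by blast
qed

end
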